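(* Let $D\subset\mathbb{C}^2$ be a plane curve and let $f\in\mathfrak{m}^3$ be a reduced local equation for $D$ around $0$. Then there is no system of local coordinates $(x,y)$ of $\mathbb{C}^2$ centered at $0$ together with a basis $\{\delta_1,\delta_2\}$ of $\operatorname{Der}_f$ whose linear parts in these coordinates are $x\partial_x$ and $(ax+y)\partial_x$ for some $a\in\mathbb{C}$. Consequently, there exists a basis $\{\delta_1,\delta_2\}$ of $\operatorname{Der}_f$ such that $\delta_1$ has no linear part (i.e. its linear part is zero).
   Context: $\mathcal{O}=\mathcal{O}_{\mathbb{C}^2,0}$ is the ring of convergent power series in two variables, $\mathfrak m$ its maximal ideal. "Reduced" means without repeated factors. $\operatorname{Der}_f$ is the $\mathcal{O}$-module of $\mathbb{C}$-derivations $\delta$ of $\mathcal{O}$ with $\delta(f)\in\mathcal{O}f$; it is free of rank $2$. In coordinates $(x,y)$, the linear part of a derivation $\delta=a\,\partial_x+b\,\partial_y$ is $\delta_0=a_1\partial_x+b_1\partial_y$, where $a_1,b_1$ are the homogeneous components of degree $1$ of $a,b$. *)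

theory Defs
  imports
    "HOL-Analysis.Analysis"
    "HOL-Computational_Algebra.Formal_Power_Series"
    "HOL-Computational_Algebra.Squarefree"
begin

unbundle no vec_syntax
unbundle fps_syntax

section \<open>The ring of convergent power series in two variables\<close>

text \<open>
  A formal power series in two variables is an iterated one-variable series: the coefficient of
  \<open>X^i Y^j\<close> in \<open>F\<close> is \<open>F $ i $ j\<close>.
\<close>

definition convergent2 :: "complex fps fps \<Rightarrow> bool" where
  "convergent2 F \<longleftrightarrow> (\<exists>r>0. \<forall>z w. norm z < r \<longrightarrow> norm w < r \<longrightarrow>
     (\<lambda>(i, j). F $ i $ j * z ^ i * w ^ j) summable_on UNIV)"

lemma convergent2_iff_bound:
  "convergent2 F \<longleftrightarrow> (\<exists>C R. C \<ge> 0 \<and> R > 0 \<and> (\<forall>i j. norm (F $ i $ j) \<le> C * R ^ (i + j)))"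
proof
  assume "convergent2 F"
  then obtain r where r: "r > 0" and s: "\<And>z w. norm z < r \<Longrightarrow> norm w < r \<Longrightarrow>
      (\<lambda>(i, j). F $ i $ j * z ^ i * w ^ j) summable_on UNIV"
    unfolding convergent2_def by blast
  define q where "q = r / 2"
  have q: "q > 0" "q < r" using r by (auto simp: q_def)
  define t where "t = (\<lambda>(i, j). F $ i $ j * (of_real q) ^ i * (of_real q) ^ j)"
  have "t summable_on UNIV"
    unfolding t_def using q by (intro s) auto
  hence a: "(\<lambda>p. norm (t p)) summable_on UNIV"
    by (simp add: summable_on_iff_abs_summable_on_complex)
  define C where "C = infsum (\<lambda>p. norm (t p)) UNIV"
  have le: "norm (t p) \<le> C" for p
  proof -
    have "sum (\<lambda>p. norm (t p)) {p} \<le> C"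
      unfolding C_def by (rule finite_sum_le_infsum[OF a]) auto
    thus ?thesis by simp
  qed
  have "norm (F $ i $ j) \<le> C * (1 / q) ^ (i + j)" for i j
  proof -
    have "norm (F $ i $ j) * q ^ (i + j) \<le> C"
      using le[of "(i, j)"] q by (simp add: t_def norm_mult norm_power power_add mult.assoc)
    thus ?thesis using q by (simp add: power_one_over divide_simps)
  qed
  moreover have "C \<ge> 0" using le[of undefined] norm_ge_zero order_trans by blast
  ultimately show "\<exists>C R. C \<ge> 0 \<and> R > 0 \<and> (\<forall>i j. norm (F $ i $ j) \<le> C * R ^ (i + j))"
    using q by (intro exI[of _ C] exI[of _ "1 / q"]) auto
next
  assume "\<exists>C R. C \<ge> 0 \<and> R > 0 \<and> (\<forall>i j. norm (F $ i $ j) \<le> C * R ^ (i + j))"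
  then obtain C R where C: "C \<ge> 0" and R: "R > 0"
    and b: "\<And>i j. norm (F $ i $ j) \<le> C * R ^ (i + j)" by blast
  have "(\<lambda>(i, j). F $ i $ j * z ^ i * w ^ j) summable_on UNIV"
    if z: "norm z < 1 / R" and w: "norm w < 1 / R" for z w
  proof -
    define u v :: real where "u = R * norm z" and "v = R * norm w"
    have u: "0 \<le> u" "u < 1" and v: "0 \<le> v" "v < 1"
      using z w R by (auto simp: u_def v_def field_simps)
    have g: "((\<lambda>n. q ^ n) has_sum (1 / (1 - q))) UNIV" if "0 \<le> q" "q < 1" for q :: real
      using that geometric_sums[of q] summable_geometric[of q]
      by (intro norm_summable_imp_has_sum) (auto simp: norm_power)
    have "((\<lambda>(i, j). C * (u ^ i * v ^ j)) has_sum (C * (1 / (1 - u) * (1 / (1 - v)))))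
            (Sigma UNIV (\<lambda>_. UNIV))"
    proof (rule has_sum_SigmaI[where g = "\<lambda>i. C * (u ^ i * (1 / (1 - v)))"])
      show "((\<lambda>j. case (i, j) of (i, j) \<Rightarrow> C * (u ^ i * v ^ j)) has_sum
              C * (u ^ i * (1 / (1 - v)))) UNIV" for i
        unfolding prod.case by (intro has_sum_cmult_right g v)
      show "((\<lambda>i. C * (u ^ i * (1 / (1 - v)))) has_sum C * (1 / (1 - u) * (1 / (1 - v)))) UNIV"
        by (intro has_sum_cmult_right has_sum_cmult_left g u)
      show "(\<lambda>(i, j). C * (u ^ i * v ^ j)) summable_on Sigma UNIV (\<lambda>_. UNIV)"
      proof (rule summable_on_SigmaI[where g = "\<lambda>i. C * (u ^ i * (1 / (1 - v)))"])
        show "((\<lambda>j. case (i, j) of (i, j) \<Rightarrow> C * (u ^ i * v ^ j)) has_sum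
                C * (u ^ i * (1 / (1 - v)))) UNIV" for i
          unfolding prod.case by (intro has_sum_cmult_right g v)
        show "(\<lambda>i. C * (u ^ i * (1 / (1 - v)))) summable_on UNIV"
          by (intro summable_on_cmult_right summable_on_cmult_left has_sum_imp_summable[OF g] u)
      qed (use C u v in auto)
    qed
    hence "(\<lambda>(i, j). C * (u ^ i * v ^ j)) summable_on UNIV"
      by (auto dest: has_sum_imp_summable)
    hence "(\<lambda>p. norm (case p of (i, j) \<Rightarrow> F $ i $ j * z ^ i * w ^ j)) summable_on UNIV"
    proof (rule summable_on_comparison_test)
      fix p :: "nat \<times> nat"
      obtain i j where p: "p = (i, j)" by force
      have "norm (F $ i $ j) * (norm z ^ i * norm w ^ j)
              \<le> C * R ^ (i + j) * (norm z ^ i * norm w ^ j)"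
        by (intro mult_right_mono b) auto
      also have "\<dots> = C * (u ^ i * v ^ j)"
        by (simp add: u_def v_def power_add power_mult_distrib)
      finally show "norm (case p of (i, j) \<Rightarrow> F $ i $ j * z ^ i * w ^ j)
          \<le> (case p of (i, j) \<Rightarrow> C * (u ^ i * v ^ j))"
        by (simp add: p norm_mult norm_power mult.assoc)
    qed auto
    thus ?thesis by (rule abs_summable_summable)
  qed
  thus "convergent2 F" unfolding convergent2_def using R by (intro exI[of _ "1 / R"]) auto
qed

lemma convergent2_const: "convergent2 (fps_const (fps_const c))"
  unfolding convergent2_iff_bound
  by (rule exI[of _ "norm c"], rule exI[of _ 1]) auto

lemma convergent2_uminus: "convergent2 F \<Longrightarrow> convergent2 (- F)"
  by (simp add: convergent2_iff_bound)

lemma convergent2_add: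
  assumes "convergent2 F" "convergent2 G"
  shows "convergent2 (F + G)"
proof -
  obtain C R where C: "C \<ge> 0" "R > 0" "\<And>i j. norm (F $ i $ j) \<le> C * R ^ (i + j)"
    using assms(1) unfolding convergent2_iff_bound by blast
  obtain C' R' where C': "C' \<ge> 0" "R' > 0" "\<And>i j. norm (G $ i $ j) \<le> C' * R' ^ (i + j)"
    using assms(2) unfolding convergent2_iff_bound by blast
  have "norm ((F + G) $ i $ j) \<le> (C + C') * (max R R') ^ (i + j)" for i j
  proof -
    have "norm ((F + G) $ i $ j) \<le> C * R ^ (i + j) + C' * R' ^ (i + j)"
      using norm_triangle_mono[OF C(3) C'(3)] by simp
    also have "\<dots> \<le> C * (max R R') ^ (i + j) + C' * (max R R') ^ (i + j)"
      using C C' by (intro add_mono mult_left_mono power_mono) auto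
    finally show ?thesis by (simp add: algebra_simps)
  qed
  thus ?thesis unfolding convergent2_iff_bound using C C'
    by (intro exI[of _ "C + C'"] exI[of _ "max R R'"]) auto
qed

lemma convergent2_mult:
  assumes "convergent2 F" "convergent2 G"
  shows "convergent2 (F * G)"
proof -
  obtain C R where C: "C \<ge> 0" "R > 0" "\<And>i j. norm (F $ i $ j) \<le> C * R ^ (i + j)"
    using assms(1) unfolding convergent2_iff_bound by blast
  obtain C' R' where C': "C' \<ge> 0" "R' > 0" "\<And>i j. norm (G $ i $ j) \<le> C' * R' ^ (i + j)"
    using assms(2) unfolding convergent2_iff_bound by blast
  define M where "M = max R R'"
  have M: "M > 0" "R \<le> M" "R' \<le> M" using C by (auto simp: M_def)
  have F: "norm (F $ i $ j) \<le> C * M ^ (i + j)" for i j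
    using C(3)[of i j] mult_left_mono[OF power_mono[OF M(2), of "i + j"] C(1)] C(2) by linarith
  have G: "norm (G $ i $ j) \<le> C' * M ^ (i + j)" for i j
    using C'(3)[of i j] mult_left_mono[OF power_mono[OF M(3), of "i + j"] C'(1)] C'(2) by linarith
  have "norm ((F * G) $ i $ j) \<le> (C * C') * (2 * M) ^ (i + j)" for i j
  proof -
    have "(F * G) $ i $ j = (\<Sum>a=0..i. \<Sum>b=0..j. F $ a $ b * G $ (i - a) $ (j - b))"
      by (simp add: fps_mult_nth fps_sum_nth)
    also have "norm \<dots> \<le> (\<Sum>a=0..i. \<Sum>b=0..j. C * C' * M ^ (i + j))"
    proof (intro sum_norm_le)
      fix a b assume ab: "a \<in> {0..i}" "b \<in> {0..j}"
      have "norm (F $ a $ b * G $ (i - a) $ (j - b))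
              \<le> (C * M ^ (a + b)) * (C' * M ^ (i - a + (j - b)))"
        unfolding norm_mult using C M by (intro mult_mono F G) auto
      also have "\<dots> = C * C' * M ^ (a + b + (i - a + (j - b)))"
        by (simp only: power_add mult_ac)
      also have "a + b + (i - a + (j - b)) = i + j" using ab by auto
      finally show "norm (F $ a $ b * G $ (i - a) $ (j - b)) \<le> C * C' * M ^ (i + j)" .
    qed
    also have "\<dots> = real (Suc i) * real (Suc j) * (C * C' * M ^ (i + j))"
      by simp
    also have "\<dots> \<le> 2 ^ i * 2 ^ j * (C * C' * M ^ (i + j))"
    proof (intro mult_right_mono mult_mono)
      have p: "real (Suc n) \<le> 2 ^ n" for n
        using Suc_leI[OF less_exp[of n]] by (metis of_nat_le_iff of_nat_numeral of_nat_power)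
      show "real (Suc i) \<le> 2 ^ i" "real (Suc j) \<le> 2 ^ j" by (rule p)+
    qed (use C C' M in auto)
    also have "\<dots> = C * C' * (2 * M) ^ (i + j)"
      by (simp add: power_mult_distrib power_add)
    finally show ?thesis .
  qed
  thus ?thesis unfolding convergent2_iff_bound using C C' M
    by (intro exI[of _ "C * C'"] exI[of _ "2 * M"]) auto
qed

typedef cps2 = "{F. convergent2 F}"
  using convergent2_const by blast

setup_lifting type_definition_cps2

instantiation cps2 :: idom
begin

lift_definition zero_cps2 :: cps2 is 0
  using convergent2_const[of 0] by simp
lift_definition one_cps2 :: cps2 is 1
  using convergent2_const[of 1] by simp
lift_definition uminus_cps2 :: "cps2 \<Rightarrow> cps2" is uminus
  by (rule convergent2_uminus)
lift_definition plus_cps2 :: "cps2 \<Rightarrow> cps2 \<Rightarrow> cps2" is "(+)"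
  by (rule convergent2_add)
lift_definition times_cps2 :: "cps2 \<Rightarrow> cps2 \<Rightarrow> cps2" is "(*)"
  by (rule convergent2_mult)
lift_definition minus_cps2 :: "cps2 \<Rightarrow> cps2 \<Rightarrow> cps2" is "(-)"
  by (metis convergent2_add convergent2_uminus diff_conv_add_uminus)

instance
  by standard (transfer; simp add: algebra_simps)+

end

lift_definition coeff2 :: "cps2 \<Rightarrow> nat \<Rightarrow> nat \<Rightarrow> complex" is "\<lambda>F i j. F $ i $ j" .

lift_definition const2 :: "complex \<Rightarrow> cps2" is "\<lambda>c. fps_const (fps_const c)"
  by (rule convergent2_const)

text \<open>
  The sum of the series. Outside the domain of convergence \<open>infsum\<close> gives a junk value, so
  \<open>ev2 g\<close> is only used near \<open>0\<close>.
\<close>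

definition ev2 :: "cps2 \<Rightarrow> complex \<times> complex \<Rightarrow> complex" where
  "ev2 g p = (\<Sum>\<^sub>\<infinity>(i, j). coeff2 g i j * fst p ^ i * snd p ^ j)"


section \<open>The maximal ideal and its powers\<close>

definition max_ideal :: "cps2 set" where
  "max_ideal = {g. coeff2 g 0 0 = 0}"

definition ideal_mult :: "'a::comm_ring_1 set \<Rightarrow> 'a set \<Rightarrow> 'a set" where
  "ideal_mult I J =
     {\<Sum>k<n. a k * b k | (n::nat) a b. (\<forall>k<n. a k \<in> I) \<and> (\<forall>k<n. b k \<in> J)}"

primrec ideal_power :: "'a::comm_ring_1 set \<Rightarrow> nat \<Rightarrow> 'a set" where
  "ideal_power I 0 = UNIV"
| "ideal_power I (Suc n) = ideal_mult I (ideal_power I n)"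


section \<open>Logarithmic derivations\<close>

definition local_equation :: "cps2 \<Rightarrow> (complex \<times> complex) set \<Rightarrow> bool" where
  "local_equation f D \<longleftrightarrow> (\<forall>\<^sub>F p in nhds 0. p \<in> D \<longleftrightarrow> ev2 f p = 0)"

definition derivation :: "(cps2 \<Rightarrow> cps2) \<Rightarrow> bool" where
  "derivation \<delta> \<longleftrightarrow>
     (\<forall>g h. \<delta> (g + h) = \<delta> g + \<delta> h) \<and>
     (\<forall>c g. \<delta> (const2 c * g) = const2 c * \<delta> g) \<and>
     (\<forall>g h. \<delta> (g * h) = g * \<delta> h + h * \<delta> g)"

definition Der :: "cps2 \<Rightarrow> (cps2 \<Rightarrow> cps2) set" where
  "Der f = {\<delta>. derivation \<delta> \<and> f dvd \<delta> f}"

definition Der_basis :: "cps2 \<Rightarrow> (cps2 \<Rightarrow> cps2) \<Rightarrow> (cps2 \<Rightarrow> cps2) \<Rightarrow> bool" where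
  "Der_basis f \<delta>1 \<delta>2 \<longleftrightarrow> \<delta>1 \<in> Der f \<and> \<delta>2 \<in> Der f \<and>
     (\<forall>\<delta>\<in>Der f. \<exists>!(g, h). \<delta> = (\<lambda>k. g * \<delta>1 k + h * \<delta>2 k))"


section \<open>Local coordinates and linear parts\<close>

definition chart :: "cps2 \<Rightarrow> cps2 \<Rightarrow> complex \<times> complex \<Rightarrow> complex \<times> complex" where
  "chart x y p = (ev2 x p, ev2 y p)"

text \<open>
  A pair \<open>(x, y)\<close> is a system of local coordinates centered at \<open>0\<close> if its chart is the germ of a
  biholomorphic map from \<open>(\<complex>\<^sup>2, 0)\<close> to \<open>(\<complex>\<^sup>2, 0)\<close>; the pair \<open>(u, v)\<close> below is the inverse germ.
\<close>

definition local_coords :: "cps2 \<Rightarrow> cps2 \<Rightarrow> bool" where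
  "local_coords x y \<longleftrightarrow> x \<in> max_ideal \<and> y \<in> max_ideal \<and>
     (\<exists>u\<in>max_ideal. \<exists>v\<in>max_ideal.
        (\<forall>\<^sub>F p in nhds 0. chart u v (chart x y p) = p) \<and>
        (\<forall>\<^sub>F p in nhds 0. chart x y (chart u v p) = p))"

text \<open>
  The power series \<open>c\<close> with \<open>g = c(x, y)\<close> near \<open>0\<close>. It exists and is unique whenever
  \<open>(x, y)\<close> are local coordinates.
\<close>

definition expansion :: "cps2 \<Rightarrow> cps2 \<Rightarrow> cps2 \<Rightarrow> cps2" where
  "expansion x y g = (THE c. \<forall>\<^sub>F p in nhds 0. ev2 g p = ev2 c (chart x y p))"

definition hom_comp :: "cps2 \<Rightarrow> cps2 \<Rightarrow> nat \<Rightarrow> cps2 \<Rightarrow> cps2" where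
  "hom_comp x y d g =
     (\<Sum>i\<le>d. const2 (coeff2 (expansion x y g) i (d - i)) * x ^ i * y ^ (d - i))"

text \<open>
  In coordinates \<open>(x, y)\<close> a derivation is \<open>\<delta> = a \<partial>\<^sub>x + b \<partial>\<^sub>y\<close> with \<open>a = \<delta> x\<close> and \<open>b = \<delta> y\<close>. Its linear
  part \<open>a\<^sub>1 \<partial>\<^sub>x + b\<^sub>1 \<partial>\<^sub>y\<close> is recorded as the pair \<open>(a\<^sub>1, b\<^sub>1)\<close> of its coefficients.
\<close>

definition linear_part :: "cps2 \<Rightarrow> cps2 \<Rightarrow> (cps2 \<Rightarrow> cps2) \<Rightarrow> cps2 \<times> cps2" where
  "linear_part x y \<delta> = (hom_comp x y 1 (\<delta> x), hom_comp x y 1 (\<delta> y))"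

end

(* Freeness of Der_f: among pairs of logarithmic vector fields take one whose determinant has the
   lexicographically smallest leading monomial x^k y^n. By Cramer's rule every logarithmic field is,
   modulo x, a combination of the pair; iterating gives formal coefficients, which are convergent
   because a formal quotient of convergent series is convergent. The same argument shows that the
   ideal of all m with f | m f_x and f | m f_y is principal, and for squarefree f it is (f). So f
   divides det(delta_1, delta_2) for all delta_1, delta_2 in Der_f (Saito).

   No delta in Der_f has linear part x d/dx with delta(f) = h f and h(0) = 0: such a delta has a
   formal separatrix w tangent to y = 0, any invariant series without constant term is divisible by
   w, hence f = w^d * unit. Then f / f_y is convergent of order 1 and lies in the above ideal,
   although f has order at least 2. This also excludes logarithmic fields that do not vanish at 0.
   Two fields with linear parts x d/dx and (ax + y) d/dx force the leading form of f to be a power of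
   y, hence h(0) = 0 for the first of them.

   Finally, if f has order at least 3, then so has the determinant of a basis. The two linear parts are
   then everywhere parallel, so they are dependent or span (x d/dx, y d/dx) in suitable coordinates. *)

theory Submission
  imports Defs
begin


section \<open>Formal power series in two variables\<close>

text \<open>Squarefreeness only restricts convergent factors, while the separatrix is a formal
  series. That a power of it divides \<open>f\<close> formally is therefore no contradiction yet;
  the ideal of all \<open>m\<close> with \<open>f dvd m * dX2 f\<close> and
  \<open>f dvd m * dY2 f\<close> is used because it turns the formal information into divisibility
  of one convergent element, whose order can be read off. The minimality arguments work because
  reduction modulo \<open>X2\<close> leaves a series in the second variable alone, and there, of two
  nonzero elements, the one of smaller order divides the other. Minimality only yields a remainder
  that is a multiple of a power of \<open>X2\<close>; that the remainder divided by this power still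
  belongs to the ideal or module in question is a separate point, settled by primality of
  \<open>X2\<close>. The second claim speaks about all coordinate systems at once. A derivation with
  values in series of order at least 2 has zero linear part in each of them, so linear dependence is
  needed in the standard coordinates only.\<close>

definition Xf :: "complex fps fps" where "Xf = fps_X"
definition Yf :: "complex fps fps" where "Yf = fps_const fps_X"

definition dXf :: "complex fps fps \<Rightarrow> complex fps fps" where
  "dXf F = fps_deriv F"

definition dYf :: "complex fps fps \<Rightarrow> complex fps fps" where
  "dYf F = Abs_fps (\<lambda>i. fps_deriv (F $ i))"

definition order_ge :: "nat \<Rightarrow> complex fps fps \<Rightarrow> bool" where
  "order_ge n F \<longleftrightarrow> (\<forall>i j. i + j < n \<longrightarrow> F $ i $ j = 0)"

lemma fps2_eqI: "(\<And>i j. F $ i $ j = G $ i $ j) \<Longrightarrow> F = G" for F G :: "complex fps fps"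
  by (intro fps_ext) auto

lemma fps2_mult_nth:
  "(F * G) $ i $ j = (\<Sum>a\<le>i. \<Sum>b\<le>j. F $ a $ b * G $ (i - a) $ (j - b))"
  for F G :: "complex fps fps"
  by (simp add: fps_mult_nth fps_sum_nth atLeast0AtMost)

lemma Xf_nth: "Xf $ i $ j = (if i = 1 \<and> j = 0 then 1 else 0)"
  by (simp add: Xf_def)

lemma Yf_nth: "Yf $ i $ j = (if i = 0 \<and> j = 1 then 1 else 0)"
  by (simp add: Yf_def)

lemma Xf_mult_nth: "(Xf * F) $ i $ j = (if i = 0 then 0 else F $ (i - 1) $ j)"
  by (simp add: Xf_def)

lemma Yf_mult_nth: "(Yf * F) $ i $ j = (if j = 0 then 0 else F $ i $ (j - 1))"
  by (simp add: Yf_def)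

lemma const_mult_nth: "(fps_const (fps_const c) * F) $ i $ j = c * F $ i $ j"
  for F :: "complex fps fps"
  by simp

lemma dXf_nth: "dXf F $ i $ j = of_nat (i + 1) * F $ (i + 1) $ j"
proof -
  have "(of_nat (i + 1) :: complex fps) = fps_const (of_nat (i + 1))"
    by (rule fps_of_nat [symmetric])
  then show ?thesis
    unfolding dXf_def fps_deriv_nth by (simp only: fps_mult_left_const_nth)
qed

lemma dYf_nth: "dYf F $ i $ j = of_nat (j + 1) * F $ i $ (j + 1)"
  by (simp add: dYf_def)

lemma dXf_add: "dXf (F + G) = dXf F + dXf G"
  by (simp add: dXf_def)

lemma dXf_mult: "dXf (F * G) = F * dXf G + dXf F * G"
  by (simp add: dXf_def)

lemma dYf_add: "dYf (F + G) = dYf F + dYf G"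
  by (intro fps_ext) (simp add: dYf_def)

lemma dYf_mult: "dYf (F * G) = F * dYf G + dYf F * G"
proof (rule fps_ext)
  fix i
  show "dYf (F * G) $ i = (F * dYf G + dYf F * G) $ i"
    by (simp add: dYf_def fps_mult_nth fps_deriv_sum sum.distrib)
qed

lemma dXf_const [simp]: "dXf (fps_const (fps_const c)) = 0"
  by (simp add: dXf_def)

lemma dYf_const [simp]: "dYf (fps_const (fps_const c)) = 0"
  by (intro fps2_eqI) (auto simp: dYf_nth)

lemma dXf_Xf [simp]: "dXf Xf = 1" and dYf_Xf [simp]: "dYf Xf = 0"
  and dXf_Yf [simp]: "dXf Yf = 0" and dYf_Yf [simp]: "dYf Yf = 1"
  by (intro fps2_eqI; auto simp: dXf_nth dYf_nth Xf_nth Yf_nth)+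

section \<open>Order of vanishing\<close>

lemma order_geD: "order_ge n F \<Longrightarrow> i + j < n \<Longrightarrow> F $ i $ j = 0"
  by (auto simp: order_ge_def)

lemma order_ge_0 [simp]: "order_ge 0 F"
  by (simp add: order_ge_def)

lemma order_ge_zero [simp]: "order_ge n 0"
  by (simp add: order_ge_def)

lemma order_ge_mono: "order_ge n F \<Longrightarrow> m \<le> n \<Longrightarrow> order_ge m F"
  by (auto simp: order_ge_def)

lemma order_ge_add: "order_ge n F \<Longrightarrow> order_ge n G \<Longrightarrow> order_ge n (F + G)"
  by (auto simp: order_ge_def)

lemma order_ge_diff: "order_ge n F \<Longrightarrow> order_ge n G \<Longrightarrow> order_ge n (F - G)"
  by (auto simp: order_ge_def)

lemma order_ge_mult:
  assumes "order_ge m F" "order_ge n G"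
  shows "order_ge (m + n) (F * G)"
  unfolding order_ge_def
proof (intro allI impI)
  fix i j :: nat assume ij: "i + j < m + n"
  have "F $ a $ b * G $ (i - a) $ (j - b) = 0" if "a \<le> i" "b \<le> j" for a b
  proof (cases "a + b < m")
    case True
    then show ?thesis using assms(1) by (simp add: order_ge_def)
  next
    case False
    then have "(i - a) + (j - b) < n" using that ij by linarith
    then show ?thesis using assms(2) by (simp add: order_ge_def)
  qed
  then show "(F * G) $ i $ j = 0"
    unfolding fps2_mult_nth by (intro sum.neutral ballI) auto
qed

lemma order_ge_mult1: "order_ge m F \<Longrightarrow> order_ge m (F * G)"
  using order_ge_mult[of m F 0 G] by simp

lemma order_ge_mult2: "order_ge m G \<Longrightarrow> order_ge m (F * G)"
  using order_ge_mult[of 0 F m G] by simp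

lemma order_ge_dXf: "order_ge (Suc n) F \<Longrightarrow> order_ge n (dXf F)"
  by (auto simp: order_ge_def dXf_nth)

lemma order_ge_dYf: "order_ge (Suc n) F \<Longrightarrow> order_ge n (dYf F)"
  by (auto simp: order_ge_def dYf_nth)

lemma order_ge_all_imp_0: "(\<And>n. order_ge n F) \<Longrightarrow> F = 0"
  by (intro fps2_eqI) (metis lessI order_geD fps_zero_nth)

lemma order_ge_Xf: "order_ge 1 Xf" and order_ge_Yf: "order_ge 1 Yf"
  by (auto simp: order_ge_def Xf_nth Yf_nth)

lemma exists_order:
  assumes "F \<noteq> 0"
  obtains n i j where "order_ge n F" "i + j = n" "F $ i $ j \<noteq> 0"
proof -
  define P where "P n \<longleftrightarrow> (\<exists>i j. i + j = n \<and> F $ i $ j \<noteq> 0)" for n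
  have "\<exists>n. P n"
    using assms fps2_eqI[of F 0] by (auto simp: P_def)
  define n where "n = (LEAST n. P n)"
  have "P n" using \<open>\<exists>n. P n\<close> unfolding n_def by (rule LeastI_ex)
  moreover have "order_ge n F"
    unfolding order_ge_def using not_less_Least[of _ P, folded n_def]
    by (auto simp: P_def)
  ultimately show thesis using that by (auto simp: P_def)
qed

lemma fps2_mult_nth_0: "(F * G) $ 0 $ 0 = F $ 0 $ 0 * G $ 0 $ 0" for F G :: "complex fps fps"
  by simp

lemma fps2_unit:
  fixes F :: "complex fps fps"
  assumes "F $ 0 $ 0 \<noteq> 0"
  obtains G where "F * G = 1"
proof -
  have "F $ 0 * inverse (F $ 0) = 1"
    using assms inverse_mult_eq_1'[of "F $ 0"] by simp
  then have "F * fps_right_inverse F (inverse (F $ 0)) = 1"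
    by (rule fps_right_inverse)
  then show thesis by (rule that)
qed


section \<open>Division of convergent series\<close>

text \<open>A bound on the weighted norm, the sum of all \<open>norm (p $ j) * \<rho> ^ j\<close>.
  It is phrased through partial sums, so that summability never has to be carried along.\<close>

definition row_bound :: "real \<Rightarrow> complex fps \<Rightarrow> real \<Rightarrow> bool" where
  "row_bound \<rho> p c \<longleftrightarrow> (\<forall>m. (\<Sum>j\<le>m. norm (p $ j) * \<rho> ^ j) \<le> c)"

lemma row_bound_nth:
  assumes "row_bound \<rho> p c" "\<rho> > 0"
  shows "norm (p $ j) \<le> c * (1 / \<rho>) ^ j"
proof -
  have "norm (p $ j) * \<rho> ^ j \<le> (\<Sum>j\<le>j. norm (p $ j) * \<rho> ^ j)"
    using assms(2) by (intro member_le_sum) auto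
  also have "\<dots> \<le> c" using assms(1) by (auto simp: row_bound_def)
  finally show ?thesis using assms(2) by (simp add: field_simps power_divide)
qed

lemma row_bound_nonneg: "row_bound \<rho> p c \<Longrightarrow> c \<ge> 0"
  unfolding row_bound_def
  by (drule spec[of _ 0]) (auto intro: order_trans[OF norm_ge_zero])

lemma row_bound_mono: "row_bound \<rho> p c \<Longrightarrow> c \<le> d \<Longrightarrow> row_bound \<rho> p d"
  by (force simp: row_bound_def intro: order_trans)

lemma row_bound_diff:
  assumes "row_bound \<rho> p c" "row_bound \<rho> q d" "\<rho> > 0"
  shows "row_bound \<rho> (p - q) (c + d)"
  unfolding row_bound_def
proof
  fix m
  have "(\<Sum>j\<le>m. norm ((p - q) $ j) * \<rho> ^ j)
      \<le> (\<Sum>j\<le>m. norm (p $ j) * \<rho> ^ j + norm (q $ j) * \<rho> ^ j)"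
    using assms(3) by (intro sum_mono)
      (auto simp: distrib_right[symmetric] intro!: mult_right_mono norm_triangle_ineq4)
  also have "\<dots> \<le> c + d"
    using assms(1,2) by (auto simp: row_bound_def sum.distrib intro!: add_mono)
  finally show "(\<Sum>j\<le>m. norm ((p - q) $ j) * \<rho> ^ j) \<le> c + d" .
qed

lemma row_bound_sum:
  assumes "\<And>a. a \<in> A \<Longrightarrow> row_bound \<rho> (p a) (c a)" "\<rho> > 0"
  shows "row_bound \<rho> (\<Sum>a\<in>A. p a) (\<Sum>a\<in>A. c a)"
  unfolding row_bound_def
proof
  fix m
  have "(\<Sum>j\<le>m. norm ((\<Sum>a\<in>A. p a) $ j) * \<rho> ^ j) \<le> (\<Sum>j\<le>m. \<Sum>a\<in>A. norm (p a $ j) * \<rho> ^ j)"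
    using assms(2) by (intro sum_mono)
      (auto simp: fps_sum_nth sum_distrib_right[symmetric] intro!: mult_right_mono norm_sum)
  also have "\<dots> = (\<Sum>a\<in>A. \<Sum>j\<le>m. norm (p a $ j) * \<rho> ^ j)"
    by (rule sum.swap)
  also have "\<dots> \<le> (\<Sum>a\<in>A. c a)"
    using assms(1) by (intro sum_mono) (auto simp: row_bound_def)
  finally show "(\<Sum>j\<le>m. norm ((\<Sum>a\<in>A. p a) $ j) * \<rho> ^ j) \<le> (\<Sum>a\<in>A. c a)" .
qed

text \<open>Both factors are truncated at the same \<open>m\<close>, so the inequality also applies
  to a series for which no bound is known yet; the absorption argument for quotients depends on
  this.\<close>

lemma row_sum_mult_le:
  fixes p q :: "complex fps"
  assumes "\<rho> > 0"
  shows "(\<Sum>j\<le>m. norm ((p * q) $ j) * \<rho> ^ j)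
    \<le> (\<Sum>j\<le>m. norm (p $ j) * \<rho> ^ j) * (\<Sum>j\<le>m. norm (q $ j) * \<rho> ^ j)"
proof -
  let ?P = "\<lambda>j. norm (p $ j) * \<rho> ^ j" and ?Q = "\<lambda>j. norm (q $ j) * \<rho> ^ j"
  have "(\<Sum>j\<le>m. norm ((p * q) $ j) * \<rho> ^ j) \<le> (\<Sum>j\<le>m. \<Sum>b\<le>j. ?P b * ?Q (j - b))"
  proof (intro sum_mono)
    fix j assume "j \<in> {..m}"
    have "norm ((p * q) $ j) * \<rho> ^ j \<le> (\<Sum>b\<le>j. norm (p $ b * q $ (j - b))) * \<rho> ^ j"
      using assms unfolding fps_mult_nth atLeast0AtMost
      by (intro mult_right_mono norm_sum) auto
    also have "\<dots> = (\<Sum>b\<le>j. ?P b * ?Q (j - b))"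
      unfolding sum_distrib_right
      by (intro sum.cong refl) (auto simp: norm_mult simp flip: power_add)
    finally show "norm ((p * q) $ j) * \<rho> ^ j \<le> (\<Sum>b\<le>j. ?P b * ?Q (j - b))" .
  qed
  also have "\<dots> = (\<Sum>(b, c) | b + c \<le> m. ?P b * ?Q c)"
    by (rule sum.triangle_reindex_eq[symmetric])
  also have "\<dots> \<le> (\<Sum>(b, c)\<in>{..m} \<times> {..m}. ?P b * ?Q c)"
    using assms by (intro sum_mono2) auto
  also have "\<dots> = (\<Sum>j\<le>m. ?P j) * (\<Sum>j\<le>m. ?Q j)"
    by (simp add: sum_product sum.cartesian_product)
  finally show ?thesis .
qed

lemma row_bound_mult:
  assumes "row_bound \<rho> p c" "row_bound \<rho> q d" "\<rho> > 0"
  shows "row_bound \<rho> (p * q) (c * d)"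
  unfolding row_bound_def
proof
  fix m
  have "(\<Sum>j\<le>m. norm ((p * q) $ j) * \<rho> ^ j)
      \<le> (\<Sum>j\<le>m. norm (p $ j) * \<rho> ^ j) * (\<Sum>j\<le>m. norm (q $ j) * \<rho> ^ j)"
    by (rule row_sum_mult_le[OF assms(3)])
  also have "\<dots> \<le> c * d"
    using assms row_bound_nonneg[OF assms(1)]
    by (intro mult_mono) (auto simp: row_bound_def intro!: sum_nonneg)
  finally show "(\<Sum>j\<le>m. norm ((p * q) $ j) * \<rho> ^ j) \<le> c * d" .
qed

lemma geometric_partial_sum_le:
  fixes x :: real
  assumes "0 \<le> x" "x \<le> 1/2"
  shows "(\<Sum>j\<le>m. x ^ j) \<le> 2"
proof -
  have "(\<Sum>j\<le>m. x ^ j) \<le> (\<Sum>j. x ^ j)"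
    using assms by (intro sum_le_suminf summable_geometric) auto
  also have "\<dots> = 1 / (1 - x)"
    using assms by (intro suminf_geometric) auto
  also have "\<dots> \<le> 2" using assms by (simp add: field_simps)
  finally show ?thesis .
qed

lemma row_bound_geometric:
  assumes "\<And>j. norm (p $ j) \<le> C * R ^ j" "C \<ge> 0" "R > 0" "\<rho> > 0" "R * \<rho> \<le> 1/2"
  shows "row_bound \<rho> p (2 * C)"
  unfolding row_bound_def
proof
  fix m
  have "(\<Sum>j\<le>m. norm (p $ j) * \<rho> ^ j) \<le> (\<Sum>j\<le>m. C * (R * \<rho>) ^ j)"
    using assms by (intro sum_mono) (auto simp: power_mult_distrib mult.assoc[symmetric] intro!: mult_right_mono)
  also have "\<dots> = C * (\<Sum>j\<le>m. (R * \<rho>) ^ j)" by (simp add: sum_distrib_left)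
  also have "\<dots> \<le> C * 2"
    using assms by (intro mult_left_mono geometric_partial_sum_le) auto
  finally show "(\<Sum>j\<le>m. norm (p $ j) * \<rho> ^ j) \<le> 2 * C" by simp
qed

lemma row_bound_fps_X_power_cancel:
  assumes "row_bound \<rho> (fps_X ^ n * p) c" "\<rho> > 0"
  shows "row_bound \<rho> p (c / \<rho> ^ n)"
  unfolding row_bound_def
proof
  fix m
  have "(\<Sum>j\<le>m. norm (p $ j) * \<rho> ^ j) * \<rho> ^ n
      = (\<Sum>j\<le>m. norm ((fps_X ^ n * p) $ (j + n)) * \<rho> ^ (j + n))"
    by (simp add: sum_distrib_right power_add mult.assoc fps_X_power_mult_nth)
  also have "\<dots> = (\<Sum>j\<in>(\<lambda>j. j + n) ` {..m}. norm ((fps_X ^ n * p) $ j) * \<rho> ^ j)"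
    by (subst sum.reindex) auto
  also have "\<dots> \<le> (\<Sum>j\<le>m + n. norm ((fps_X ^ n * p) $ j) * \<rho> ^ j)"
    using assms(2) by (intro sum_mono2) auto
  also have "\<dots> \<le> c" using assms(1) by (auto simp: row_bound_def)
  finally show "(\<Sum>j\<le>m. norm (p $ j) * \<rho> ^ j) \<le> c / \<rho> ^ n"
    using assms(2) by (simp add: field_simps)
qed

text \<open>
  The row \<open>g\<close> is \<open>fps_X ^ n * (e - q)\<close> with \<open>e\<close> a nonzero constant and \<open>q\<close> without constant term;
  for small \<open>\<rho>\<close> the norm of \<open>q\<close> is at most half that of \<open>e\<close>, so \<open>q\<close> can be absorbed.
\<close>

lemma row_division_bound:
  fixes g :: "complex fps"
  assumes g: "\<And>j. norm (g $ j) \<le> C * R ^ j" "C \<ge> 0" "R > 0" and "g \<noteq> 0" and "\<rho>1 > 0"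
  shows "\<exists>\<rho> K. 0 < \<rho> \<and> \<rho> \<le> \<rho>1 \<and> K > 0 \<and>
    (\<forall>p c. row_bound \<rho> (g * p) c \<longrightarrow> row_bound \<rho> p (K * c))"
proof -
  define n where "n = subdegree g"
  define u where "u = fps_shift n g"
  define e where "e = g $ n"
  have e: "e \<noteq> 0" using \<open>g \<noteq> 0\<close> by (simp add: e_def n_def)
  have gu: "g = fps_X ^ n * u"
    unfolding u_def n_def by (metis fps_shift_times_fps_X_power le_refl mult.commute)
  define q where "q = fps_const e - u"
  have q0: "q $ 0 = 0" by (simp add: q_def u_def e_def)
  define C' where "C' = C * R ^ (n + 1)"
  have C': "C' \<ge> 0" using g by (simp add: C'_def)
  \<comment> \<open>The second entry makes the ratio \<open>R * \<rho>\<close> at most 1/2, so that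
    \<open>q'\<close> has norm at most \<open>2 * C'\<close>; the third then makes the norm of
    \<open>q\<close>, at most \<open>\<rho> * (2 * C')\<close>, no larger than
    \<open>norm e / 2\<close>. The summand 1 only keeps the denominator positive.\<close>
  define \<rho> where "\<rho> = min \<rho>1 (min (1 / (2 * R)) (norm e / (4 * (C' + 1))))"
  have \<rho>: "\<rho> > 0" "\<rho> \<le> \<rho>1" "R * \<rho> \<le> 1/2" "4 * (C' + 1) * \<rho> \<le> norm e"
  proof -
    show "\<rho> > 0" "\<rho> \<le> \<rho>1" using assms e C' by (auto simp: \<rho>_def)
    have "\<rho> \<le> 1 / (2 * R)" by (auto simp: \<rho>_def)
    then show "R * \<rho> \<le> 1/2" using g(3) by (simp add: field_simps)
    have "\<rho> \<le> norm e / (4 * (C' + 1))" by (auto simp: \<rho>_def)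
    then show "4 * (C' + 1) * \<rho> \<le> norm e" using C' by (simp add: field_simps)
  qed
  define q' where "q' = fps_shift 1 q"
  have qq': "q = fps_X * q'"
    using q0 by (intro fps_ext) (auto simp: q'_def)
  have "norm (q' $ j) \<le> C' * R ^ j" for j
  proof -
    have "norm (q' $ j) = norm (g $ (n + 1 + j))"
      by (simp add: q'_def q_def u_def add_ac)
    also have "\<dots> \<le> C * R ^ (n + 1 + j)" by (rule g(1))
    finally show ?thesis by (simp add: C'_def power_add mult_ac)
  qed
  then have q'b: "row_bound \<rho> q' (2 * C')"
    using C' g(3) \<rho> by (intro row_bound_geometric) auto
  have qb: "row_bound \<rho> q (norm e / 2)"
    unfolding row_bound_def
  proof
    fix m
    have "(\<Sum>j\<le>m. norm (q $ j) * \<rho> ^ j) \<le> (\<Sum>j\<le>Suc m. norm (q $ j) * \<rho> ^ j)"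
      using \<rho> by (intro sum_mono2) auto
    also have "\<dots> = \<rho> * (\<Sum>j\<le>m. norm (q' $ j) * \<rho> ^ j)"
      by (simp add: sum.atMost_Suc_shift qq' sum_distrib_left mult_ac del: sum.atMost_Suc)
    also have "\<dots> \<le> \<rho> * (2 * C')"
      using q'b \<rho> by (intro mult_left_mono) (auto simp: row_bound_def)
    also have "\<dots> \<le> norm e / 2" using \<rho> by (simp add: algebra_simps)
    finally show "(\<Sum>j\<le>m. norm (q $ j) * \<rho> ^ j) \<le> norm e / 2" .
  qed
  define K where "K = 2 / (norm e * \<rho> ^ n)"
  have "row_bound \<rho> p (K * c)" if gp: "row_bound \<rho> (g * p) c" for p c
  proof -
    have "row_bound \<rho> (fps_X ^ n * p) (2 * c / norm e)"
      unfolding row_bound_def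
    proof
      fix m
      let ?N = "\<lambda>p. \<Sum>j\<le>m. norm (p $ j) * \<rho> ^ j"
      define h where "h = fps_X ^ n * p"
      have "g * p = fps_const e * h - q * h"
        by (simp add: gu q_def h_def algebra_simps)
      then have "fps_const e * h = g * p + q * h" by simp
      then have *: "norm e * norm (h $ j) \<le> norm ((g * p) $ j) + norm ((q * h) $ j)" for j
        by (metis fps_add_nth fps_mult_left_const_nth norm_mult norm_triangle_ineq)
      have "norm e * ?N h = (\<Sum>j\<le>m. norm e * norm (h $ j) * \<rho> ^ j)"
        by (simp add: sum_distrib_left mult.assoc)
      also have "\<dots> \<le> (\<Sum>j\<le>m. norm ((g * p) $ j) * \<rho> ^ j + norm ((q * h) $ j) * \<rho> ^ j)"
        using \<rho> * by (intro sum_mono) (auto simp: distrib_right[symmetric] intro!: mult_right_mono)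
      also have "\<dots> = ?N (g * p) + ?N (q * h)" by (simp add: sum.distrib)
      also have "\<dots> \<le> c + norm e / 2 * ?N h"
      proof (intro add_mono)
        show "?N (g * p) \<le> c" using gp by (auto simp: row_bound_def)
        have "?N (q * h) \<le> ?N q * ?N h" by (rule row_sum_mult_le[OF \<rho>(1)])
        also have "\<dots> \<le> norm e / 2 * ?N h"
          using qb \<rho> by (intro mult_right_mono) (auto simp: row_bound_def intro!: sum_nonneg)
        finally show "?N (q * h) \<le> norm e / 2 * ?N h" .
      qed
      finally have "norm e * ?N h / 2 \<le> c" by (simp add: algebra_simps)
      then show "?N (fps_X ^ n * p) \<le> 2 * c / norm e"
        using e by (simp add: h_def field_simps)
    qed
    from row_bound_fps_X_power_cancel[OF this \<rho>(1)] show ?thesis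
      by (simp add: K_def mult_ac)
  qed
  moreover have "K > 0" using e \<rho> by (simp add: K_def)
  ultimately show ?thesis using \<rho> by blast
qed

text \<open>
  Dividing out the leading row \<open>g 0\<close> of the divisor expresses each row of the quotient through
  the earlier ones, and \<open>row_division_bound\<close> turns this into a geometric bound.
\<close>

lemma convergent2_divide:
  fixes F G H :: "complex fps fps"
  assumes F: "convergent2 F" and G: "convergent2 G" and "G \<noteq> 0" and eq: "F = G * H"
  shows "convergent2 H"
proof -
  obtain C1 R1 where 1: "C1 \<ge> 0" "R1 > 0" "\<And>i j. norm (F $ i $ j) \<le> C1 * R1 ^ (i + j)"
    using F unfolding convergent2_iff_bound by blast
  obtain C2 R2 where 2: "C2 \<ge> 0" "R2 > 0" "\<And>i j. norm (G $ i $ j) \<le> C2 * R2 ^ (i + j)"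
    using G unfolding convergent2_iff_bound by blast
  define R where "R = max R1 R2"
  have R: "R > 0" using 1 by (auto simp: R_def)
  define k where "k = subdegree G"
  define g where "g a = G $ (k + a)" for a
  define B where "B = (C1 + C2) * R ^ k"
  have B: "B \<ge> 0" using 1 2 R by (simp add: B_def)
  have bnd: "norm (A $ (k + a) $ j) \<le> B * R ^ a * R ^ j"
    if "C \<ge> 0" "C \<le> C1 + C2" "R' > 0" "R' \<le> R" "\<And>i j. norm (A $ i $ j) \<le> C * R' ^ (i + j)"
    for A :: "complex fps fps" and a j C R'
  proof -
    have "norm (A $ (k + a) $ j) \<le> C * R' ^ (k + a + j)" by (rule that)
    also have "\<dots> \<le> (C1 + C2) * R ^ (k + a + j)"
      using that by (intro mult_mono power_mono) auto
    finally show ?thesis by (simp add: B_def power_add mult_ac)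
  qed
  have gb: "norm (g a $ j) \<le> B * R ^ a * R ^ j" for a j
    unfolding g_def using 1 2 by (intro bnd[of C2 R2]) (auto simp: R_def)
  have Fb: "norm (F $ (k + a) $ j) \<le> B * R ^ a * R ^ j" for a j
    using 1 2 by (intro bnd[of C1 R1]) (auto simp: R_def)
  have "g 0 \<noteq> 0" using \<open>G \<noteq> 0\<close> by (simp add: g_def k_def)
  then obtain \<rho> K where \<rho>: "0 < \<rho>" "\<rho> \<le> 1 / (2 * R)" "K > 0"
    and K: "\<And>p c. row_bound \<rho> (g 0 * p) c \<Longrightarrow> row_bound \<rho> p (K * c)"
    using row_division_bound[of "g 0" "B * R ^ 0" R "1 / (2 * R)"] gb[of 0] B R
    by (metis (no_types, lifting) divide_pos_pos mult_pos_pos zero_less_numeral zero_less_one mult_1_right power_0)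
  have R\<rho>: "R * \<rho> \<le> 1/2" using \<rho> R by (simp add: field_simps)
  have gr: "row_bound \<rho> (g a) (2 * B * R ^ a)" for a
    using row_bound_geometric[of "g a" "B * R ^ a" R \<rho>, OF gb] B R \<rho> R\<rho> by (simp add: mult_ac)
  have Fr: "row_bound \<rho> (F $ (k + a)) (2 * B * R ^ a)" for a
    using row_bound_geometric[of "F $ (k + a)" "B * R ^ a" R \<rho>, OF Fb] B R \<rho> R\<rho> by (simp add: mult_ac)
  have rec: "F $ (k + i) = (\<Sum>a\<le>i. g a * H $ (i - a))" for i
  proof -
    have "F $ (k + i) = (\<Sum>a\<le>k + i. G $ a * H $ (k + i - a))"
      by (simp add: eq fps_mult_nth atLeast0AtMost)
    also have "\<dots> = (\<Sum>a\<in>{k..k + i}. G $ a * H $ (k + i - a))"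
      by (intro sum.mono_neutral_right) (auto simp: k_def nth_less_subdegree_zero)
    also have "\<dots> = (\<Sum>a\<le>i. g a * H $ (i - a))"
      by (rule sum.reindex_bij_witness[of _ "\<lambda>a. k + a" "\<lambda>a. a - k"]) (auto simp: g_def add.commute)
    finally show ?thesis .
  qed
  define D where "D = 2 * K * B"
  have D: "D \<ge> 0" using B \<rho> by (simp add: D_def)
  define A where "A = 2 * D"
  \<comment> \<open>Chosen so that \<open>T - R = 2 * D * R\<close>. Then \<open>geo\<close>
    collapses \<open>2 * D\<close> times the convolution sum to \<open>T ^ i - R ^ i\<close>, the
    term \<open>D * R ^ i\<close> cancels, and the induction closes with \<open>D * T ^ i\<close>,
    which is at most \<open>A * T ^ i\<close>.\<close>
  define T where "T = R * (1 + 2 * D)"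
  have T: "T \<ge> R" "T > 0" using R D by (auto simp: T_def algebra_simps intro!: mult_nonneg_nonneg add_pos_nonneg)
  have geo: "(T - R) * (\<Sum>a=1..i. R ^ a * T ^ (i - a)) = R * (T ^ i - R ^ i)" for i
  proof (induction i)
    case (Suc i)
    have "(\<Sum>a=1..Suc i. R ^ a * T ^ (Suc i - a)) = (\<Sum>a=1..i. R ^ a * T ^ (Suc i - a)) + R ^ Suc i"
      by simp
    also have "(\<Sum>a=1..i. R ^ a * T ^ (Suc i - a)) = T * (\<Sum>a=1..i. R ^ a * T ^ (i - a))"
      unfolding sum_distrib_left by (intro sum.cong) (auto simp: Suc_diff_le)
    finally have "(T - R) * (\<Sum>a=1..Suc i. R ^ a * T ^ (Suc i - a))
        = T * (R * (T ^ i - R ^ i)) + (T - R) * R ^ Suc i"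
      unfolding Suc.IH[symmetric] by (simp only: distrib_left mult_ac)
    then show ?case by (simp add: algebra_simps)
  qed auto
  have Hb: "row_bound \<rho> (H $ i) (A * T ^ i)" for i
  proof (induction i rule: less_induct)
    case (less i)
    have "(\<Sum>a\<le>i. g a * H $ (i - a)) = g 0 * H $ i + (\<Sum>a=1..i. g a * H $ (i - a))"
      unfolding atLeast0AtMost[symmetric] by (subst sum.atLeast_Suc_atMost) auto
    then have "g 0 * H $ i = F $ (k + i) - (\<Sum>a=1..i. g a * H $ (i - a))"
      by (simp add: rec)
    moreover have "row_bound \<rho> (F $ (k + i) - (\<Sum>a=1..i. g a * H $ (i - a)))
        (2 * B * R ^ i + (\<Sum>a=1..i. (2 * B * R ^ a) * (A * T ^ (i - a))))"
      using less \<rho> gr Fr by (intro row_bound_diff row_bound_sum row_bound_mult) auto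
    ultimately have "row_bound \<rho> (H $ i)
        (K * (2 * B * R ^ i + (\<Sum>a=1..i. (2 * B * R ^ a) * (A * T ^ (i - a)))))"
      by (intro K) simp
    moreover have "K * (2 * B * R ^ i + (\<Sum>a=1..i. (2 * B * R ^ a) * (A * T ^ (i - a)))) \<le> A * T ^ i"
    proof -
      have "K * (2 * B * R ^ i + (\<Sum>a=1..i. (2 * B * R ^ a) * (A * T ^ (i - a))))
          = D * R ^ i + 2 * D * (D * (\<Sum>a=1..i. R ^ a * T ^ (i - a)))"
        by (simp add: D_def A_def sum_distrib_left algebra_simps)
      also have "2 * D * R * (\<Sum>a=1..i. R ^ a * T ^ (i - a)) = R * (T ^ i - R ^ i)"
        using geo[of i] by (simp add: T_def algebra_simps)
      then have "2 * (D * (\<Sum>a=1..i. R ^ a * T ^ (i - a))) = T ^ i - R ^ i"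
        using R by (metis (no_types, lifting) mult.assoc mult.left_commute mult_cancel_left less_irrefl)
      then have "2 * D * (D * (\<Sum>a=1..i. R ^ a * T ^ (i - a))) = D * (T ^ i - R ^ i)"
        by (metis mult.assoc mult.commute)
      finally have "K * (2 * B * R ^ i + (\<Sum>a=1..i. (2 * B * R ^ a) * (A * T ^ (i - a))))
          = D * T ^ i"
        by (simp add: algebra_simps)
      also have "\<dots> \<le> A * T ^ i" using D T by (simp add: A_def)
      finally show ?thesis .
    qed
    ultimately show ?case by (rule row_bound_mono)
  qed
  have "norm (H $ i $ j) \<le> A * (max T (1 / \<rho>)) ^ (i + j)" for i j
  proof -
    have "norm (H $ i $ j) \<le> A * T ^ i * (1 / \<rho>) ^ j"
      by (rule row_bound_nth[OF Hb \<rho>(1)])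
    also have "\<dots> \<le> A * max T (1 / \<rho>) ^ i * max T (1 / \<rho>) ^ j"
      using T D \<rho> by (intro mult_mono power_mono) (auto simp: A_def)
    finally show ?thesis by (simp add: power_add mult.assoc)
  qed
  then show ?thesis
    unfolding convergent2_iff_bound using D T
    by (intro exI[of _ A] exI[of _ "max T (1 / \<rho>)"]) (auto simp: A_def)
qed


section \<open>Algebra of convergent power series\<close>

lemma convergent2_Rep: "convergent2 (Rep_cps2 f)"
  using Rep_cps2 by auto

lemmas cps2_rep_simps = zero_cps2.rep_eq one_cps2.rep_eq uminus_cps2.rep_eq plus_cps2.rep_eq
  minus_cps2.rep_eq times_cps2.rep_eq

lemma Rep_power: "Rep_cps2 (f ^ n) = Rep_cps2 f ^ n"
  by (induction n) (auto simp: cps2_rep_simps)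

lemma cps2_eqI: "Rep_cps2 f = Rep_cps2 g \<Longrightarrow> f = g"
  by (simp add: Rep_cps2_inject)

lemma Rep_eq_0_iff [simp]: "Rep_cps2 f = 0 \<longleftrightarrow> f = 0"
  by (metis Rep_cps2_inject zero_cps2.rep_eq)

text \<open>A formal cofactor of a nonzero convergent divisor is itself convergent by
  \<open>convergent2_divide\<close>. Hence divisibility can be established by purely formal
  constructions.\<close>

lemma dvd_cps2_iff: "f dvd g \<longleftrightarrow> Rep_cps2 f dvd Rep_cps2 g"
proof
  assume "f dvd g"
  then show "Rep_cps2 f dvd Rep_cps2 g" by (auto elim!: dvdE simp: cps2_rep_simps)
next
  assume "Rep_cps2 f dvd Rep_cps2 g"
  then obtain H where H: "Rep_cps2 g = Rep_cps2 f * H" by (elim dvdE)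
  show "f dvd g"
  proof (cases "f = 0")
    case True
    then have "Rep_cps2 g = 0" using H by simp
    then show ?thesis using True by simp
  next
    case False
    then have "convergent2 H"
      using convergent2_divide[OF convergent2_Rep convergent2_Rep _ H] by simp
    then have "Rep_cps2 (Abs_cps2 H) = H" by (simp add: Abs_cps2_inverse)
    then have "g = f * Abs_cps2 H" using H by (intro cps2_eqI) (simp add: cps2_rep_simps)
    then show ?thesis by simp
  qed
qed

lemma convergent2_bounded_by:
  assumes "\<And>i j. norm (F $ i $ j) \<le> C" "C \<ge> 0"
  shows "convergent2 F"
  unfolding convergent2_iff_bound using assms
  by (intro exI[of _ C] exI[of _ 1]) auto

section \<open>Coordinate functions, partial derivatives and order of convergent series\<close>

lift_definition X2 :: cps2 is Xf
  by (rule convergent2_bounded_by[of _ 1]) (auto simp: Xf_nth)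

lift_definition Y2 :: cps2 is Yf
  by (rule convergent2_bounded_by[of _ 1]) (auto simp: Yf_nth)

text \<open>Absorbs the factor produced by differentiation into the geometric bound, at the price of
  doubling its ratio; one form for each partial derivative.\<close>

lemma Suc_le_power2_add: "real (i + 1) \<le> 2 ^ (i + j)" "real (i + 1) \<le> 2 ^ (j + i)"
proof -
  have "i + 1 \<le> 2 ^ i" using Suc_leI[OF less_exp[of i]] by simp
  also have "\<dots> \<le> (2::nat) ^ (i + j)" by (rule power_increasing) auto
  finally have "real (i + 1) \<le> real (2 ^ (i + j))" by (rule of_nat_mono)
  then show "real (i + 1) \<le> 2 ^ (i + j)" "real (i + 1) \<le> 2 ^ (j + i)"
    by (simp_all add: add.commute)
qed

lemma convergent2_dXf:
  assumes "convergent2 F" shows "convergent2 (dXf F)"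
proof -
  obtain C R where C: "C \<ge> 0" "R > 0" "\<And>i j. norm (F $ i $ j) \<le> C * R ^ (i + j)"
    using assms unfolding convergent2_iff_bound by blast
  have "norm (dXf F $ i $ j) \<le> C * R * (2 * R) ^ (i + j)" for i j
  proof -
    have "norm (dXf F $ i $ j) \<le> real (i + 1) * (C * R ^ (i + 1 + j))"
      unfolding dXf_nth norm_mult norm_of_nat using C(1,2) by (intro mult_left_mono C(3)) auto
    also have "\<dots> \<le> 2 ^ (i + j) * (C * R ^ (i + 1 + j))"
      using C(1,2) by (intro mult_right_mono Suc_le_power2_add) auto
    finally show ?thesis by (simp add: power_mult_distrib mult_ac)
  qed
  then show ?thesis unfolding convergent2_iff_bound using C
    by (intro exI[of _ "C * R"] exI[of _ "2 * R"]) auto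
qed

lemma convergent2_dYf:
  assumes "convergent2 F" shows "convergent2 (dYf F)"
proof -
  obtain C R where C: "C \<ge> 0" "R > 0" "\<And>i j. norm (F $ i $ j) \<le> C * R ^ (i + j)"
    using assms unfolding convergent2_iff_bound by blast
  have "norm (dYf F $ i $ j) \<le> C * R * (2 * R) ^ (i + j)" for i j
  proof -
    have "norm (dYf F $ i $ j) \<le> real (j + 1) * (C * R ^ (i + (j + 1)))"
      unfolding dYf_nth norm_mult norm_of_nat using C(1,2) by (intro mult_left_mono C(3)) auto
    also have "\<dots> \<le> 2 ^ (i + j) * (C * R ^ (i + (j + 1)))"
      using C(1,2) by (intro mult_right_mono Suc_le_power2_add) auto
    finally show ?thesis by (simp add: power_mult_distrib mult_ac)
  qed
  then show ?thesis unfolding convergent2_iff_bound using C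
    by (intro exI[of _ "C * R"] exI[of _ "2 * R"]) auto
qed

lift_definition dX2 :: "cps2 \<Rightarrow> cps2" is dXf by (rule convergent2_dXf)
lift_definition dY2 :: "cps2 \<Rightarrow> cps2" is dYf by (rule convergent2_dYf)

lift_definition order2_ge :: "nat \<Rightarrow> cps2 \<Rightarrow> bool" is order_ge .

lemma dX2_add: "dX2 (f + g) = dX2 f + dX2 g" by transfer (rule dXf_add)
lemma dY2_add: "dY2 (f + g) = dY2 f + dY2 g" by transfer (rule dYf_add)
lemma dX2_mult: "dX2 (f * g) = f * dX2 g + dX2 f * g" by transfer (rule dXf_mult)
lemma dY2_mult: "dY2 (f * g) = f * dY2 g + dY2 f * g" by transfer (rule dYf_mult)
lemma dX2_const [simp]: "dX2 (const2 c) = 0" by transfer simp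
lemma dY2_const [simp]: "dY2 (const2 c) = 0" by transfer simp
lemma dX2_X2 [simp]: "dX2 X2 = 1" and dY2_X2 [simp]: "dY2 X2 = 0"
  and dX2_Y2 [simp]: "dX2 Y2 = 0" and dY2_Y2 [simp]: "dY2 Y2 = 1"
  by (transfer; simp)+

lemma order2_ge_0 [simp]: "order2_ge 0 f" by transfer simp
lemma order2_ge_zero [simp]: "order2_ge n 0" by transfer simp
lemma order2_ge_mono: "order2_ge n f \<Longrightarrow> m \<le> n \<Longrightarrow> order2_ge m f"
  by transfer (rule order_ge_mono)
lemma order2_ge_add: "order2_ge n f \<Longrightarrow> order2_ge n g \<Longrightarrow> order2_ge n (f + g)"
  by transfer (rule order_ge_add)
lemma order2_ge_diff: "order2_ge n f \<Longrightarrow> order2_ge n g \<Longrightarrow> order2_ge n (f - g)"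
  by transfer (rule order_ge_diff)
lemma order2_ge_mult: "order2_ge m f \<Longrightarrow> order2_ge n g \<Longrightarrow> order2_ge (m + n) (f * g)"
  by transfer (rule order_ge_mult)
lemma order2_ge_mult1: "order2_ge m f \<Longrightarrow> order2_ge m (f * g)"
  by transfer (rule order_ge_mult1)
lemma order2_ge_X2: "order2_ge 1 X2" by transfer (rule order_ge_Xf)
lemma order2_ge_Y2: "order2_ge 1 Y2" by transfer (rule order_ge_Yf)
lemma order2_ge_coeff: "order2_ge n f \<longleftrightarrow> (\<forall>i j. i + j < n \<longrightarrow> coeff2 f i j = 0)"
  by transfer (simp add: order_ge_def)
lemma order2_ge_all_imp_0: "(\<And>n. order2_ge n f) \<Longrightarrow> f = 0"
  by transfer (rule order_ge_all_imp_0)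

lemma const2_mult: "const2 (a * b) = const2 a * const2 b" by transfer simp
lemma const2_0 [simp]: "const2 0 = 0" by transfer simp
lemma const2_1 [simp]: "const2 1 = 1" by transfer simp
lemma coeff2_const2: "coeff2 (const2 c) i j = (if i = 0 \<and> j = 0 then c else 0)"
  by transfer auto
lemma coeff2_const_mult: "coeff2 (const2 c * f) i j = c * coeff2 f i j"
  by transfer (rule const_mult_nth)
lemma coeff2_add: "coeff2 (f + g) i j = coeff2 f i j + coeff2 g i j" by transfer simp
lemma coeff2_diff: "coeff2 (f - g) i j = coeff2 f i j - coeff2 g i j" by transfer simp
lemma coeff2_zero [simp]: "coeff2 0 i j = 0" by transfer simp
lemma coeff2_mult_00: "coeff2 (f * g) 0 0 = coeff2 f 0 0 * coeff2 g 0 0" by transfer simp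
lemma coeff2_X2: "coeff2 X2 i j = (if i = 1 \<and> j = 0 then 1 else 0)" by transfer (rule Xf_nth)
lemma coeff2_Y2: "coeff2 Y2 i j = (if i = 0 \<and> j = 1 then 1 else 0)" by transfer (rule Yf_nth)
lemma coeff2_X2_mult: "coeff2 (X2 * f) i j = (if i = 0 then 0 else coeff2 f (i - 1) j)"
  by transfer (rule Xf_mult_nth)
lemma coeff2_Y2_mult: "coeff2 (Y2 * f) i j = (if j = 0 then 0 else coeff2 f i (j - 1))"
  by transfer (rule Yf_mult_nth)
lemma coeff2_dX2: "coeff2 (dX2 f) i j = of_nat (i + 1) * coeff2 f (i + 1) j"
  by transfer (rule dXf_nth)
lemma coeff2_dY2: "coeff2 (dY2 f) i j = of_nat (j + 1) * coeff2 f i (j + 1)"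
  by transfer (rule dYf_nth)
lemma order2_ge_dX2: "order2_ge (Suc n) f \<Longrightarrow> order2_ge n (dX2 f)"
  by transfer (rule order_ge_dXf)
lemma order2_ge_dY2: "order2_ge (Suc n) f \<Longrightarrow> order2_ge n (dY2 f)"
  by transfer (rule order_ge_dYf)

lemma unit_cps2_iff: "f dvd 1 \<longleftrightarrow> coeff2 f 0 0 \<noteq> 0"
proof
  assume "f dvd 1"
  then obtain g where "1 = f * g" by (elim dvdE)
  then have "coeff2 f 0 0 * coeff2 g 0 0 = coeff2 1 0 0" by (simp flip: coeff2_mult_00)
  also have "coeff2 1 0 0 = 1" by transfer simp
  finally show "coeff2 f 0 0 \<noteq> 0" by auto
next
  assume "coeff2 f 0 0 \<noteq> 0"
  then obtain G where "Rep_cps2 f * G = 1" by (metis coeff2.rep_eq fps2_unit)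
  then show "f dvd 1" unfolding dvd_cps2_iff one_cps2.rep_eq by (metis dvd_triv_left)
qed


section \<open>Division along the variable X\<close>

text \<open>Row 0 is the residue modulo \<open>X2\<close>, a series in the second variable.
  Primality of \<open>X2\<close> then comes from the absence of zero divisors among such
  series.\<close>

lemma X2_dvd_iff: "X2 dvd f \<longleftrightarrow> Rep_cps2 f $ 0 = 0"
proof
  assume "X2 dvd f"
  then show "Rep_cps2 f $ 0 = 0"
    by (auto elim!: dvdE simp: cps2_rep_simps X2.rep_eq Xf_def)
next
  assume "Rep_cps2 f $ 0 = 0"
  then have "Rep_cps2 f = fps_X * fps_shift 1 (Rep_cps2 f)"
    by (intro fps_ext) auto
  then show "X2 dvd f"
    unfolding dvd_cps2_iff X2.rep_eq Xf_def by (metis dvd_triv_left)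
qed

lemma X2_prime: "X2 dvd f * g \<Longrightarrow> \<not> X2 dvd f \<Longrightarrow> X2 dvd g"
  by (auto simp: X2_dvd_iff cps2_rep_simps)

lemma X2_nonzero [simp]: "X2 \<noteq> 0"
  by (metis coeff2_X2 coeff2_zero one_neq_zero)

lemma X2_factor:
  assumes "f \<noteq> 0"
  obtains g where "f = X2 ^ subdegree (Rep_cps2 f) * g" "\<not> X2 dvd g"
    "Rep_cps2 g $ 0 = Rep_cps2 f $ subdegree (Rep_cps2 f)"
proof -
  let ?k = "subdegree (Rep_cps2 f)"
  have eq: "Rep_cps2 f = fps_X ^ ?k * fps_shift ?k (Rep_cps2 f)"
    by (metis fps_shift_times_fps_X_power le_refl mult.commute)
  then have "X2 ^ ?k dvd f"
    unfolding dvd_cps2_iff Rep_power X2.rep_eq Xf_def by (metis dvd_triv_left)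
  then obtain g where g: "f = X2 ^ ?k * g" by (elim dvdE)
  then have "Rep_cps2 f = fps_X ^ ?k * Rep_cps2 g"
    by (metis Rep_power X2.rep_eq Xf_def times_cps2.rep_eq)
  then have 0: "Rep_cps2 g $ 0 = Rep_cps2 f $ ?k"
    by (metis cancel_comm_monoid_add_class.diff_cancel fps_X_power_mult_nth less_irrefl)
  have "Rep_cps2 f $ ?k \<noteq> 0" using assms by simp
  then show thesis using that[OF g] 0 by (simp add: X2_dvd_iff)
qed

text \<open>Regards a single row as a series in the second variable, so that the quotient of two
  rows is covered by \<open>convergent2_divide\<close>.\<close>

lemma convergent2_fps_const:
  assumes "convergent2 F"
  shows "convergent2 (fps_const (F $ k))"
proof -
  obtain C R where C: "C \<ge> 0" "R > 0" "\<And>i j. norm (F $ i $ j) \<le> C * R ^ (i + j)"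
    using assms unfolding convergent2_iff_bound by blast
  have "norm (fps_const (F $ k) $ i $ j) \<le> C * R ^ k * R ^ (i + j)" for i j
    using C(3)[of k j] C(1,2) by (auto simp: power_add mult.assoc)
  then show ?thesis unfolding convergent2_iff_bound using C
    by (intro exI[of _ "C * R ^ k"] exI[of _ R]) auto
qed

text \<open>Only row \<open>k\<close> of \<open>p\<close> has to be cancelled, where
  \<open>k\<close> is the order of \<open>d\<close> in the first variable. In each case allowed by
  the hypothesis, row \<open>k\<close> of \<open>p\<close> is zero or has at least the order of row
  \<open>k\<close> of \<open>d\<close>, hence is a multiple of it; the quotient \<open>c\<close> is
  convergent and involves the second variable only.\<close>

lemma leading_row_division:
  assumes "d \<noteq> 0"
    and "p = 0 \<or> subdegree (Rep_cps2 d) < subdegree (Rep_cps2 p) \<or>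
      subdegree (Rep_cps2 d) = subdegree (Rep_cps2 p) \<and>
      subdegree (Rep_cps2 d $ subdegree (Rep_cps2 d))
        \<le> subdegree (Rep_cps2 p $ subdegree (Rep_cps2 d))"
  obtains c q where "p = c * d + X2 ^ Suc (subdegree (Rep_cps2 d)) * q"
proof -
  define k where "k = subdegree (Rep_cps2 d)"
  obtain d' where d': "d = X2 ^ k * d'" "\<not> X2 dvd d'" "Rep_cps2 d' $ 0 = Rep_cps2 d $ k"
    using X2_factor[OF assms(1)] unfolding k_def by metis
  have "X2 ^ k dvd p"
  proof (cases "p = 0")
    case False
    then show ?thesis
      using X2_factor[OF False] assms(2) unfolding k_def
      by (metis dvd_mult2 dvd_refl le_imp_power_dvd nat_le_linear not_less)
  qed auto
  then obtain p' where p': "p = X2 ^ k * p'" by (elim dvdE)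
  have p'0: "Rep_cps2 p' $ 0 = Rep_cps2 p $ k"
    unfolding p' times_cps2.rep_eq Rep_power X2.rep_eq Xf_def
    by (simp add: fps_X_power_mult_nth)
  have "Rep_cps2 d' $ 0 dvd Rep_cps2 p' $ 0"
  proof (cases "Rep_cps2 p $ k = 0")
    case False
    then have "subdegree (Rep_cps2 p) \<le> k" by (rule subdegree_leI)
    moreover have "Rep_cps2 d $ k \<noteq> 0" using assms(1) by (simp add: k_def)
    ultimately show ?thesis
      using False assms(2) unfolding p'0 d'(3) by (auto simp: zero_cps2.rep_eq fps_dvd_iff k_def)
  qed (simp add: p'0)
  then obtain c where c: "Rep_cps2 p' $ 0 = Rep_cps2 d' $ 0 * c" by (elim dvdE)
  have "fps_const (Rep_cps2 p' $ 0) = fps_const (Rep_cps2 d' $ 0) * fps_const c"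
    by (simp add: c)
  moreover have "fps_const (Rep_cps2 d' $ 0) \<noteq> 0"
    using d'(2) by (simp add: X2_dvd_iff fps_const_eq_0_iff)
  ultimately have "convergent2 (fps_const c)"
    using convergent2_divide[OF convergent2_fps_const[OF convergent2_Rep]
        convergent2_fps_const[OF convergent2_Rep]] by blast
  then have C: "Rep_cps2 (Abs_cps2 (fps_const c)) = fps_const c" by (simp add: Abs_cps2_inverse)
  have "X2 dvd p' - Abs_cps2 (fps_const c) * d'"
    by (simp add: X2_dvd_iff cps2_rep_simps C c mult.commute)
  then obtain q where "p' - Abs_cps2 (fps_const c) * d' = X2 * q" by (elim dvdE)
  then have "p = Abs_cps2 (fps_const c) * d + X2 ^ Suc k * q"
    by (simp add: p' d'(1) algebra_simps)
  then show thesis using that unfolding k_def by blast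
qed

text \<open>Minimality for the pair (order in \<open>X2\<close>, order of the leading row) excludes
  exactly those \<open>p\<close> to which \<open>leading_row_division\<close> does not apply.
  \<open>S\<close> is an arbitrary set, so nothing relates \<open>q\<close> to \<open>S\<close>;
  each application has to supply that itself.\<close>

lemma lex_minimal_element:
  assumes "p0 \<in> S" "p0 \<noteq> 0"
  obtains d k d' where "d \<in> S" "d = X2 ^ k * d'" "\<not> X2 dvd d'"
    "\<And>p. p \<in> S \<Longrightarrow> \<exists>c q. p = c * d + X2 ^ Suc k * q"
proof -
  define v where "v p = (subdegree (Rep_cps2 p), subdegree (Rep_cps2 p $ subdegree (Rep_cps2 p)))" for p
  have "wf (inv_image (less_than <*lex*> less_than) v)"
    by (intro wf_inv_image wf_lex_prod wf_less_than)
  then obtain d where d: "d \<in> S - {0}" "\<And>p. (p, d) \<in> inv_image (less_than <*lex*> less_than) v \<Longrightarrow> p \<notin> S - {0}"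
    using assms wfE_min[of _ p0 "S - {0}"] by (metis DiffI empty_iff insert_iff)
  have "\<exists>c q. p = c * d + X2 ^ Suc (subdegree (Rep_cps2 d)) * q" if "p \<in> S" for p
  proof -
    have "p = 0 \<or> (p, d) \<notin> inv_image (less_than <*lex*> less_than) v"
      using d(2) that by blast
    then have "p = 0 \<or> subdegree (Rep_cps2 d) < subdegree (Rep_cps2 p) \<or>
      subdegree (Rep_cps2 d) = subdegree (Rep_cps2 p) \<and>
      subdegree (Rep_cps2 d $ subdegree (Rep_cps2 d))
        \<le> subdegree (Rep_cps2 p $ subdegree (Rep_cps2 d))"
      by (auto simp: v_def)
    then show ?thesis using leading_row_division[of d p] d(1) by blast
  qed
  moreover obtain d' where "d = X2 ^ subdegree (Rep_cps2 d) * d'" "\<not> X2 dvd d'"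
    using X2_factor[of d] d(1) by (metis DiffE singletonI)
  ultimately show thesis using that d(1) by blast
qed

text \<open>Unrolling gives \<open>p 0\<close> as \<open>d\<close> times a partial sum of the series
  with terms \<open>c n * X2 ^ n\<close>, up to a multiple of \<open>X2 ^ N\<close>. The full sum
  \<open>H\<close> exists formally, and formal divisibility suffices.\<close>

lemma dvd_of_X2_expansion:
  assumes p: "\<And>n. p n = c n * d + X2 * p (Suc n)"
  shows "d dvd p (0::nat)"
proof -
  define H where "H = Abs_fps (\<lambda>k. \<Sum>n\<le>k. Rep_cps2 (c n) $ (k - n))"
  have H: "order_ge N (H - (\<Sum>n<N. Rep_cps2 (c n) * fps_X ^ n))" for N
    unfolding order_ge_def
  proof (intro allI impI)
    fix i j assume "i + j < N"
    then have "(\<Sum>n<N. Rep_cps2 (c n) * fps_X ^ n) $ i = (\<Sum>n\<le>i. Rep_cps2 (c n) $ (i - n))"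
      unfolding fps_sum_nth
      by (intro sum.mono_neutral_cong_right) (auto simp: fps_X_power_mult_right_nth)
    then show "(H - (\<Sum>n<N. Rep_cps2 (c n) * fps_X ^ n)) $ i $ j = 0"
      by (simp add: H_def)
  qed
  have part: "Rep_cps2 (p 0) = (\<Sum>n<N. Rep_cps2 (c n) * fps_X ^ n) * Rep_cps2 d
      + fps_X ^ N * Rep_cps2 (p N)" for N
  proof (induction N)
    case (Suc N)
    have "Rep_cps2 (p N) = Rep_cps2 (c N) * Rep_cps2 d + fps_X * Rep_cps2 (p (Suc N))"
      using p[of N] by (metis X2.rep_eq Xf_def plus_cps2.rep_eq times_cps2.rep_eq)
    then show ?case unfolding Suc by (simp add: algebra_simps)
  qed auto
  have "order_ge N (Rep_cps2 (p 0) - H * Rep_cps2 d)" for N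
  proof -
    have "Rep_cps2 (p 0) - H * Rep_cps2 d
        = fps_X ^ N * Rep_cps2 (p N) - (H - (\<Sum>n<N. Rep_cps2 (c n) * fps_X ^ n)) * Rep_cps2 d"
      by (subst part[of N]) (simp add: algebra_simps)
    moreover have "order_ge N (fps_X ^ N * Rep_cps2 (p N))"
      by (auto simp: order_ge_def fps_X_power_mult_nth)
    ultimately show ?thesis
      using order_ge_mult1[OF H] by (auto intro!: order_ge_diff)
  qed
  then have "Rep_cps2 (p 0) - H * Rep_cps2 d = 0" by (rule order_ge_all_imp_0)
  then show ?thesis by (simp add: dvd_cps2_iff)
qed

text \<open>A Nakayama argument: every element of \<open>S\<close> is a multiple of \<open>d\<close>
  plus \<open>X2\<close> times an element of \<open>S\<close>, and iterating this expands
  \<open>p\<close> in powers of \<open>X2\<close> with coefficients divisible by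
  \<open>d\<close>.\<close>

lemma dvd_of_X2_closed:
  assumes "\<And>p. p \<in> S \<Longrightarrow> \<exists>c. \<exists>p'\<in>S. p = c * d + X2 * p'" and "p \<in> S"
  shows "d dvd p"
proof -
  obtain c s where cs: "\<And>p. p \<in> S \<Longrightarrow> s p \<in> S \<and> p = c p * d + X2 * s p"
    using assms(1) by metis
  define P where "P n = (s ^^ n) p" for n :: nat
  have "P n \<in> S" for n by (induction n) (auto simp: P_def assms(2) cs)
  then have "P n = c (P n) * d + X2 * P (Suc n)" for n
    using cs[of "P n"] by (simp add: P_def)
  from dvd_of_X2_expansion[of P "\<lambda>n. c (P n)", OF this] show ?thesis by (simp add: P_def)
qed


section \<open>Freeness of syzygy modules\<close>

text \<open>A lexicographically minimal element \<open>g = X2 ^ k * g'\<close> generates: a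
  remainder \<open>X2 ^ Suc k * q\<close> in the ideal can be divided once by \<open>X2\<close>
  without leaving the ideal, so the ideal satisfies the hypothesis of
  \<open>dvd_of_X2_closed\<close>.\<close>

lemma colon_ideal_principal:
  fixes f s t :: cps2
  assumes "f \<noteq> 0"
  obtains g where "f dvd g * s" "f dvd g * t"
    "\<And>m. f dvd m * s \<Longrightarrow> f dvd m * t \<Longrightarrow> g dvd m"
proof -
  define J where "J = {g. f dvd g * s \<and> f dvd g * t}"
  have "f \<in> J" by (simp add: J_def)
  then obtain g k g' where g: "g \<in> J" "g = X2 ^ k * g'" "\<not> X2 dvd g'"
    and div: "\<And>p. p \<in> J \<Longrightarrow> \<exists>c q. p = c * g + X2 ^ Suc k * q"
    using lex_minimal_element[OF _ assms] by metis
  \<comment> \<open>Comparing the cofactors \<open>e\<close> of \<open>X2 ^ Suc k * q * s\<close>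
    and \<open>r\<close> of \<open>g * s\<close> gives \<open>X2 * q * r = g' * e\<close>. As
    \<open>X2\<close> does not divide \<open>g'\<close>, it divides \<open>e\<close> and can be
    cancelled.\<close>
  have sat: "f dvd X2 ^ k * q * s" if q: "f dvd X2 ^ Suc k * q * s" and gs: "f dvd g * s" for q s
  proof -
    obtain e where e: "X2 ^ Suc k * q * s = f * e" using q by (elim dvdE)
    obtain r where r: "g * s = f * r" using gs by (elim dvdE)
    have "X2 ^ k * f * (X2 * q * r) = X2 ^ Suc k * q * (f * r)" by (simp add: mult_ac)
    also have "\<dots> = g * (X2 ^ Suc k * q * s)" by (simp add: mult_ac flip: r)
    also have "\<dots> = X2 ^ k * f * (g' * e)" unfolding e g(2) by (simp add: mult_ac)
    finally have "X2 * q * r = g' * e" using assms by simp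
    then have "X2 dvd g' * e" by (metis dvd_triv_left mult.assoc)
    then obtain e' where "e = X2 * e'" using X2_prime g(3) by (meson dvdE)
    then have "X2 * (X2 ^ k * q * s) = X2 * (f * e')" using e by (simp add: mult_ac)
    then have "X2 ^ k * q * s = f * e'" by simp
    then show ?thesis by simp
  qed
  have "\<exists>c. \<exists>p'\<in>J. p = c * g + X2 * p'" if p: "p \<in> J" for p
  proof -
    obtain c q where cq: "p = c * g + X2 ^ Suc k * q" using div[OF p] by blast
    have "f dvd X2 ^ Suc k * q * u" if "f dvd p * u" "f dvd g * u" for u
    proof -
      have "X2 ^ Suc k * q * u = p * u - c * (g * u)" by (simp add: cq algebra_simps)
      then show ?thesis using that by (metis dvd_diff dvd_mult)
    qed
    then have "X2 ^ k * q \<in> J" using p g(1) sat by (auto simp: J_def)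
    then show ?thesis using cq by (metis mult.assoc power_Suc)
  qed
  then have "g dvd m" if "m \<in> J" for m using dvd_of_X2_closed[of J g m] that by blast
  then show thesis using that[of g] g(1) by (auto simp: J_def)
qed

text \<open>
  A pair of elements of the module whose determinant has lexicographically least leading monomial
  is a basis: by Cramer's rule every element is, modulo the submodule of multiples of \<open>X2\<close>, a
  combination of this pair.
\<close>

lemma syzygy_module_free:
  fixes f s t :: cps2
  assumes "f \<noteq> 0"
  obtains a1 b1 a2 b2 where "f dvd a1 * s + b1 * t" "f dvd a2 * s + b2 * t"
    "a1 * b2 - a2 * b1 \<noteq> 0"
    "\<And>a b. f dvd a * s + b * t \<Longrightarrow> \<exists>g h. a = g * a1 + h * a2 \<and> b = g * b1 + h * b2"
proof -
  define M where "M = {(a, b). f dvd a * s + b * t}"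
  define S where "S = {a1 * b2 - a2 * b1 | a1 b1 a2 b2. (a1, b1) \<in> M \<and> (a2, b2) \<in> M}"
  have inS: "a1 * b2 - a2 * b1 \<in> S" if "(a1, b1) \<in> M" "(a2, b2) \<in> M" for a1 b1 a2 b2
    using that by (auto simp: S_def)
  \<comment> \<open>The pairs \<open>(f, 0)\<close> and \<open>(0, f)\<close> always lie in
    \<open>M\<close>, so a nonzero determinant exists.\<close>
  have "f * f - 0 * 0 \<in> S" by (intro inS) (auto simp: M_def)
  moreover have "f * f - 0 * 0 \<noteq> 0" using assms by simp
  ultimately obtain d k d' where d: "d \<in> S" "d = X2 ^ k * d'" "\<not> X2 dvd d'"
    and div: "\<And>p. p \<in> S \<Longrightarrow> \<exists>c q. p = c * d + X2 ^ Suc k * q"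
    by (rule lex_minimal_element) blast
  have d0: "d \<noteq> 0" using d by auto
  obtain a1 b1 a2 b2 where dd: "d = a1 * b2 - a2 * b1" and m: "(a1, b1) \<in> M" "(a2, b2) \<in> M"
    using d(1) by (auto simp: S_def)
  obtain h1 h2 where h: "a1 * s + b1 * t = f * h1" "a2 * s + b2 * t = f * h2"
    using m by (auto simp: M_def elim!: dvdE)
  have step: "\<exists>c e a' b'. (a', b') \<in> M \<and> a = c * a1 + e * a2 + X2 * a' \<and> b = c * b1 + e * b2 + X2 * b'"
    if ab: "(a, b) \<in> M" for a b
  proof -
    obtain c q where c: "a * b2 - a2 * b = c * d + X2 ^ Suc k * q"
      using div[OF inS[OF ab m(2)]] by blast
    obtain e r where e: "a1 * b - a * b1 = e * d + X2 ^ Suc k * r"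
      using div[OF inS[OF m(1) ab]] by blast
    define a' where "a' = a - c * a1 - e * a2"
    define b' where "b' = b - c * b1 - e * b2"
    \<comment> \<open>By Cramer's rule the multiples of \<open>d\<close> cancel and only the
      remainders are left. Cancelling \<open>X2 ^ k\<close> leaves \<open>d' * a'\<close> divisible
      by \<open>X2\<close>, hence \<open>a'\<close>; the same is done for \<open>b'\<close>.\<close>
    have "d * a' = X2 ^ Suc k * (q * a1 + r * a2)"
    proof -
      have "d * a' = d * a - (c * d) * a1 - (e * d) * a2" by (simp add: a'_def algebra_simps)
      also have "c * d = a * b2 - a2 * b - X2 ^ Suc k * q" using c by simp
      also have "e * d = a1 * b - a * b1 - X2 ^ Suc k * r" using e by simp
      finally show ?thesis unfolding dd by (simp add: algebra_simps)
    qed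
    then have "X2 ^ k * (d' * a') = X2 ^ k * (X2 * (q * a1 + r * a2))"
      unfolding d(2) by (simp add: mult_ac)
    then have A: "d' * a' = X2 * (q * a1 + r * a2)" by simp
    have "d * b' = X2 ^ Suc k * (q * b1 + r * b2)"
    proof -
      have "d * b' = d * b - (c * d) * b1 - (e * d) * b2" by (simp add: b'_def algebra_simps)
      also have "c * d = a * b2 - a2 * b - X2 ^ Suc k * q" using c by simp
      also have "e * d = a1 * b - a * b1 - X2 ^ Suc k * r" using e by simp
      finally show ?thesis unfolding dd by (simp add: algebra_simps)
    qed
    then have "X2 ^ k * (d' * b') = X2 ^ k * (X2 * (q * b1 + r * b2))"
      unfolding d(2) by (simp add: mult_ac)
    then have B: "d' * b' = X2 * (q * b1 + r * b2)" by simp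
    obtain a'' where a'': "a' = X2 * a''"
      using X2_prime[of d' a'] A d(3) by (auto elim: dvdE)
    obtain b'' where b'': "b' = X2 * b''"
      using X2_prime[of d' b'] B d(3) by (auto elim: dvdE)
    obtain h0 where h0: "a * s + b * t = f * h0" using ab by (auto simp: M_def elim: dvdE)
    define h' where "h' = h0 - c * h1 - e * h2"
    have h': "a' * s + b' * t = f * h'"
    proof -
      have "a' * s + b' * t = (a * s + b * t) - c * (a1 * s + b1 * t) - e * (a2 * s + b2 * t)"
        by (simp add: a'_def b'_def algebra_simps)
      then show ?thesis by (simp add: h h0 h'_def algebra_simps)
    qed
    \<comment> \<open>For \<open>(a'', b'')\<close> to lie in \<open>M\<close>, the cofactor
      \<open>h'\<close> must also be divisible by \<open>X2\<close>; this follows by multiplying its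
      defining equation by \<open>d'\<close>.\<close>
    have "f * (d' * h') = (d' * a') * s + (d' * b') * t"
      by (simp add: algebra_simps flip: h')
    also have "\<dots> = X2 * (q * (a1 * s + b1 * t) + r * (a2 * s + b2 * t))"
      unfolding A B by (simp add: algebra_simps)
    also have "\<dots> = f * (X2 * (q * h1 + r * h2))"
      unfolding h by (simp add: algebra_simps)
    finally have "d' * h' = X2 * (q * h1 + r * h2)" using assms by simp
    then obtain h'' where h'': "h' = X2 * h''"
      using X2_prime[of d' h'] d(3) by (auto elim: dvdE)
    have "X2 * (a'' * s + b'' * t) = X2 * (f * h'')"
      using h' unfolding a'' b'' h'' by (simp add: algebra_simps)
    then have "a'' * s + b'' * t = f * h''" by simp
    then have "(a'', b'') \<in> M" by (simp add: M_def)
    moreover have "a = c * a1 + e * a2 + X2 * a''" "b = c * b1 + e * b2 + X2 * b''"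
      using a'' b'' unfolding a'_def b'_def by (simp_all add: algebra_simps)
    ultimately show ?thesis by blast
  qed
  \<comment> \<open>The two Cramer numerators inherit the decomposition of \<open>step\<close>, so
    \<open>dvd_of_X2_closed\<close> makes both divisible by the determinant
    \<open>d\<close>.\<close>
  have dvd1: "d dvd a * b2 - a2 * b" if ab: "(a, b) \<in> M" for a b
  proof (rule dvd_of_X2_closed[where S = "{a * b2 - a2 * b | a b. (a, b) \<in> M}"])
    fix p assume "p \<in> {a * b2 - a2 * b | a b. (a, b) \<in> M}"
    then obtain a b where p: "p = a * b2 - a2 * b" "(a, b) \<in> M" by blast
    obtain c e a' b' where *: "(a', b') \<in> M" "a = c * a1 + e * a2 + X2 * a'"
      "b = c * b1 + e * b2 + X2 * b'" using step[OF p(2)] by blast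
    have "p = c * d + X2 * (a' * b2 - a2 * b')"
      unfolding p(1) dd *(2,3) by (simp add: algebra_simps)
    then show "\<exists>c. \<exists>p'\<in>{a * b2 - a2 * b | a b. (a, b) \<in> M}. p = c * d + X2 * p'"
      using *(1) by blast
  qed (use ab in blast)
  have dvd2: "d dvd a1 * b - a * b1" if ab: "(a, b) \<in> M" for a b
  proof (rule dvd_of_X2_closed[where S = "{a1 * b - a * b1 | a b. (a, b) \<in> M}"])
    fix p assume "p \<in> {a1 * b - a * b1 | a b. (a, b) \<in> M}"
    then obtain a b where p: "p = a1 * b - a * b1" "(a, b) \<in> M" by blast
    obtain c e a' b' where *: "(a', b') \<in> M" "a = c * a1 + e * a2 + X2 * a'"
      "b = c * b1 + e * b2 + X2 * b'" using step[OF p(2)] by blast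
    have "p = e * d + X2 * (a1 * b' - a' * b1)"
      unfolding p(1) dd *(2,3) by (simp add: algebra_simps)
    then show "\<exists>c. \<exists>p'\<in>{a1 * b - a * b1 | a b. (a, b) \<in> M}. p = c * d + X2 * p'"
      using *(1) by blast
  qed (use ab in blast)
  have "\<exists>g h. a = g * a1 + h * a2 \<and> b = g * b1 + h * b2" if ab: "f dvd a * s + b * t" for a b
  proof -
    have M: "(a, b) \<in> M" using ab by (simp add: M_def)
    obtain g where g: "a * b2 - a2 * b = d * g" using dvd1[OF M] by (elim dvdE)
    obtain h where h: "a1 * b - a * b1 = d * h" using dvd2[OF M] by (elim dvdE)
    have "d * a = (a * b2 - a2 * b) * a1 + (a1 * b - a * b1) * a2"
      unfolding dd by (simp add: algebra_simps)
    also have "\<dots> = d * (g * a1 + h * a2)" unfolding g h by (simp add: algebra_simps)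
    finally have 1: "a = g * a1 + h * a2" using d0 by simp
    have "d * b = (a * b2 - a2 * b) * b1 + (a1 * b - a * b1) * b2"
      unfolding dd by (simp add: algebra_simps)
    also have "\<dots> = d * (g * b1 + h * b2)" unfolding g h by (simp add: algebra_simps)
    finally have 2: "b = g * b1 + h * b2" using d0 by simp
    show ?thesis using 1 2 by blast
  qed
  then show thesis
    using that[of a1 b1 a2 b2] m d0 unfolding dd by (auto simp: M_def)
qed


section \<open>Squarefree series and their derivatives\<close>

text \<open>In characteristic 0, if the leading form of \<open>u\<close> is not constant, then the
  derivative in a variable occurring in it has smaller order than \<open>u\<close> and cannot be a
  multiple of \<open>u\<close>.\<close>

lemma unit_of_dvd_derivatives:
  assumes "u \<noteq> 0" "u dvd dX2 u" "u dvd dY2 u"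
  shows "u dvd 1"
proof (rule ccontr)
  assume nu: "\<not> u dvd 1"
  have "Rep_cps2 u \<noteq> 0" using assms(1) by simp
  then obtain n i j where n: "order_ge n (Rep_cps2 u)" "i + j = n" "Rep_cps2 u $ i $ j \<noteq> 0"
    by (rule exists_order)
  have c: "coeff2 u i j \<noteq> 0" using n(3) by (simp add: coeff2.rep_eq)
  have "order2_ge n u" using n(1) by (simp add: order2_ge.rep_eq)
  then have o: "order2_ge n (dX2 u)" "order2_ge n (dY2 u)"
    using assms(2,3) by (auto elim!: dvdE intro: order2_ge_mult1)
  have "i \<noteq> 0 \<or> j \<noteq> 0" using nu c unfolding unit_cps2_iff by metis
  then consider "i > 0" | "j > 0" by linarith
  then show False
  proof cases
    case 1
    then have "coeff2 (dX2 u) (i - 1) j = 0"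
      using o(1) n(2) unfolding order2_ge_coeff by simp
    then show False using 1 c by (simp add: coeff2_dX2)
  next
    case 2
    then have "coeff2 (dY2 u) i (j - 1) = 0"
      using o(2) n(2) unfolding order2_ge_coeff by simp
    then show False using 2 c by (simp add: coeff2_dY2)
  qed
qed

text \<open>
  If \<open>g\<close> generates the ideal of all \<open>m\<close> with \<open>f dvd m * dX2 f\<close> and \<open>f dvd m * dY2 f\<close>, then
  \<open>f = g * u\<close> where \<open>u\<close> divides \<open>g * dX2 u\<close> and \<open>g * dY2 u\<close>. Repeating this with \<open>u\<close> in place of
  \<open>f\<close> produces a common factor of \<open>g\<close> and \<open>u\<close>, which is a unit; hence so is \<open>u\<close>.
\<close>

lemma squarefree_dvd_of_dvd_derivatives:
  assumes sf: "squarefree f" and m: "f dvd m * dX2 f" "f dvd m * dY2 f"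
  shows "f dvd m"
proof -
  have split: "f = 0 \<or> (\<exists>g u. f = g * u \<and> u dvd dX2 f \<and> u dvd dY2 f \<and>
      (\<forall>m. f dvd m * dX2 f \<and> f dvd m * dY2 f \<longrightarrow> g dvd m))" for f
  proof (cases "f = 0")
    case False
    obtain g where g: "f dvd g * dX2 f" "f dvd g * dY2 f"
      "\<And>m. f dvd m * dX2 f \<Longrightarrow> f dvd m * dY2 f \<Longrightarrow> g dvd m"
      using colon_ideal_principal[OF False] by metis
    have "g dvd f" by (intro g(3)) auto
    then obtain u where u: "f = g * u" by (elim dvdE)
    then have "g \<noteq> 0" using False by auto
    then have "u dvd dX2 f" "u dvd dY2 f" using g(1,2) unfolding u by auto
    then show ?thesis using u g(3) by blast
  qed simp
  have f0: "f \<noteq> 0" using sf by auto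
  then obtain g u where gu: "f = g * u" "u dvd dX2 f" "u dvd dY2 f"
    and gm: "\<And>m. f dvd m * dX2 f \<Longrightarrow> f dvd m * dY2 f \<Longrightarrow> g dvd m"
    using split[of f] by blast
  have u0: "u \<noteq> 0" using f0 gu by auto
  obtain g' u' where gu': "u = g' * u'" "u' dvd dX2 u" "u' dvd dY2 u"
    and gm': "\<And>m. u dvd m * dX2 u \<Longrightarrow> u dvd m * dY2 u \<Longrightarrow> g' dvd m"
    using split[of u] u0 by blast
  have "u dvd g * dX2 u"
    using gu(2) unfolding gu(1) dX2_mult by (simp add: dvd_add_left_iff)
  moreover have "u dvd g * dY2 u"
    using gu(3) unfolding gu(1) dY2_mult by (simp add: dvd_add_left_iff)
  ultimately have "g' dvd g" by (rule gm')
  then have "g' ^ 2 dvd f"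
    unfolding gu(1) gu'(1) power2_eq_square by (metis dvd_triv_left mult_dvd_mono)
  then have "g' dvd 1" using sf by (auto simp: squarefree_def)
  then have "u dvd u'" unfolding gu'(1) by simp
  then have "u dvd dX2 u" "u dvd dY2 u" using gu'(2,3) by (auto intro: dvd_trans)
  then have "u dvd 1" by (rule unit_of_dvd_derivatives[OF u0])
  then have "f dvd g" unfolding gu(1) by simp
  moreover have "g dvd m" by (rule gm[OF m])
  ultimately show ?thesis by (rule dvd_trans)
qed


section \<open>Derivations\<close>

lemma derivation_add: "derivation \<delta> \<Longrightarrow> \<delta> (g + h) = \<delta> g + \<delta> h"
  and derivation_scale: "derivation \<delta> \<Longrightarrow> \<delta> (const2 c * g) = const2 c * \<delta> g"
  and derivation_mult: "derivation \<delta> \<Longrightarrow> \<delta> (g * h) = g * \<delta> h + h * \<delta> g"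
  unfolding derivation_def by blast+

lemma derivation_combination:
  assumes "derivation \<delta>1" "derivation \<delta>2"
  shows "derivation (\<lambda>k. g * \<delta>1 k + h * \<delta>2 k)"
  unfolding derivation_def
proof (intro conjI allI)
  fix u v c
  show "g * \<delta>1 (u + v) + h * \<delta>2 (u + v) = g * \<delta>1 u + h * \<delta>2 u + (g * \<delta>1 v + h * \<delta>2 v)"
    unfolding derivation_add[OF assms(1)] derivation_add[OF assms(2)] by (simp only: algebra_simps)
  show "g * \<delta>1 (const2 c * u) + h * \<delta>2 (const2 c * u) = const2 c * (g * \<delta>1 u + h * \<delta>2 u)"
    unfolding derivation_scale[OF assms(1)] derivation_scale[OF assms(2)] by (simp only: algebra_simps)
  show "g * \<delta>1 (u * v) + h * \<delta>2 (u * v)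
      = u * (g * \<delta>1 v + h * \<delta>2 v) + v * (g * \<delta>1 u + h * \<delta>2 u)"
    unfolding derivation_mult[OF assms(1)] derivation_mult[OF assms(2)] by (simp only: algebra_simps)
qed

lemma derivation_partials: "derivation (\<lambda>k. a * dX2 k + b * dY2 k)"
  unfolding derivation_def by (simp add: dX2_add dY2_add dX2_mult dY2_mult algebra_simps)

text \<open>Splitting off row 0 leaves a multiple of \<open>X2\<close>, and splitting the constant
  off row 0 leaves a multiple of \<open>Y2\<close>.\<close>

lemma hadamard:
  obtains g1 g2 where "g = const2 (coeff2 g 0 0) + X2 * g1 + Y2 * g2"
proof -
  define r where "r = Rep_cps2 g $ 0"
  define G where "G = Abs_cps2 (fps_const r)"
  have G: "Rep_cps2 G = fps_const r"
    unfolding G_def r_def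
    by (intro Abs_cps2_inverse) (simp add: convergent2_fps_const convergent2_Rep)
  have "X2 dvd g - G" by (simp add: X2_dvd_iff cps2_rep_simps G r_def)
  then obtain g1 where g1: "g - G = X2 * g1" by (elim dvdE)
  have "Rep_cps2 (G - const2 (coeff2 g 0 0)) = Yf * fps_const (fps_shift 1 r)"
    by (intro fps2_eqI, unfold Yf_mult_nth)
       (auto simp: cps2_rep_simps G const2.rep_eq coeff2.rep_eq r_def)
  then have "Y2 dvd G - const2 (coeff2 g 0 0)"
    unfolding dvd_cps2_iff Y2.rep_eq by simp
  then obtain g2 where g2: "G - const2 (coeff2 g 0 0) = Y2 * g2" by (elim dvdE)
  have "g = const2 (coeff2 g 0 0) + X2 * g1 + Y2 * g2"
    using g1 g2 by (simp add: algebra_simps)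
  then show thesis by (rule that)
qed

lemma derivation_const:
  assumes "derivation \<delta>" shows "\<delta> (const2 c) = 0"
proof -
  have "\<delta> (1 * 1) = 1 * \<delta> 1 + 1 * \<delta> 1" by (rule derivation_mult[OF assms])
  then have "\<delta> 1 + \<delta> 1 = \<delta> 1 + 0" by (simp only: mult_1_left add_0_right)
  then have "\<delta> 1 = 0" by (rule add_left_imp_eq)
  then show ?thesis using derivation_scale[OF assms, of c 1] by simp
qed

text \<open>A derivation is purely algebraic and cannot be applied termwise to a series. Instead,
  the difference \<open>D\<close> of both sides kills \<open>X2\<close> and \<open>Y2\<close>, so
  \<open>hadamard\<close> raises a lower bound for the order of all values of \<open>D\<close> by
  one; all values therefore have infinite order.\<close>

lemma derivation_eq_partials:
  assumes "derivation \<delta>"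
  shows "\<delta> g = \<delta> X2 * dX2 g + \<delta> Y2 * dY2 g"
proof -
  define D where "D k = 1 * \<delta> k + (- 1) * (\<delta> X2 * dX2 k + \<delta> Y2 * dY2 k)" for k
  have D: "derivation D" unfolding D_def
    by (intro derivation_combination assms derivation_partials)
  have DX: "D X2 = 0" "D Y2 = 0" by (simp_all add: D_def)
  have "order2_ge n (D g)" for n g
  proof (induction n arbitrary: g)
    case (Suc n)
    obtain g1 g2 where g: "g = const2 (coeff2 g 0 0) + X2 * g1 + Y2 * g2" by (rule hadamard)
    have "D g = D (const2 (coeff2 g 0 0)) + D (X2 * g1) + D (Y2 * g2)"
      by (subst g) (simp only: derivation_add[OF D])
    also have "\<dots> = X2 * D g1 + Y2 * D g2"
      by (simp add: DX derivation_const[OF D] derivation_mult[OF D])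
    finally have eq: "D g = X2 * D g1 + Y2 * D g2" .
    have "order2_ge (1 + n) (X2 * D g1)" "order2_ge (1 + n) (Y2 * D g2)"
      by (intro order2_ge_mult order2_ge_X2 order2_ge_Y2 Suc)+
    then show ?case unfolding eq by (auto intro: order2_ge_add)
  qed simp
  then have "D g = 0" by (rule order2_ge_all_imp_0)
  then show ?thesis
    by (simp only: D_def mult_1_left mult_minus_left add_uminus_conv_diff right_minus_eq)
qed

lemma order2_ge_1_iff: "order2_ge 1 f \<longleftrightarrow> coeff2 f 0 0 = 0"
  by (auto simp: order2_ge_coeff)

lemma Der_iff: "\<delta> \<in> Der f \<longleftrightarrow> derivation \<delta> \<and> f dvd \<delta> X2 * dX2 f + \<delta> Y2 * dY2 f"
  unfolding Der_def mem_Collect_eq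
  using derivation_eq_partials[of \<delta> f] by (intro conj_cong refl) simp

lemma Der_combination:
  assumes "\<delta>1 \<in> Der f" "\<delta>2 \<in> Der f"
  shows "(\<lambda>k. g * \<delta>1 k + h * \<delta>2 k) \<in> Der f"
  using assms by (auto simp: Der_def intro: derivation_combination dvd_add dvd_mult)

text \<open>By \<open>derivation_eq_partials\<close> a derivation is the pair of its values at
  \<open>X2\<close> and \<open>Y2\<close>, which identifies \<open>Der f\<close> with a syzygy
  module. The nonzero determinant yields uniqueness of the coefficients.\<close>

lemma Der_basis_exists:
  assumes "f \<noteq> 0"
  obtains \<delta>1 \<delta>2 where "Der_basis f \<delta>1 \<delta>2"
proof -
  obtain a1 b1 a2 b2 where d: "f dvd a1 * dX2 f + b1 * dY2 f" "f dvd a2 * dX2 f + b2 * dY2 f"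
    "a1 * b2 - a2 * b1 \<noteq> 0"
    and gen: "\<And>a b. f dvd a * dX2 f + b * dY2 f \<Longrightarrow> \<exists>g h. a = g * a1 + h * a2 \<and> b = g * b1 + h * b2"
    using syzygy_module_free[OF assms, of "dX2 f" "dY2 f"] by metis
  define \<delta>1 where "\<delta>1 = (\<lambda>k. a1 * dX2 k + b1 * dY2 k)"
  define \<delta>2 where "\<delta>2 = (\<lambda>k. a2 * dX2 k + b2 * dY2 k)"
  have in_Der: "\<delta>1 \<in> Der f" "\<delta>2 \<in> Der f"
    unfolding \<delta>1_def \<delta>2_def Der_def using d by (auto intro: derivation_partials)
  have "\<exists>!(g, h). \<delta> = (\<lambda>k. g * \<delta>1 k + h * \<delta>2 k)" if \<delta>: "\<delta> \<in> Der f" for \<delta>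
  proof -
    obtain g h where gh: "\<delta> X2 = g * a1 + h * a2" "\<delta> Y2 = g * b1 + h * b2"
      using gen \<delta> by (meson Der_iff)
    have der: "derivation \<delta>" using \<delta> by (simp add: Der_def)
    have "\<delta> = (\<lambda>k. g * \<delta>1 k + h * \<delta>2 k)"
      by (rule ext, subst derivation_eq_partials[OF der]) (simp add: gh \<delta>1_def \<delta>2_def algebra_simps)
    moreover have "g' = g \<and> h' = h" if "\<delta> = (\<lambda>k. g' * \<delta>1 k + h' * \<delta>2 k)" for g' h'
    proof -
      have e: "g' * a1 + h' * a2 = g * a1 + h * a2" "g' * b1 + h' * b2 = g * b1 + h * b2"
        using fun_cong[OF that, of X2] fun_cong[OF that, of Y2] gh by (simp_all add: \<delta>1_def \<delta>2_def)
      have "g' * (a1 * b2 - a2 * b1) = (g' * a1 + h' * a2) * b2 - (g' * b1 + h' * b2) * a2"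
        by (simp add: algebra_simps)
      also have "\<dots> = g * (a1 * b2 - a2 * b1)" unfolding e by (simp add: algebra_simps)
      finally have 1: "g' = g" using d(3) by simp
      have "h' * (a1 * b2 - a2 * b1) = (g' * b1 + h' * b2) * a1 - (g' * a1 + h' * a2) * b1"
        by (simp add: algebra_simps)
      also have "\<dots> = h * (a1 * b2 - a2 * b1)" unfolding e by (simp add: algebra_simps)
      finally show ?thesis using 1 d(3) by simp
    qed
    ultimately show ?thesis by (intro ex1I[of _ "(g, h)"]) auto
  qed
  then have "Der_basis f \<delta>1 \<delta>2" using in_Der unfolding Der_basis_def by blast
  then show thesis by (rule that)
qed

text \<open>Eliminating one partial derivative at a time shows that the determinant multiplies both
  \<open>dX2 f\<close> and \<open>dY2 f\<close> into the multiples of \<open>f\<close>.\<close>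

lemma saito_dvd_det:
  assumes "squarefree f" "\<delta>1 \<in> Der f" "\<delta>2 \<in> Der f"
  shows "f dvd \<delta>1 X2 * \<delta>2 Y2 - \<delta>2 X2 * \<delta>1 Y2"
proof (rule squarefree_dvd_of_dvd_derivatives[OF assms(1)])
  have d: "f dvd \<delta>1 X2 * dX2 f + \<delta>1 Y2 * dY2 f" "f dvd \<delta>2 X2 * dX2 f + \<delta>2 Y2 * dY2 f"
    using assms(2,3) by (auto simp: Der_iff)
  have "(\<delta>1 X2 * \<delta>2 Y2 - \<delta>2 X2 * \<delta>1 Y2) * dX2 f
      = \<delta>2 Y2 * (\<delta>1 X2 * dX2 f + \<delta>1 Y2 * dY2 f) - \<delta>1 Y2 * (\<delta>2 X2 * dX2 f + \<delta>2 Y2 * dY2 f)"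
    by (simp add: algebra_simps)
  then show "f dvd (\<delta>1 X2 * \<delta>2 Y2 - \<delta>2 X2 * \<delta>1 Y2) * dX2 f"
    using d by (metis dvd_diff dvd_mult)
  have "(\<delta>1 X2 * \<delta>2 Y2 - \<delta>2 X2 * \<delta>1 Y2) * dY2 f
      = \<delta>1 X2 * (\<delta>2 X2 * dX2 f + \<delta>2 Y2 * dY2 f) - \<delta>2 X2 * (\<delta>1 X2 * dX2 f + \<delta>1 Y2 * dY2 f)"
    by (simp add: algebra_simps)
  then show "f dvd (\<delta>1 X2 * \<delta>2 Y2 - \<delta>2 X2 * \<delta>1 Y2) * dY2 f"
    using d by (metis dvd_diff dvd_mult)
qed


section \<open>Semisimple vector fields with a zero eigenvalue\<close>

text \<open>Completeness for the order filtration. A coefficient of total degree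
  \<open>i + j\<close> is stable from index \<open>i + j + 1\<close> on, so the limit reads it off
  there.\<close>

lemma order_ge_limit:
  assumes "\<And>n. order_ge n (G (Suc n) - G n)"
  obtains H where "\<And>n. order_ge n (H - G n)"
proof -
  have step: "order_ge n (G (n + k) - G n)" for n k
  proof (induction k)
    case (Suc k)
    have "G (n + Suc k) - G n = (G (Suc (n + k)) - G (n + k)) + (G (n + k) - G n)" by simp
    also have "order_ge n \<dots>"
      using assms[of "n + k"] Suc by (intro order_ge_add) (auto intro: order_ge_mono)
    finally show ?case .
  qed simp
  define H where "H = Abs_fps (\<lambda>i. Abs_fps (\<lambda>j. G (i + j + 1) $ i $ j))"
  have "order_ge n (H - G n)" for n
    unfolding order_ge_def
  proof (intro allI impI)
    fix i j assume "i + j < n"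
    then obtain k where "n = i + j + 1 + k" using less_eqE by (metis Suc_eq_plus1 Suc_leI)
    then show "(H - G n) $ i $ j = 0"
      using order_geD[OF step[of "i + j + 1" k], of i j] by (simp add: H_def)
  qed
  then show thesis by (rule that)
qed

text \<open>The part of degree \<open>n\<close> of \<open>F\<close> consists of a multiple of \<open>Xf ^ n\<close> and a multiple of \<open>Yf\<close>.\<close>

definition Y_quotient :: "nat \<Rightarrow> complex fps fps \<Rightarrow> complex fps fps" where
  "Y_quotient n F = Abs_fps (\<lambda>i. Abs_fps (\<lambda>j. if i + j = n then F $ i $ (j + 1) else 0))"

lemma order_ge_Y_quotient: "order_ge n (Y_quotient n F)"
  by (auto simp: order_ge_def Y_quotient_def)

lemma Xf_power_nth: "Xf ^ n $ i $ j = (if i = n \<and> j = 0 then 1 else 0)"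
  by (simp add: Xf_def)

lemma order_ge_Xf_power: "order_ge n (Xf ^ n)"
  unfolding order_ge_def Xf_power_nth by auto

text \<open>Note the shift: \<open>Y_quotient n F\<close> is homogeneous of degree \<open>n\<close>,
  and its product with \<open>Yf\<close> accounts for degree \<open>Suc n\<close> of
  \<open>F\<close>.\<close>

lemma order_ge_remove_leading:
  assumes "order_ge (Suc n) F"
  shows "order_ge (Suc (Suc n))
    (F - fps_const (fps_const (F $ Suc n $ 0)) * Xf ^ Suc n - Yf * Y_quotient n F)"
  unfolding order_ge_def
proof (intro allI impI)
  fix i j assume "i + j < Suc (Suc n)"
  then consider "i + j < Suc n" | "i + j = Suc n" "j = 0" | "i + j = Suc n" "j > 0" by linarith
  then show "(F - fps_const (fps_const (F $ Suc n $ 0)) * Xf ^ Suc n - Yf * Y_quotient n F) $ i $ j = 0"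
  proof cases
    case 1
    then show ?thesis using order_geD[OF assms 1]
      by (simp only: fps_sub_nth const_mult_nth Xf_power_nth Yf_mult_nth) (auto simp: Y_quotient_def)
  qed (simp_all only: fps_sub_nth const_mult_nth Xf_power_nth Yf_mult_nth, simp_all add: Y_quotient_def)
qed

locale semisimple_zero_eigenvalue =
  fixes a b :: "complex fps fps"
  assumes a: "order_ge 2 (a - Xf)" and b: "order_ge 2 b"
begin

definition vf :: "complex fps fps \<Rightarrow> complex fps fps" where
  "vf G = a * dXf G + b * dYf G"

lemma vf_add: "vf (F + G) = vf F + vf G"
  by (simp add: vf_def dXf_add dYf_add algebra_simps)

lemma vf_mult: "vf (F * G) = F * vf G + vf F * G"
  by (simp add: vf_def dXf_mult dYf_mult algebra_simps)

lemma vf_const [simp]: "vf (fps_const (fps_const c)) = 0"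
  by (simp add: vf_def)

lemma vf_diff: "vf (F - G) = vf F - vf G"
  using vf_add[of "F - G" G] by simp

text \<open>On leading forms the field acts as \<open>Xf * dXf\<close>, which multiplies the
  monomial with exponents \<open>i\<close> and \<open>j\<close> by \<open>i\<close>. Every
  higher-order comparison for the field reduces to this diagonal action.\<close>

lemma vf_leading: "order_ge n G \<Longrightarrow> order_ge (Suc n) (vf G - Xf * dXf G)"
proof -
  assume G: "order_ge n G"
  have eq: "vf G - Xf * dXf G = (a - Xf) * dXf G + b * dYf G"
    by (simp add: vf_def algebra_simps)
  show ?thesis
  proof (cases n)
    case 0
    then show ?thesis unfolding eq
      using a b by (intro order_ge_add order_ge_mult1) (auto intro: order_ge_mono)
  next
    case (Suc m)
    then have "order_ge (2 + m) ((a - Xf) * dXf G)" "order_ge (2 + m) (b * dYf G)"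
      using order_ge_mult[OF a order_ge_dXf[of m G]] order_ge_mult[OF b order_ge_dYf[of m G]] G
      by simp_all
    then show ?thesis unfolding eq Suc by (intro order_ge_add) simp_all
  qed
qed

lemma order_ge_vf: "order_ge n G \<Longrightarrow> order_ge n (vf G)"
proof -
  assume G: "order_ge n G"
  have "order_ge n (Xf * dXf G)"
  proof (cases n)
    case (Suc m)
    then show ?thesis
      using order_ge_mult[OF order_ge_Xf order_ge_dXf[of m G]] G by simp
  qed simp
  then have "order_ge n ((vf G - Xf * dXf G) + Xf * dXf G)"
    using order_ge_mono[OF vf_leading[OF G], of n] by (intro order_ge_add) auto
  then show ?thesis by simp
qed

lemma vf_Xf_power: "order_ge (Suc n) (vf (Xf ^ n) - of_nat n * Xf ^ n)"
proof -
  have "order_ge (Suc n) (vf (Xf ^ n) - Xf * dXf (Xf ^ n))"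
    by (intro vf_leading order_ge_Xf_power)
  also have "Xf * dXf (Xf ^ n) = of_nat n * Xf ^ n"
  proof (rule fps2_eqI)
    fix i j
    have "(of_nat n :: complex fps fps) = fps_const (fps_const (of_nat n))"
      by (simp add: fps_of_nat)
    then show "(Xf * dXf (Xf ^ n)) $ i $ j = (of_nat n * Xf ^ n) $ i $ j"
      by (simp only: Xf_mult_nth dXf_nth const_mult_nth Xf_power_nth) auto
  qed
  finally show ?thesis .
qed

text \<open>
  The obstruction to solving \<open>vf w = l * w\<close> in degree \<open>n\<close> is a form of degree \<open>n\<close>. Its multiple of
  \<open>Xf ^ n\<close> is removed by changing \<open>w\<close>, because \<open>vf (Xf ^ n)\<close> has leading form \<open>n * Xf ^ n\<close>, and the
  rest, a multiple of \<open>Yf\<close>, by changing \<open>l\<close>.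
\<close>

lemma separatrix:
  obtains w l where "order_ge 2 (w - Yf)" "order_ge 1 l" "vf w = l * w"
proof -
  \<comment> \<open>The offset 2 is the order of the initial residue: the start
    \<open>(Yf, 0)\<close> leaves exactly \<open>b\<close>. In \<open>Q\<close> the order is only
    \<open>n + 1\<close> because \<open>l\<close> is corrected one degree below
    \<open>w\<close>.\<close>
  define P where "P n wl \<longleftrightarrow> order_ge 2 (fst wl - Yf) \<and> order_ge 1 (snd wl) \<and>
    order_ge (n + 2) (vf (fst wl) - snd wl * fst wl)" for n and wl :: "complex fps fps \<times> complex fps fps"
  define Q where "Q n wl wl' \<longleftrightarrow> order_ge (n + 1) (fst wl' - fst wl) \<and> order_ge (n + 1) (snd wl' - snd wl)"
    for n :: nat and wl wl' :: "complex fps fps \<times> complex fps fps"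
  have "P 0 (Yf, 0)" using b by (simp add: P_def vf_def numeral_2_eq_2)
  moreover have "\<exists>wl'. P (Suc n) wl' \<and> Q n wl wl'" if "P n wl" for n wl
  proof -
    obtain w l where wl: "wl = (w, l)" by force
    have w: "order_ge 2 (w - Yf)" and l: "order_ge 1 l" and e: "order_ge (n + 2) (vf w - l * w)"
      using that by (auto simp: P_def wl)
    define E where "E = vf w - l * w"
    \<comment> \<open>The denominator is the eigenvalue of \<open>Xf ^ (n + 2)\<close> under the
      leading action of the field.\<close>
    define c where "c = E $ (n + 2) $ 0 / of_nat (n + 2)"
    define C where "C = fps_const (fps_const c)"
    define q where "q = Y_quotient (n + 1) E"
    define w' where "w' = w - C * Xf ^ (n + 2)"
    define l' where "l' = l + q"
    have X: "order_ge (n + 2) (C * Xf ^ (n + 2))"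
      by (intro order_ge_mult2 order_ge_Xf_power)
    have q: "order_ge (n + 1) q" unfolding q_def by (rule order_ge_Y_quotient)
    have "order_ge 2 ((w - Yf) - C * Xf ^ (n + 2))"
      using X by (intro order_ge_diff w) (auto intro: order_ge_mono)
    then have w': "order_ge 2 (w' - Yf)" by (simp add: w'_def algebra_simps)
    have l': "order_ge 1 l'"
      unfolding l'_def using q by (intro order_ge_add l) (auto intro: order_ge_mono)
    have "of_nat (n + 2) * C = fps_const (fps_const (E $ (n + 2) $ 0))"
      by (simp add: C_def c_def flip: fps_of_nat fps_const_mult del: of_nat_add of_nat_Suc)
    then have C: "C * (of_nat (n + 2) * Xf ^ (n + 2)) = fps_const (fps_const (E $ Suc (n + 1) $ 0)) * Xf ^ Suc (n + 1)"
      by (simp add: mult_ac)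
    \<comment> \<open>The first bracket is the old residue with its form of degree
      \<open>n + 2\<close> removed. The other terms are the errors made by treating the field as its
      linear part and \<open>w\<close> as \<open>Yf\<close>, and the effect of \<open>l'\<close> on
      the correction of \<open>w\<close>; all have order at least \<open>n + 3\<close>.\<close>
    have "vf w' - l' * w' = (E - fps_const (fps_const (E $ Suc (n + 1) $ 0)) * Xf ^ Suc (n + 1) - Yf * q)
        - C * (vf (Xf ^ (n + 2)) - of_nat (n + 2) * Xf ^ (n + 2)) - q * (w - Yf) + l' * (C * Xf ^ (n + 2))"
      unfolding C[symmetric]
      by (simp only: w'_def l'_def E_def vf_diff vf_mult C_def vf_const) (simp add: algebra_simps)
    moreover have "order_ge (n + 3) (E - fps_const (fps_const (E $ Suc (n + 1) $ 0)) * Xf ^ Suc (n + 1) - Yf * q)"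
      using order_ge_remove_leading[of "n + 1" E] e by (simp add: q_def E_def numeral_3_eq_3)
    moreover have "order_ge (n + 3) (C * (vf (Xf ^ (n + 2)) - of_nat (n + 2) * Xf ^ (n + 2)))"
      using order_ge_mult2[OF vf_Xf_power[of "n + 2"]] by (simp add: numeral_3_eq_3)
    moreover have "order_ge (n + 3) (q * (w - Yf))"
      using order_ge_mult[OF q w] by (simp add: numeral_3_eq_3)
    moreover have "order_ge (n + 3) (l' * (C * Xf ^ (n + 2)))"
      using order_ge_mult[OF l' X] by (simp add: numeral_3_eq_3)
    ultimately have "order_ge (n + 3) (vf w' - l' * w')"
      by (simp only: order_ge_add order_ge_diff)
    then have "P (Suc n) (w', l')" using w' l' by (simp add: P_def numeral_3_eq_3)
    moreover have "Q n wl (w', l')"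
      using X q order_ge_mono[of "n + 2" "0 - C * Xf ^ (n + 2)" "n + 1"]
      by (auto simp: Q_def wl w'_def l'_def order_ge_def)
    ultimately show ?thesis by blast
  qed
  ultimately obtain s where s: "\<And>n. P n (s n)" "\<And>n. Q n (s n) (s (Suc n))"
    using dependent_nat_choice[of P Q] by metis
  have "order_ge n (fst (s (Suc n)) - fst (s n))" "order_ge n (snd (s (Suc n)) - snd (s n))" for n
    using s(2)[of n] by (auto simp: Q_def intro: order_ge_mono)
  then obtain w l where w: "\<And>n. order_ge n (w - fst (s n))" and l: "\<And>n. order_ge n (l - snd (s n))"
    using order_ge_limit[of "\<lambda>n. fst (s n)"] order_ge_limit[of "\<lambda>n. snd (s n)"] by metis
  have "order_ge n (vf w - l * w)" for n
  proof -
    define wn ln where "wn = fst (s n)" and "ln = snd (s n)"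
    have "vf w - l * w = (vf wn - ln * wn) + vf (w - wn) - (l - ln) * w - ln * (w - wn)"
      unfolding vf_diff by (simp add: algebra_simps)
    moreover have "order_ge n (vf wn - ln * wn)"
      using s(1)[of n] by (auto simp: P_def wn_def ln_def intro: order_ge_mono)
    moreover have "order_ge n (vf (w - wn))" "order_ge n (ln * (w - wn))"
      using w[of n] unfolding wn_def by (auto intro: order_ge_vf order_ge_mult2)
    moreover have "order_ge n ((l - ln) * w)"
      using l[of n] unfolding ln_def by (rule order_ge_mult1)
    ultimately show ?thesis by (simp only: order_ge_add order_ge_diff)
  qed
  then have "vf w - l * w = 0" by (rule order_ge_all_imp_0)
  then have "vf w = l * w" by simp
  moreover have "order_ge 2 ((w - fst (s 2)) + (fst (s 2) - Yf))"
    using w[of 2] s(1)[of 2] by (intro order_ge_add) (auto simp: P_def)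
  moreover have "order_ge 1 ((l - snd (s 1)) + snd (s 1))"
    using l[of 1] s(1)[of 1] by (intro order_ge_add) (auto simp: P_def)
  ultimately show thesis using that[of w l] by simp
qed

text \<open>The product \<open>(w - Yf) * t\<close> has order at least two more than the bound known
  for \<open>t\<close>, so bounds for \<open>w * t\<close> pass to \<open>Yf * t\<close>, where the
  factor can be cancelled coefficientwise.\<close>

lemma order_ge_cancel_separatrix:
  assumes w: "order_ge 2 (w - Yf)" and "order_ge (Suc n) (w * t)"
  shows "order_ge n t"
proof -
  have "k \<le> n \<Longrightarrow> order_ge k t" for k
  proof (induction k)
    case (Suc k)
    then have "order_ge (2 + k) ((w - Yf) * t)" by (intro order_ge_mult w) auto
    then have "order_ge (2 + k) (w * t - (w - Yf) * t)"
      using assms(2) Suc.prems by (intro order_ge_diff) (auto intro: order_ge_mono)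
    then have Y: "order_ge (2 + k) (Yf * t)" by (simp add: algebra_simps)
    show ?case unfolding order_ge_def
    proof (intro allI impI)
      fix i j assume "i + j < Suc k"
      then show "t $ i $ j = 0"
        using order_geD[OF Y, of i "j + 1"] unfolding Yf_mult_nth by simp
    qed
  qed simp
  then show ?thesis by simp
qed

text \<open>
  A congruence \<open>F \<equiv> w * s\<close> modulo degree \<open>n\<close> improves by one degree: comparing leading forms in the
  equation satisfied by \<open>e = F - w * s\<close> shows that the leading form of \<open>Xf * dXf e\<close> is divisible by
  \<open>Yf\<close>, hence so is that of \<open>e\<close>.
\<close>

lemma separatrix_dvd:
  assumes w: "order_ge 2 (w - Yf)" and l: "vf w = l * w"
    and F: "vf F = h * F" and h: "order_ge 1 h" and F1: "order_ge 1 F"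
  shows "w dvd F"
proof -
  define P where "P n s \<longleftrightarrow> order_ge (n + 1) (F - w * s)" for n s
  define Q where "Q n s s' \<longleftrightarrow> order_ge n (s' - s)" for n :: nat and s s' :: "complex fps fps"
  \<comment> \<open>The approximation may start at 0 because \<open>F\<close> has no constant
    term.\<close>
  have "P 0 0" using F1 by (simp add: P_def)
  moreover have "\<exists>s'. P (Suc n) s' \<and> Q n s s'" if "P n s" for n s
  proof -
    define e where "e = F - w * s"
    have e: "order_ge (Suc n) e" using that by (simp add: P_def e_def)
    define t where "t = h * s - l * s - vf s"
    have wt: "vf e = h * e + w * t"
      unfolding e_def t_def vf_diff vf_mult F l by (simp add: algebra_simps)
    have he: "order_ge (n + 2) (h * e)" using order_ge_mult[OF h e] by simp
    have "order_ge (Suc n) (vf e - h * e)"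
      using order_ge_vf[OF e] he by (intro order_ge_diff) (auto intro: order_ge_mono)
    then have "order_ge n t" using order_ge_cancel_separatrix[OF w] by (simp add: wt)
    then have "order_ge (n + 2) ((w - Yf) * t)"
      using order_ge_mult[OF w] by (simp add: add.commute)
    moreover have "order_ge (n + 2) (vf e - Xf * dXf e)" using vf_leading[OF e] by simp
    ultimately have "order_ge (n + 2) (h * e + (w - Yf) * t - (vf e - Xf * dXf e))"
      by (intro order_ge_diff[OF order_ge_add[OF he]])
    also have "h * e + (w - Yf) * t - (vf e - Xf * dXf e) = Xf * dXf e - Yf * t"
      by (simp add: wt algebra_simps)
    \<comment> \<open>The coefficient of \<open>Xf ^ (n + 1)\<close>: the multiple of
      \<open>Yf\<close> does not contribute, and the other term is \<open>n + 1\<close> times the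
      coefficient of \<open>e\<close>, which therefore vanishes.\<close>
    finally have "(Xf * dXf e - Yf * t) $ (n + 1) $ 0 = 0" by (rule order_geD) simp
    then have "of_nat (n + 1) * e $ (n + 1) $ 0 = 0"
      unfolding fps_sub_nth Xf_mult_nth Yf_mult_nth dXf_nth by simp
    then have "e $ Suc n $ 0 = 0" by (simp del: of_nat_Suc)
    then have "order_ge (n + 2) (e - Yf * Y_quotient n e)"
      using order_ge_remove_leading[OF e] by simp
    moreover have "order_ge (n + 2) ((w - Yf) * Y_quotient n e)"
      using order_ge_mult[OF w order_ge_Y_quotient[of n e]] by (simp add: add.commute)
    ultimately have "order_ge (n + 2) (e - Yf * Y_quotient n e - (w - Yf) * Y_quotient n e)"
      by (rule order_ge_diff)
    also have "e - Yf * Y_quotient n e - (w - Yf) * Y_quotient n e = F - w * (s + Y_quotient n e)"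
      by (simp add: e_def algebra_simps)
    finally have "P (Suc n) (s + Y_quotient n e)" by (simp add: P_def)
    moreover have "Q n s (s + Y_quotient n e)" by (simp add: Q_def order_ge_Y_quotient)
    ultimately show ?thesis by blast
  qed
  ultimately obtain s where s: "\<And>n. P n (s n)" "\<And>n. Q n (s n) (s (Suc n))"
    using dependent_nat_choice[of P Q] by metis
  obtain S where S: "\<And>n. order_ge n (S - s n)"
    using order_ge_limit[of s] s(2) by (metis Q_def)
  have "order_ge n (F - w * S)" for n
  proof -
    have "order_ge n (F - w * s n)"
      using s(1)[of n] by (auto simp: P_def intro: order_ge_mono)
    then have "order_ge n ((F - w * s n) - w * (S - s n))"
      by (rule order_ge_diff[OF _ order_ge_mult2[OF S]])
    then show ?thesis by (simp add: algebra_simps)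
  qed
  then have "F - w * S = 0" by (rule order_ge_all_imp_0)
  then show ?thesis by simp
qed

lemma separatrix_nth:
  assumes "order_ge 2 (w - Yf)"
  shows "w $ 0 $ 0 = 0" "w $ 0 $ 1 = 1"
  using order_geD[OF assms, of 0 0] order_geD[OF assms, of 0 1]
  unfolding fps_sub_nth Yf_nth by simp_all

text \<open>Division by \<open>w\<close> preserves the form of the equation, replacing
  \<open>h\<close> by \<open>h - l\<close>, which again has order at least 1. Each division lowers
  the bound \<open>n\<close>, and the process stops only at a series with nonzero constant
  term.\<close>

lemma separatrix_power:
  assumes w: "order_ge 2 (w - Yf)" and l: "vf w = l * w" "order_ge 1 l"
  shows "\<lbrakk>vf F = h * F; order_ge 1 h; \<not> order_ge n F\<rbrakk> \<Longrightarrow> \<exists>d u. F = w ^ d * u \<and> u $ 0 $ 0 \<noteq> 0"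
proof (induction n arbitrary: F h)
  case (Suc n)
  show ?case
  proof (cases "F $ 0 $ 0 = 0")
    case True
    then have "order_ge 1 F" by (auto simp: order_ge_def)
    then have "w dvd F" by (rule separatrix_dvd[OF w l(1) Suc.prems(1,2)])
    then obtain G where G: "F = w * G" by (elim dvdE)
    have "w \<noteq> 0" using separatrix_nth(2)[OF w] by auto
    moreover have "w * (vf G) = w * ((h - l) * G)"
      using Suc.prems(1) unfolding G vf_mult l by (simp add: algebra_simps)
    ultimately have "vf G = (h - l) * G" by simp
    moreover have "order_ge 1 (h - l)" by (intro order_ge_diff Suc.prems l)
    moreover have "\<not> order_ge n G"
    proof
      assume "order_ge n G"
      moreover have "order_ge 1 w"
        using separatrix_nth(1)[OF w] by (auto simp: order_ge_def)
      ultimately have "order_ge (1 + n) F" unfolding G by (intro order_ge_mult)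
      then show False using Suc.prems(3) by simp
    qed
    ultimately obtain d u where "G = w ^ d * u" "u $ 0 $ 0 \<noteq> 0" using Suc.IH by blast
    then show ?thesis unfolding G by (intro exI[of _ "Suc d"] exI[of _ u]) (simp add: mult.assoc)
  qed (auto intro: exI[of _ 0])
qed simp

end

text \<open>
  The curve consists of copies of a smooth formal curve \<open>w\<close>, so that \<open>r = f / dY2 f\<close> is a unit times
  \<open>w\<close>. Being a quotient of convergent series, \<open>r\<close> is convergent even though \<open>w\<close> was only
  constructed formally.
\<close>

lemma semisimple_zero_eigenvalue_contradiction:
  assumes sf: "squarefree f" and f2: "order2_ge 2 f"
    and a: "order2_ge 2 (a - X2)" and b: "order2_ge 2 b"
    and eq: "a * dX2 f + b * dY2 f = h * f" and h: "coeff2 h 0 0 = 0"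
  shows False
proof -
  interpret semisimple_zero_eigenvalue "Rep_cps2 a" "Rep_cps2 b"
    using a b by unfold_locales (simp_all add: order2_ge.rep_eq minus_cps2.rep_eq X2.rep_eq)
  define F where "F = Rep_cps2 f"
  have F: "vf F = Rep_cps2 h * F"
    using arg_cong[OF eq, of Rep_cps2]
    by (simp add: vf_def F_def cps2_rep_simps dX2.rep_eq dY2.rep_eq)
  have h1: "order_ge 1 (Rep_cps2 h)" using h by (simp add: order_ge_def coeff2.rep_eq)
  have F2: "order_ge 2 F" using f2 by (simp add: F_def order2_ge.rep_eq)
  have "f \<noteq> 0" using sf by auto
  then have "F \<noteq> 0" by (simp add: F_def)
  then obtain n where n: "\<not> order_ge n F" using order_ge_all_imp_0 by blast
  obtain w l where w: "order_ge 2 (w - Yf)" and l: "order_ge 1 l" "vf w = l * w"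
    by (rule separatrix)
  obtain d u where u: "F = w ^ d * u" "u $ 0 $ 0 \<noteq> 0"
    using separatrix_power[OF w l(2,1) F h1 n] by blast
  have w0: "w $ 0 $ 0 = 0" and w1: "w $ 0 $ 1 = 1" using separatrix_nth[OF w] by auto
  have wu: "(w * v) $ 0 $ 1 = v $ 0 $ 0" for v
    unfolding fps2_mult_nth using w0 w1 by simp
  have "F $ 0 $ 0 = 0" by (rule order_geD[OF F2]) simp
  then have "d \<noteq> 0" using u by (intro notI) simp
  have "F $ 0 $ 1 = 0" by (rule order_geD[OF F2]) simp
  then have "d \<noteq> 1" using u wu[of u] by (intro notI) simp
  obtain k where k: "d = Suc k" using \<open>d \<noteq> 0\<close> by (cases d) auto
  define D where "D = (of_nat d :: complex fps fps)"
  have dpow: "dYf (w ^ Suc m) = of_nat (Suc m) * w ^ m * dYf w"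
    "dXf (w ^ Suc m) = of_nat (Suc m) * w ^ m * dXf w" for m
    by (induction m) (simp_all add: dYf_mult dXf_mult algebra_simps)
  \<comment> \<open>\<open>W\<close> and \<open>V\<close> remain after taking \<open>w ^ k\<close>
    out of the partial derivatives of \<open>w ^ d * u\<close>. Since \<open>dYf w\<close> is 1 at
    the origin and \<open>d\<close> is not 0, \<open>W\<close> is a unit, so the quotient of
    \<open>F\<close> by \<open>dYf F\<close> is \<open>w * u / W\<close>.\<close>
  define W where "W = D * u * dYf w + w * dYf u"
  define V where "V = D * u * dXf w + w * dXf u"
  have dF: "dYf F = w ^ k * W" "dXf F = w ^ k * V"
    unfolding u(1) k dYf_mult dXf_mult dpow W_def V_def D_def by (simp_all add: algebra_simps)
  have D00: "D $ 0 $ 0 = of_nat d" by (simp add: D_def flip: fps_of_nat)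
  have "W $ 0 $ 0 = of_nat d * u $ 0 $ 0"
    using w1 by (simp add: W_def D00 dYf_nth w0)
  then have W0: "W $ 0 $ 0 \<noteq> 0" using u(2) \<open>d \<noteq> 0\<close> by simp
  then obtain W' where W': "W * W' = 1" by (rule fps2_unit)
  then have "W $ 0 $ 0 * W' $ 0 $ 0 = 1" by (simp flip: fps2_mult_nth_0)
  then have W'0: "W' $ 0 $ 0 \<noteq> 0" by auto
  define r where "r = w * (u * W')"
  have "w \<noteq> 0" "W \<noteq> 0" using w1 W0 by auto
  then have dF0: "dYf F \<noteq> 0" by (simp add: dF)
  have "dYf F * r = w ^ d * u * (W * W')" by (simp add: dF r_def k mult_ac)
  then have Fr: "F = dYf F * r" by (simp add: W' u(1))
  have "convergent2 r"
    by (rule convergent2_divide[OF _ _ dF0 Fr])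
       (simp_all add: F_def convergent2_Rep convergent2_dYf)
  then obtain r2 where r2: "Rep_cps2 r2 = r" by (metis Abs_cps2_inverse mem_Collect_eq)
  have "f dvd r2 * dX2 f"
  proof -
    have "r * dXf F = F * (W' * V)" unfolding r_def dF(2) by (simp add: u(1) k mult_ac)
    then show ?thesis
      unfolding dvd_cps2_iff times_cps2.rep_eq r2 dX2.rep_eq F_def[symmetric] by simp
  qed
  moreover have "f dvd r2 * dY2 f"
    unfolding dvd_cps2_iff times_cps2.rep_eq r2 dY2.rep_eq F_def[symmetric]
    using Fr by (metis dvd_refl mult.commute)
  ultimately have "f dvd r2" by (rule squarefree_dvd_of_dvd_derivatives[OF sf])
  \<comment> \<open>The order passes from \<open>f\<close> to its multiple \<open>r2\<close>,
    whereas \<open>r\<close> is \<open>w\<close> times a unit and so has a nonzero coefficient at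
    \<open>Yf\<close>.\<close>
  then have "order2_ge 2 r2" using f2 by (auto elim!: dvdE intro: order2_ge_mult1)
  then have "r $ 0 $ 1 = 0" by (simp add: order2_ge.rep_eq r2 order_ge_def)
  moreover have "r $ 0 $ 1 = u $ 0 $ 0 * W' $ 0 $ 0" unfolding r_def wu by simp
  ultimately show False using u(2) W'0 by simp
qed


section \<open>Sums of convergent power series\<close>

lemma product_summable:
  fixes f g :: "_ \<Rightarrow> 'a :: {real_normed_field, banach}"
  assumes f: "(\<lambda>x. norm (f x)) summable_on A" and g: "(\<lambda>x. norm (g x)) summable_on B"
  shows "(\<lambda>z. norm (case z of (x, y) \<Rightarrow> f x * g y)) summable_on A \<times> B"
    and "((\<lambda>(x, y). f x * g y) has_sum infsum f A * infsum g B) (A \<times> B)"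
proof -
  show abs: "(\<lambda>z. norm (case z of (x, y) \<Rightarrow> f x * g y)) summable_on A \<times> B"
    unfolding Infinite_Sum.abs_summable_on_Sigma_iff
    using f g by (auto simp: norm_mult infsum_cmult_right' abs_mult infsum_nonneg intro!: summable_on_cmult_right
        summable_on_cmult_left)
  then have s: "(\<lambda>(x, y). f x * g y) summable_on A \<times> B"
    by (rule abs_summable_summable)
  have "infsum (\<lambda>(x, y). f x * g y) (A \<times> B) = infsum (\<lambda>x. infsum (\<lambda>y. f x * g y) B) A"
    using infsum_Sigma_banach[OF s] by simp
  also have "\<dots> = infsum f A * infsum g B"
    by (simp add: infsum_cmult_right' infsum_cmult_left')
  finally show "((\<lambda>(x, y). f x * g y) has_sum infsum f A * infsum g B) (A \<times> B)"
    using has_sum_infsum[OF s] by simp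
qed

text \<open>Polymorphic in the coefficients, so that the same product is available for the real
  families of norms that serve as majorants.\<close>

definition cauchy2 :: "(nat \<times> nat \<Rightarrow> 'a) \<Rightarrow> (nat \<times> nat \<Rightarrow> 'a) \<Rightarrow> nat \<times> nat \<Rightarrow> 'a :: comm_semiring_0" where
  "cauchy2 f g = (\<lambda>(i, j). \<Sum>a\<le>i. \<Sum>b\<le>j. f (a, b) * g (i - a, j - b))"

text \<open>The product family is regrouped by the sum of its two indices; the fibre over
  \<open>(i, j)\<close> is the finite rectangle \<open>{..i} \<times> {..j}\<close>.\<close>

lemma cauchy2_has_sum:
  fixes f g :: "_ \<Rightarrow> 'a :: {real_normed_field, banach}"
  assumes f: "(\<lambda>x. norm (f x)) summable_on UNIV" and g: "(\<lambda>x. norm (g x)) summable_on UNIV"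
  shows "(cauchy2 f g has_sum infsum f UNIV * infsum g UNIV) UNIV"
proof -
  have "((\<lambda>(x, y). f x * g y) has_sum infsum f UNIV * infsum g UNIV) (UNIV \<times> UNIV)"
    by (rule product_summable[OF f g])
  also have "?this \<longleftrightarrow> ((\<lambda>((i, j), (a, b)). f (a, b) * g (i - a, j - b)) has_sum infsum f UNIV * infsum g UNIV)
      (Sigma UNIV (\<lambda>(i, j). {..i} \<times> {..j}))"
    by (rule has_sum_reindex_bij_witness[of _ "\<lambda>((i, j), (a, b)). ((a, b), (i - a, j - b))"
          "\<lambda>((a, b), (c, d)). ((a + c, b + d), (a, b))"]) auto
  finally show ?thesis
    by (rule has_sum_SigmaD) (auto simp: cauchy2_def sum.cartesian_product intro!: has_sum_finiteI sum.cong)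
qed

lemma norm_cauchy2_le:
  fixes f g :: "_ \<Rightarrow> 'a :: {real_normed_field, banach}"
  shows "norm (cauchy2 f g p) \<le> cauchy2 (\<lambda>x. norm (f x)) (\<lambda>x. norm (g x)) p"
  unfolding cauchy2_def by (auto simp: norm_mult split: prod.splits intro!: sum_norm_le)

lemma cauchy2_abs_summable:
  fixes f g :: "_ \<Rightarrow> 'a :: {real_normed_field, banach}"
  assumes f: "(\<lambda>x. norm (f x)) summable_on UNIV" and g: "(\<lambda>x. norm (g x)) summable_on UNIV"
  shows "(\<lambda>x. norm (cauchy2 f g x)) summable_on UNIV"
    and "infsum (\<lambda>x. norm (cauchy2 f g x)) UNIV
      \<le> infsum (\<lambda>x. norm (f x)) UNIV * infsum (\<lambda>x. norm (g x)) UNIV"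
proof -
  have s: "(cauchy2 (\<lambda>x. norm (f x)) (\<lambda>x. norm (g x)) has_sum
      infsum (\<lambda>x. norm (f x)) UNIV * infsum (\<lambda>x. norm (g x)) UNIV) UNIV"
    using f g by (intro cauchy2_has_sum) auto
  show abs: "(\<lambda>x. norm (cauchy2 f g x)) summable_on UNIV"
    by (rule summable_on_comparison_test[OF has_sum_imp_summable[OF s]])
       (auto intro: norm_cauchy2_le)
  show "infsum (\<lambda>x. norm (cauchy2 f g x)) UNIV
      \<le> infsum (\<lambda>x. norm (f x)) UNIV * infsum (\<lambda>x. norm (g x)) UNIV"
    unfolding infsumI[OF s, symmetric]
    by (intro infsum_mono abs has_sum_imp_summable[OF s] norm_cauchy2_le)
qed

section \<open>Evaluation of convergent series at a point\<close>

definition term2 :: "cps2 \<Rightarrow> complex \<times> complex \<Rightarrow> nat \<times> nat \<Rightarrow> complex" where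
  "term2 g p = (\<lambda>(i, j). coeff2 g i j * fst p ^ i * snd p ^ j)"

definition abs_conv :: "cps2 \<Rightarrow> complex \<times> complex \<Rightarrow> bool" where
  "abs_conv g p \<longleftrightarrow> (\<lambda>x. norm (term2 g p x)) summable_on UNIV"

text \<open>The series of absolute values evaluated at the moduli of the coordinates of
  \<open>p\<close>. Where \<open>abs_conv\<close> holds, it is submultiplicative and dominates
  \<open>ev2\<close>, which makes it the majorant for composition.\<close>

definition norm2 :: "cps2 \<Rightarrow> complex \<times> complex \<Rightarrow> real" where
  "norm2 g p = infsum (\<lambda>x. norm (term2 g p x)) UNIV"

lemma ev2_eq: "ev2 g p = infsum (term2 g p) UNIV"
  by (simp add: ev2_def term2_def)

lemma coeff2_mult: "coeff2 (f * g) i j = (\<Sum>a\<le>i. \<Sum>b\<le>j. coeff2 f a b * coeff2 g (i - a) (j - b))"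
  by transfer (rule fps2_mult_nth)

lemma term2_mult: "term2 (f * g) p = cauchy2 (term2 f p) (term2 g p)"
proof (rule ext)
  fix x :: "nat \<times> nat"
  obtain i j where x: "x = (i, j)" by force
  have *: "coeff2 f a b * fst p ^ a * snd p ^ b * (coeff2 g (i - a) (j - b) * fst p ^ (i - a) * snd p ^ (j - b))
      = coeff2 f a b * coeff2 g (i - a) (j - b) * fst p ^ i * snd p ^ j" if "a \<le> i" "b \<le> j" for a b
  proof -
    have "fst p ^ i = fst p ^ a * fst p ^ (i - a)" "snd p ^ j = snd p ^ b * snd p ^ (j - b)"
      using that by (simp_all flip: power_add)
    then show ?thesis by simp
  qed
  show "term2 (f * g) p x = cauchy2 (term2 f p) (term2 g p) x"
    unfolding x cauchy2_def term2_def prod.case coeff2_mult sum_distrib_right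
    by (intro sum.cong refl) (simp only: * atMost_iff)
qed

lemma abs_conv_mult:
  assumes "abs_conv f p" "abs_conv g p"
  shows "abs_conv (f * g) p" "ev2 (f * g) p = ev2 f p * ev2 g p"
    "norm2 (f * g) p \<le> norm2 f p * norm2 g p"
  using assms cauchy2_abs_summable[of "term2 f p" "term2 g p"]
    infsumI[OF cauchy2_has_sum[of "term2 f p" "term2 g p"]]
  by (simp_all add: abs_conv_def ev2_eq norm2_def term2_mult)

lemma term2_add: "term2 (f + g) p = (\<lambda>x. term2 f p x + term2 g p x)"
  by (auto simp: term2_def coeff2_add algebra_simps)

lemma term2_diff: "term2 (f - g) p = (\<lambda>x. term2 f p x + - term2 g p x)"
  by (auto simp: term2_def coeff2_diff algebra_simps)

lemma abs_conv_summable: "abs_conv f p \<Longrightarrow> term2 f p summable_on UNIV"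
  unfolding abs_conv_def by (rule abs_summable_summable)

lemma ev2_add: "abs_conv f p \<Longrightarrow> abs_conv g p \<Longrightarrow> ev2 (f + g) p = ev2 f p + ev2 g p"
  unfolding ev2_eq term2_add by (intro infsum_add abs_conv_summable)

lemma ev2_diff: "abs_conv f p \<Longrightarrow> abs_conv g p \<Longrightarrow> ev2 (f - g) p = ev2 f p - ev2 g p"
  unfolding ev2_eq term2_diff
  by (subst infsum_add) (auto simp: infsum_uminus summable_on_uminus abs_conv_summable)

lemma has_sum_single:
  fixes f :: "'a \<Rightarrow> 'b :: {topological_comm_monoid_add, t2_space}"
  assumes "\<And>x. x \<noteq> a \<Longrightarrow> f x = 0"
  shows "(f has_sum f a) UNIV"
  using has_sum_cong_neutral[of "{a}" UNIV f f "f a"] has_sum_finite[of "{a}" f] assms by auto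

lemma monomial_sums:
  assumes "\<And>x. x \<noteq> a \<Longrightarrow> term2 g p x = 0"
  shows "abs_conv g p" "ev2 g p = term2 g p a" "norm2 g p = norm (term2 g p a)"
  using infsumI[OF has_sum_single[of a "term2 g p"]]
    infsumI[OF has_sum_single[of a "\<lambda>x. norm (term2 g p x)"]]
    has_sum_imp_summable[OF has_sum_single[of a "\<lambda>x. norm (term2 g p x)"]] assms
  by (auto simp: abs_conv_def ev2_eq norm2_def)

lemma sums_const2:
  "abs_conv (const2 c) p" "ev2 (const2 c) p = c" "norm2 (const2 c) p = norm c"
  using monomial_sums[of "(0, 0)" "const2 c" p]
  by (auto simp: term2_def coeff2_const2 split: prod.splits)

lemma sums_X2: "abs_conv X2 p" "ev2 X2 p = fst p"
  using monomial_sums[of "(1, 0)" X2 p]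
  by (auto simp: term2_def coeff2_X2 split: prod.splits)

lemma sums_Y2: "abs_conv Y2 p" "ev2 Y2 p = snd p"
  using monomial_sums[of "(0, 1)" Y2 p]
  by (auto simp: term2_def coeff2_Y2 split: prod.splits)

lemma sums_power:
  assumes "abs_conv f p"
  shows "abs_conv (f ^ n) p \<and> ev2 (f ^ n) p = ev2 f p ^ n \<and> norm2 (f ^ n) p \<le> norm2 f p ^ n"
proof (induction n)
  case 0
  then show ?case using sums_const2[of 1 p] by simp
next
  case (Suc n)
  have "norm2 f p * norm2 (f ^ n) p \<le> norm2 f p * norm2 f p ^ n"
    using Suc by (intro mult_left_mono) (auto simp: norm2_def intro: infsum_nonneg)
  then show ?case using Suc abs_conv_mult[OF assms, of "f ^ n"] by auto
qed

lemma norm2_nonneg: "norm2 f p \<ge> 0"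
  by (simp add: norm2_def infsum_nonneg)

lemma norm_ev2_le: "abs_conv f p \<Longrightarrow> norm (ev2 f p) \<le> norm2 f p"
  unfolding ev2_eq norm2_def abs_conv_def by (rule norm_infsum_bound)

lemma abs_conv_radius:
  obtains r where "r > 0" "\<And>p. norm (fst p) < r \<Longrightarrow> norm (snd p) < r \<Longrightarrow> abs_conv g p"
proof -
  obtain r where r: "r > 0" "\<And>z w. norm z < r \<Longrightarrow> norm w < r \<Longrightarrow>
      (\<lambda>(i, j). Rep_cps2 g $ i $ j * z ^ i * w ^ j) summable_on UNIV"
    using convergent2_Rep[of g] unfolding convergent2_def by blast
  have "abs_conv g p" if "norm (fst p) < r" "norm (snd p) < r" for p
    using r(2)[OF that] unfolding abs_conv_def summable_on_iff_abs_summable_on_complex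
    by (simp add: term2_def coeff2.rep_eq)
  then show thesis using that r(1) by blast
qed

lemma eventually_abs_conv: "\<forall>\<^sub>F p in nhds 0. abs_conv g p"
proof -
  obtain r where r: "r > 0" "\<And>p. norm (fst p) < r \<Longrightarrow> norm (snd p) < r \<Longrightarrow> abs_conv g p"
    using abs_conv_radius by blast
  then have "abs_conv g p" if "dist p 0 < r" for p
    using that norm_fst_le[of "fst p" "snd p"] norm_snd_le[of "snd p" "fst p"]
    by (auto simp: dist_norm)
  then show ?thesis using r(1) by (auto simp: eventually_nhds_metric)
qed

text \<open>Without a constant term every monomial carries at least one factor of size at most
  \<open>norm p\<close>. Compared with its value at a fixed point \<open>s\<close> of convergence,
  each term gains the factor \<open>norm p / q\<close>.\<close>

lemma norm2_small:
  assumes "g \<in> max_ideal" "e > 0"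
  shows "\<forall>\<^sub>F p in nhds 0. norm2 g p < e"
proof -
  obtain r where r: "r > 0" "\<And>p. norm (fst p) < r \<Longrightarrow> norm (snd p) < r \<Longrightarrow> abs_conv g p"
    using abs_conv_radius by blast
  define q where "q = r / 2"
  define s where "s = (of_real q :: complex, of_real q :: complex)"
  have q: "q > 0" "q < r" using r by (auto simp: q_def)
  have abs: "abs_conv g s" using q by (intro r) (auto simp: s_def)
  have bound: "norm2 g p \<le> norm p / q * norm2 g s" if "norm p \<le> q" for p
  proof -
    define \<rho> where "\<rho> = norm p"
    have \<rho>: "norm (fst p) \<le> \<rho>" "norm (snd p) \<le> \<rho>" "0 \<le> \<rho>" "\<rho> \<le> q"
      using that norm_fst_le[of "fst p" "snd p"] norm_snd_le[of "snd p" "fst p"]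
      by (auto simp: \<rho>_def)
    have le: "norm (term2 g p x) \<le> \<rho> / q * norm (term2 g s x)" for x
    proof -
      obtain i j where x: "x = (i, j)" by force
      show ?thesis
      proof (cases "i + j = 0")
        case True
        then show ?thesis using assms(1) by (simp add: x term2_def max_ideal_def)
      next
        case False
        then obtain k where k: "i + j = Suc k" using not0_implies_Suc by blast
        have "norm (fst p) ^ i * norm (snd p) ^ j \<le> \<rho> ^ i * \<rho> ^ j"
          using \<rho> by (intro mult_mono power_mono) auto
        also have "\<dots> = \<rho> * \<rho> ^ k" by (simp add: k flip: power_add)
        also have "\<dots> \<le> \<rho> * q ^ k" using \<rho> by (intro mult_left_mono power_mono) auto
        also have "\<dots> = \<rho> / q * q ^ (i + j)" using q by (simp add: k)
        finally have "norm (coeff2 g i j) * (norm (fst p) ^ i * norm (snd p) ^ j)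
            \<le> norm (coeff2 g i j) * (\<rho> / q * q ^ (i + j))"
          by (rule mult_left_mono) simp
        then show ?thesis
          using q by (simp add: x term2_def s_def norm_mult norm_power power_add mult_ac)
      qed
    qed
    have s: "(\<lambda>x. \<rho> / q * norm (term2 g s x)) summable_on UNIV"
      using abs by (intro summable_on_cmult_right) (simp add: abs_conv_def)
    have "norm2 g p \<le> infsum (\<lambda>x. \<rho> / q * norm (term2 g s x)) UNIV"
      unfolding norm2_def
      by (intro infsum_mono s le summable_on_comparison_test[OF s le]) auto
    then show ?thesis unfolding infsum_cmult_right' norm2_def[symmetric] \<rho>_def .
  qed
  define d where "d = min q (e * q / (norm2 g s + 1))"
  have N: "norm2 g s \<ge> 0" by (rule norm2_nonneg)
  have "d > 0" using q assms(2) N by (simp add: d_def)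
  moreover have "norm2 g p < e" if "dist p 0 < d" for p
  proof -
    have p: "norm p \<le> q" "norm p < e * q / (norm2 g s + 1)" using that by (auto simp: d_def)
    have "norm2 g p \<le> norm p / q * norm2 g s" by (rule bound[OF p(1)])
    also have "\<dots> \<le> norm p / q * (norm2 g s + 1)"
      using q by (intro mult_left_mono) auto
    also have "\<dots> < e" using p(2) q N by (simp add: field_simps)
    finally show ?thesis .
  qed
  ultimately show ?thesis by (auto simp: eventually_nhds_metric)
qed

lemma ev2_tendsto_0:
  assumes "g \<in> max_ideal"
  shows "(ev2 g \<longlongrightarrow> 0) (nhds 0)"
proof (rule tendstoI)
  fix e :: real assume "e > 0"
  show "\<forall>\<^sub>F p in nhds 0. dist (ev2 g p) 0 < e"
    using eventually_abs_conv[of g] norm2_small[OF assms \<open>e > 0\<close>]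
    by eventually_elim (use norm_ev2_le in fastforce)
qed

lemma chart_tendsto_0:
  assumes "u \<in> max_ideal" "v \<in> max_ideal"
  shows "filterlim (chart u v) (nhds 0) (nhds 0)"
proof -
  have "((\<lambda>p. (ev2 u p, ev2 v p)) \<longlongrightarrow> (0, 0)) (nhds 0)"
    by (intro tendsto_Pair ev2_tendsto_0 assms)
  then show ?thesis by (simp add: chart_def[abs_def] zero_prod_def)
qed


section \<open>Identity theorem\<close>

lemma power_series_coeffs_0:
  fixes a :: "nat \<Rightarrow> complex"
  assumes "r > 0" and s: "\<And>z. norm z < r \<Longrightarrow> ((\<lambda>i. a i * z ^ i) has_sum 0) UNIV"
  shows "a i = 0"
proof -
  have sums: "(\<lambda>i. a i * z ^ i) sums 0" if "norm z < r" for z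
    using s[OF that] by (rule has_sum_imp_sums)
  have "norm (of_real (r / 2) :: complex) \<le> conv_radius a"
    using assms(1) sums[of "of_real (r / 2)"] by (intro conv_radius_geI) (auto simp: sums_iff)
  then have "fps_conv_radius (Abs_fps a) > 0"
    using assms(1) unfolding fps_conv_radius_def
    by (auto simp: ereal_less(2) intro: less_le_trans[rotated])
  moreover have "\<forall>\<^sub>F z in nhds 0. eval_fps (Abs_fps a) z = eval_fps 0 z"
    using sums assms(1) by (auto simp: eventually_nhds_metric eval_fps_def sums_iff intro!: exI[of _ r])
  ultimately have "Abs_fps a = 0" by (intro eval_fps_eqD) auto
  then show ?thesis by (metis fps_nth_Abs_fps fps_zero_nth)
qed

text \<open>The identity theorem in one variable is used twice: for fixed \<open>w\<close> the
  coefficients of the series in \<open>z\<close> are the row sums at \<open>w\<close>, which hence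
  vanish; then each row is a vanishing series in \<open>w\<close>.\<close>

lemma cps2_eq_0I:
  assumes "\<forall>\<^sub>F p in nhds 0. ev2 g p = 0"
  shows "g = 0"
proof -
  obtain r1 where r1: "r1 > 0" "\<And>p. dist p 0 < r1 \<Longrightarrow> ev2 g p = 0"
    using assms by (auto simp: eventually_nhds_metric)
  obtain r2 where r2: "r2 > 0" "\<And>p. norm (fst p) < r2 \<Longrightarrow> norm (snd p) < r2 \<Longrightarrow> abs_conv g p"
    using abs_conv_radius by blast
  define r where "r = min (r1 / 2) r2"
  have r: "r > 0" using r1 r2 by (simp add: r_def)
  have abs: "abs_conv g (z, w)" if "norm z < r" "norm w < r" for z w
    using that by (intro r2) (auto simp: r_def)
  have ev: "ev2 g (z, w) = 0" if "norm z < r" "norm w < r" for z w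
  proof (rule r1)
    have "norm (z, w) \<le> norm z + norm w" by (rule norm_Pair_le)
    then show "dist (z, w) 0 < r1" using that by (auto simp: r_def)
  qed
  \<comment> \<open>A single row is summable as a slice of the double series at a nonzero
    \<open>z\<close>, whose power can be divided out.\<close>
  have inner: "(\<lambda>j. coeff2 g i j * w ^ j) summable_on UNIV" if w: "norm w < r" for i w
  proof -
    define z where "z = (of_real (r / 2) :: complex)"
    have z: "z \<noteq> 0" "norm z < r" using r by (auto simp: z_def)
    have "(\<lambda>(i, j). term2 g (z, w) (i, j)) summable_on UNIV \<times> UNIV"
      using abs_summable_summable abs[OF z(2) w] by (auto simp: abs_conv_def)
    then have "(\<lambda>j. term2 g (z, w) (i, j)) summable_on UNIV"
      by (rule summable_on_SigmaD1[where x = i and f = "\<lambda>i j. term2 g (z, w) (i, j)"]) simp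
    then have "(\<lambda>j. inverse (z ^ i) * term2 g (z, w) (i, j)) summable_on UNIV"
      by (rule summable_on_cmult_right)
    then show ?thesis using z by (simp add: term2_def field_simps)
  qed
  have row: "infsum (\<lambda>j. coeff2 g i j * w ^ j) UNIV = 0" if w: "norm w < r" for i w
  proof (rule power_series_coeffs_0[OF r, where a = "\<lambda>i. infsum (\<lambda>j. coeff2 g i j * w ^ j) UNIV"])
    fix z :: complex assume z: "norm z < r"
    have "term2 g (z, w) summable_on UNIV"
      using abs[OF z w] unfolding abs_conv_def by (rule abs_summable_summable)
    then have "(term2 g (z, w) has_sum 0) (UNIV \<times> UNIV)"
      using ev[OF z w] has_sum_infsum[of "term2 g (z, w)" UNIV] by (simp add: ev2_eq)
    then show "((\<lambda>i. infsum (\<lambda>j. coeff2 g i j * w ^ j) UNIV * z ^ i) has_sum 0) UNIV"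
    proof (rule has_sum_SigmaD)
      fix i
      have "((\<lambda>j. coeff2 g i j * w ^ j * z ^ i) has_sum infsum (\<lambda>j. coeff2 g i j * w ^ j) UNIV * z ^ i) UNIV"
        by (intro has_sum_cmult_left has_sum_infsum inner w)
      then show "((\<lambda>j. term2 g (z, w) (i, j)) has_sum infsum (\<lambda>j. coeff2 g i j * w ^ j) UNIV * z ^ i) UNIV"
        by (simp add: term2_def mult_ac)
    qed
  qed
  have "coeff2 g i j = 0" for i j
  proof (rule power_series_coeffs_0[OF r, where a = "\<lambda>j. coeff2 g i j"])
    fix w :: complex assume "norm w < r"
    then show "((\<lambda>j. coeff2 g i j * w ^ j) has_sum 0) UNIV"
      using row[of w i] has_sum_infsum[OF inner[of w i]] by simp
  qed
  then show ?thesis by (intro order2_ge_all_imp_0) (simp add: order2_ge_coeff)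
qed

lemma cps2_eqI_ev2:
  assumes "\<forall>\<^sub>F p in nhds 0. ev2 g p = ev2 h p"
  shows "g = h"
proof -
  have "\<forall>\<^sub>F p in nhds 0. ev2 (g - h) p = 0"
    using assms eventually_abs_conv[of g] eventually_abs_conv[of h]
    by eventually_elim (simp add: ev2_diff)
  then have "g - h = 0" by (rule cps2_eq_0I)
  then show ?thesis by simp
qed


section \<open>Composition\<close>

text \<open>Interchange of summation in the family \<open>T\<close>. Submultiplicativity of
  \<open>norm2\<close> bounds the inner sums of \<open>norm (T (ij, kl))\<close> by the terms of
  \<open>g\<close> at the real point \<open>(norm2 u p, norm2 v p)\<close>. Summing over
  \<open>kl\<close> first gives the value of \<open>g\<close> on the chart, summing over
  \<open>ij\<close> first gives a power series in \<open>p\<close>.\<close>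

lemma composition_sums:
  fixes g u v p
  defines "c \<equiv> \<lambda>kl. infsum (\<lambda>(i, j). coeff2 g i j * coeff2 (u ^ i * v ^ j) (fst kl) (snd kl)) UNIV"
  assumes u: "abs_conv u p" and v: "abs_conv v p"
    and g: "abs_conv g (of_real (norm2 u p), of_real (norm2 v p))"
  shows "((\<lambda>kl. c kl * fst p ^ fst kl * snd p ^ snd kl) has_sum ev2 g (chart u v p)) UNIV"
proof -
  define T where "T = (\<lambda>(ij, kl). coeff2 g (fst ij) (snd ij) * term2 (u ^ fst ij * v ^ snd ij) p kl)"
  have uv: "abs_conv (u ^ i * v ^ j) p" "ev2 (u ^ i * v ^ j) p = ev2 u p ^ i * ev2 v p ^ j"
    "norm2 (u ^ i * v ^ j) p \<le> norm2 u p ^ i * norm2 v p ^ j" for i j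
  proof -
    have *: "abs_conv (u ^ i) p \<and> ev2 (u ^ i) p = ev2 u p ^ i \<and> norm2 (u ^ i) p \<le> norm2 u p ^ i"
      "abs_conv (v ^ j) p \<and> ev2 (v ^ j) p = ev2 v p ^ j \<and> norm2 (v ^ j) p \<le> norm2 v p ^ j"
      using sums_power u v by auto
    show "abs_conv (u ^ i * v ^ j) p" "ev2 (u ^ i * v ^ j) p = ev2 u p ^ i * ev2 v p ^ j"
      using * abs_conv_mult by auto
    have "norm2 (u ^ i * v ^ j) p \<le> norm2 (u ^ i) p * norm2 (v ^ j) p"
      using * abs_conv_mult by auto
    also have "\<dots> \<le> norm2 u p ^ i * norm2 v p ^ j"
      using * by (intro mult_mono) (auto simp: norm2_nonneg)
    finally show "norm2 (u ^ i * v ^ j) p \<le> norm2 u p ^ i * norm2 v p ^ j" .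
  qed
  have "(\<lambda>x. norm (T x)) summable_on UNIV \<times> UNIV"
    unfolding Infinite_Sum.abs_summable_on_Sigma_iff
  proof (intro conjI ballI)
    fix ij :: "nat \<times> nat"
    show "(\<lambda>kl. norm (T (ij, kl))) summable_on UNIV"
      using uv(1) by (auto simp: T_def norm_mult abs_conv_def intro!: summable_on_cmult_right)
  next
    have "(\<lambda>ij. infsum (\<lambda>kl. norm (T (ij, kl))) UNIV) summable_on UNIV"
    proof (rule summable_on_comparison_test)
      show "(\<lambda>ij. norm (term2 g (of_real (norm2 u p), of_real (norm2 v p)) ij)) summable_on UNIV"
        using g by (simp add: abs_conv_def)
      fix ij :: "nat \<times> nat"
      show "infsum (\<lambda>kl. norm (T (ij, kl))) UNIV
          \<le> norm (term2 g (of_real (norm2 u p), of_real (norm2 v p)) ij)"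
        using mult_left_mono[OF uv(3)[of "fst ij" "snd ij"], of "norm (coeff2 g (fst ij) (snd ij))"]
        by (auto simp: T_def norm_mult infsum_cmult_right' term2_def norm_power norm2_nonneg
            mult.assoc norm2_def[of "_ * _"] split: prod.splits)
    qed (simp add: infsum_nonneg)
    then show "(\<lambda>ij. norm (infsum (\<lambda>kl. norm (T (ij, kl))) UNIV)) summable_on UNIV"
      by (simp add: infsum_nonneg)
  qed
  then have s: "T summable_on UNIV \<times> UNIV" by (rule abs_summable_summable)
  have "infsum (\<lambda>kl. T (ij, kl)) UNIV = term2 g (chart u v p) ij" for ij
    using uv(2)[of "fst ij" "snd ij"]
    by (auto simp: T_def infsum_cmult_right' term2_def chart_def mult.assoc ev2_eq[of "_ * _"]
        split: prod.splits)
  then have "infsum T (UNIV \<times> UNIV) = ev2 g (chart u v p)"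
    using infsum_Sigma_banach[OF s] by (simp add: ev2_eq)
  then have "(T has_sum ev2 g (chart u v p)) (UNIV \<times> UNIV)"
    using has_sum_infsum[OF s] by simp
  then have *: "((\<lambda>(kl, ij). T (ij, kl)) has_sum ev2 g (chart u v p)) (UNIV \<times> UNIV)"
    by (rule has_sum_swap[THEN iffD1])
  then show ?thesis
  proof (rule has_sum_SigmaD)
    fix kl :: "nat \<times> nat"
    have "(\<lambda>ij. T (ij, kl)) summable_on UNIV"
      using summable_on_SigmaD1[OF has_sum_imp_summable[OF *], of kl] by simp
    moreover have "infsum (\<lambda>ij. T (ij, kl)) UNIV = c kl * fst p ^ fst kl * snd p ^ snd kl"
    proof -
      have "infsum (\<lambda>ij. T (ij, kl)) UNIV = infsum (\<lambda>ij. (case ij of (i, j) \<Rightarrow>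
          coeff2 g i j * coeff2 (u ^ i * v ^ j) (fst kl) (snd kl)) * (fst p ^ fst kl * snd p ^ snd kl)) UNIV"
        by (intro infsum_cong) (auto simp: T_def term2_def split: prod.splits)
      then show ?thesis by (simp add: infsum_cmult_left' c_def mult.assoc)
    qed
    ultimately show "((\<lambda>ij. case (kl, ij) of (kl, ij) \<Rightarrow> T (ij, kl)) has_sum
        c kl * fst p ^ fst kl * snd p ^ snd kl) UNIV"
      using has_sum_infsum by fastforce
  qed
qed

lemma composition_exists:
  assumes "u \<in> max_ideal" "v \<in> max_ideal"
  shows "\<exists>c. \<forall>\<^sub>F p in nhds 0. ev2 c p = ev2 g (chart u v p)"
proof -
  obtain r where r: "r > 0" "\<And>p. norm (fst p) < r \<Longrightarrow> norm (snd p) < r \<Longrightarrow> abs_conv g p"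
    using abs_conv_radius by blast
  define c where "c = (\<lambda>kl. infsum (\<lambda>(i, j). coeff2 g i j * coeff2 (u ^ i * v ^ j) (fst kl) (snd kl)) UNIV)"
  have ev: "\<forall>\<^sub>F p in nhds 0. ((\<lambda>kl. c kl * fst p ^ fst kl * snd p ^ snd kl) has_sum ev2 g (chart u v p)) UNIV"
    using eventually_abs_conv[of u] eventually_abs_conv[of v]
      norm2_small[OF assms(1) r(1)] norm2_small[OF assms(2) r(1)]
  proof eventually_elim
    case (elim p)
    then show ?case unfolding c_def
      by (intro composition_sums r) (auto simp: norm2_nonneg)
  qed
  then obtain d where d: "d > 0" "\<And>p. dist p 0 < d \<Longrightarrow>
      ((\<lambda>kl. c kl * fst p ^ fst kl * snd p ^ snd kl) has_sum ev2 g (chart u v p)) UNIV"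
    by (auto simp: eventually_nhds_metric)
  define C where "C = Abs_fps (\<lambda>k. Abs_fps (\<lambda>l. c (k, l)))"
  have "convergent2 C"
    unfolding convergent2_def
  \<comment> \<open>Half of \<open>d\<close>, because the norm of a pair is at most the sum of the
    norms of its entries. The coefficients do not depend on the point, so summability near 0 is
    precisely convergence of \<open>C\<close>.\<close>
  proof (intro exI[of _ "d / 2"] conjI allI impI)
    fix z w :: complex assume "norm z < d / 2" "norm w < d / 2"
    then have "dist (z, w) 0 < d" using norm_Pair_le[of z w] by auto
    from has_sum_imp_summable[OF d(2)[OF this]]
    show "(\<lambda>(i, j). C $ i $ j * z ^ i * w ^ j) summable_on UNIV"
      by (simp add: C_def case_prod_unfold)
  qed (use d in simp)
  then have C: "coeff2 (Abs_cps2 C) i j = c (i, j)" for i j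
    by (simp add: coeff2.rep_eq Abs_cps2_inverse C_def)
  have "\<forall>\<^sub>F p in nhds 0. ev2 (Abs_cps2 C) p = ev2 g (chart u v p)"
    using ev by eventually_elim (simp add: ev2_def C case_prod_unfold infsumI)
  then show ?thesis by blast
qed

text \<open>The pullback \<open>g(u, v)\<close>, specified by its values near 0. For
  \<open>u\<close> and \<open>v\<close> in the maximal ideal the identity theorem makes it unique,
  and its algebraic laws are then checked pointwise.\<close>

definition comp2 :: "cps2 \<Rightarrow> cps2 \<Rightarrow> cps2 \<Rightarrow> cps2" where
  "comp2 u v g = (SOME c. \<forall>\<^sub>F p in nhds 0. ev2 c p = ev2 g (chart u v p))"

context
  fixes u v assumes uv: "u \<in> max_ideal" "v \<in> max_ideal"
begin

lemma ev2_comp2: "\<forall>\<^sub>F p in nhds 0. ev2 (comp2 u v g) p = ev2 g (chart u v p)"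
  unfolding comp2_def by (rule someI_ex[OF composition_exists[OF uv]])

lemma comp2_eqI:
  assumes "\<forall>\<^sub>F p in nhds 0. ev2 c p = ev2 g (chart u v p)"
  shows "comp2 u v g = c"
proof (rule cps2_eqI_ev2)
  show "\<forall>\<^sub>F p in nhds 0. ev2 (comp2 u v g) p = ev2 c p"
    using ev2_comp2[of g] assms by eventually_elim simp
qed

lemma eventually_chart: "\<forall>\<^sub>F p in nhds 0. P p \<Longrightarrow> \<forall>\<^sub>F p in nhds 0. P (chart u v p)"
  by (rule eventually_compose_filterlim[OF _ chart_tendsto_0[OF uv]])

lemma comp2_add: "comp2 u v (g + h) = comp2 u v g + comp2 u v h"
proof (rule comp2_eqI)
  show "\<forall>\<^sub>F p in nhds 0. ev2 (comp2 u v g + comp2 u v h) p = ev2 (g + h) (chart u v p)"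
    using ev2_comp2[of g] ev2_comp2[of h] eventually_abs_conv[of "comp2 u v g"]
      eventually_abs_conv[of "comp2 u v h"] eventually_chart[OF eventually_abs_conv[of g]]
      eventually_chart[OF eventually_abs_conv[of h]]
    by eventually_elim (simp add: ev2_add)
qed

lemma comp2_mult: "comp2 u v (g * h) = comp2 u v g * comp2 u v h"
proof (rule comp2_eqI)
  show "\<forall>\<^sub>F p in nhds 0. ev2 (comp2 u v g * comp2 u v h) p = ev2 (g * h) (chart u v p)"
    using ev2_comp2[of g] ev2_comp2[of h] eventually_abs_conv[of "comp2 u v g"]
      eventually_abs_conv[of "comp2 u v h"] eventually_chart[OF eventually_abs_conv[of g]]
      eventually_chart[OF eventually_abs_conv[of h]]
    by eventually_elim (simp add: abs_conv_mult)
qed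

lemma comp2_const [simp]: "comp2 u v (const2 c) = const2 c"
  by (rule comp2_eqI) (simp add: sums_const2)

lemma comp2_X2 [simp]: "comp2 u v X2 = u"
  by (rule comp2_eqI) (simp add: sums_X2 chart_def)

lemma comp2_Y2 [simp]: "comp2 u v Y2 = v"
  by (rule comp2_eqI) (simp add: sums_Y2 chart_def)

lemma comp2_0 [simp]: "comp2 u v 0 = 0"
  using comp2_const[of 0] by simp

lemma comp2_1 [simp]: "comp2 u v 1 = 1"
  using comp2_const[of 1] by simp

lemma comp2_diff: "comp2 u v (g - h) = comp2 u v g - comp2 u v h"
  using comp2_add[of "g - h" h] by simp

lemma comp2_dvd: "g dvd h \<Longrightarrow> comp2 u v g dvd comp2 u v h"
  by (auto elim!: dvdE simp: comp2_mult)

lemma comp2_comp2: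
  assumes xy: "x \<in> max_ideal" "y \<in> max_ideal"
    and id: "\<forall>\<^sub>F p in nhds 0. chart x y (chart u v p) = p"
  shows "comp2 u v (comp2 x y g) = g"
proof (rule comp2_eqI)
  have "\<forall>\<^sub>F p in nhds 0. ev2 (comp2 x y g) p = ev2 g (chart x y p)"
    unfolding comp2_def by (rule someI_ex[OF composition_exists[OF xy]])
  from eventually_chart[OF this] id
  show "\<forall>\<^sub>F p in nhds 0. ev2 g p = ev2 (comp2 x y g) (chart u v p)"
    by eventually_elim simp
qed

end

section \<open>First-order Taylor expansion and composition\<close>

lemma max_ideal_iff: "g \<in> max_ideal \<longleftrightarrow> order2_ge 1 g"
  by (simp only: max_ideal_def order2_ge_1_iff mem_Collect_eq)

lemma taylor1:
  obtains p q s where "g = const2 (coeff2 g 0 0) + const2 (coeff2 g 1 0) * X2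
    + const2 (coeff2 g 0 1) * Y2 + (X2 * X2 * p + X2 * Y2 * q + Y2 * Y2 * s)"
proof -
  obtain g1 g2 where g: "g = const2 (coeff2 g 0 0) + X2 * g1 + Y2 * g2" by (rule hadamard)
  obtain p1 q1 where g1: "g1 = const2 (coeff2 g1 0 0) + X2 * p1 + Y2 * q1" by (rule hadamard)
  obtain p2 q2 where g2: "g2 = const2 (coeff2 g2 0 0) + X2 * p2 + Y2 * q2" by (rule hadamard)
  have "coeff2 g 1 0 = coeff2 (const2 (coeff2 g 0 0) + X2 * g1 + Y2 * g2) 1 0" by (simp flip: g)
  then have c1: "coeff2 g 1 0 = coeff2 g1 0 0"
    by (simp add: coeff2_add coeff2_const2 coeff2_X2_mult coeff2_Y2_mult)
  have "coeff2 g 0 1 = coeff2 (const2 (coeff2 g 0 0) + X2 * g1 + Y2 * g2) 0 1" by (simp flip: g)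
  then have c2: "coeff2 g 0 1 = coeff2 g2 0 0"
    by (simp add: coeff2_add coeff2_const2 coeff2_X2_mult coeff2_Y2_mult)
  have "g = const2 (coeff2 g 0 0) + X2 * (const2 (coeff2 g1 0 0) + X2 * p1 + Y2 * q1)
      + Y2 * (const2 (coeff2 g2 0 0) + X2 * p2 + Y2 * q2)"
    using g by (simp flip: g1 g2)
  also have "\<dots> = const2 (coeff2 g 0 0) + const2 (coeff2 g 1 0) * X2
    + const2 (coeff2 g 0 1) * Y2 + (X2 * X2 * p1 + X2 * Y2 * (q1 + p2) + Y2 * Y2 * q2)"
    unfolding c1 c2 by (simp add: algebra_simps)
  finally show thesis by (rule that)
qed

lemma order2_ge_quadratic:
  assumes "order2_ge 1 x" "order2_ge 1 y"
  shows "order2_ge 2 (x * x * p + x * y * q + y * y * s)"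
proof -
  have "order2_ge 2 (x * x)" "order2_ge 2 (x * y)" "order2_ge 2 (y * y)"
    using assms order2_ge_mult[of 1 _ 1] by (auto simp: numeral_2_eq_2)
  then have "order2_ge 2 (x * x * p)" "order2_ge 2 (x * y * q)" "order2_ge 2 (y * y * s)"
    by (auto intro: order2_ge_mult1[of 2 "x * x"] order2_ge_mult1[of 2 "x * y"]
        order2_ge_mult1[of 2 "y * y"])
  then show ?thesis by (intro order2_ge_add)
qed

lemma taylor1_comp2:
  assumes "u \<in> max_ideal" "v \<in> max_ideal"
  shows "order2_ge 2 (comp2 u v g - (const2 (coeff2 g 0 0) + const2 (coeff2 g 1 0) * u + const2 (coeff2 g 0 1) * v))"
proof -
  obtain p q s where g: "g = const2 (coeff2 g 0 0) + const2 (coeff2 g 1 0) * X2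
    + const2 (coeff2 g 0 1) * Y2 + (X2 * X2 * p + X2 * Y2 * q + Y2 * Y2 * s)"
    by (rule taylor1)
  have "comp2 u v g = const2 (coeff2 g 0 0) + const2 (coeff2 g 1 0) * u
    + const2 (coeff2 g 0 1) * v + (u * u * comp2 u v p + u * v * comp2 u v q + v * v * comp2 u v s)"
    by (subst g) (simp only: comp2_add[OF assms] comp2_mult[OF assms] comp2_const[OF assms]
        comp2_X2[OF assms] comp2_Y2[OF assms])
  then show ?thesis
    using order2_ge_quadratic[of u v "comp2 u v p" "comp2 u v q" "comp2 u v s"] assms
    by (simp add: max_ideal_iff)
qed

lemma comp2_order_1:
  assumes "u \<in> max_ideal" "v \<in> max_ideal" "order2_ge 1 g"
  shows "order2_ge 1 (comp2 u v g)"
proof -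
  obtain g1 g2 where g: "g = const2 (coeff2 g 0 0) + X2 * g1 + Y2 * g2" by (rule hadamard)
  have "comp2 u v g = comp2 u v (X2 * g1 + Y2 * g2)"
    using assms(3)[unfolded order2_ge_1_iff] by (subst g) simp
  also have "\<dots> = u * comp2 u v g1 + v * comp2 u v g2"
    by (simp add: comp2_add[OF assms(1,2)] comp2_mult[OF assms(1,2)] comp2_X2[OF assms(1,2)] comp2_Y2[OF assms(1,2)])
  finally show ?thesis
    using assms by (auto simp: max_ideal_iff intro: order2_ge_add order2_ge_mult1)
qed

lemma comp2_order_2:
  assumes "u \<in> max_ideal" "v \<in> max_ideal" "order2_ge 2 g"
  shows "order2_ge 2 (comp2 u v g)"
proof -
  have "coeff2 g 0 0 = 0" "coeff2 g 1 0 = 0" "coeff2 g 0 1 = 0"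
    using assms(3) by (simp_all add: order2_ge_coeff)
  then show ?thesis using taylor1_comp2[OF assms(1,2), of g] by simp
qed


section \<open>Change of coordinates\<close>

locale local_coordinates =
  fixes x y u v :: cps2
  assumes x: "x \<in> max_ideal" and y: "y \<in> max_ideal"
    and u: "u \<in> max_ideal" and v: "v \<in> max_ideal"
    and uv_xy: "\<forall>\<^sub>F p in nhds 0. chart u v (chart x y p) = p"
    and xy_uv: "\<forall>\<^sub>F p in nhds 0. chart x y (chart u v p) = p"
begin

text \<open>\<open>expand\<close> writes a germ as a series in the coordinates \<open>x\<close> and
  \<open>y\<close>, and \<open>subst\<close> reads such a series as a germ; they are mutually
  inverse ring automorphisms.\<close>

abbreviation "subst \<equiv> comp2 x y"
abbreviation "expand \<equiv> comp2 u v"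

lemma subst_expand [simp]: "subst (expand g) = g"
  by (rule comp2_comp2[OF x y u v uv_xy])

lemma expand_subst [simp]: "expand (subst g) = g"
  by (rule comp2_comp2[OF u v x y xy_uv])

lemma expand_x [simp]: "expand x = X2"
  using expand_subst[of X2] by (simp only: comp2_X2[OF x y])

lemma expand_y [simp]: "expand y = Y2"
  using expand_subst[of Y2] by (simp only: comp2_Y2[OF x y])

lemma expansion_eq: "expansion x y g = expand g"
  unfolding expansion_def
proof (rule the_equality)
  show "\<forall>\<^sub>F p in nhds 0. ev2 g p = ev2 (expand g) (chart x y p)"
    using ev2_comp2[OF x y, of "expand g"] by (simp add: eq_commute)
  fix c assume "\<forall>\<^sub>F p in nhds 0. ev2 g p = ev2 c (chart x y p)"
  then have "subst c = g" by (rule comp2_eqI[OF x y])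
  then show "c = expand g" by auto
qed

lemma hom_comp_1: "hom_comp x y 1 g = const2 (coeff2 (expand g) 1 0) * x + const2 (coeff2 (expand g) 0 1) * y"
  by (simp add: hom_comp_def expansion_eq add.commute)

lemma order2_ge_hom_comp_1:
  assumes "order2_ge 1 g"
  shows "order2_ge 2 (g - hom_comp x y 1 g)"
proof -
  have "coeff2 (expand g) 0 0 = 0"
    using comp2_order_1[OF u v assms] by (simp only: order2_ge_1_iff)
  then show ?thesis
    using taylor1_comp2[OF x y, of "expand g"] unfolding hom_comp_1 by simp
qed

lemma hom_comp_1_eq_0:
  assumes "order2_ge 2 g"
  shows "hom_comp x y 1 g = 0"
  using comp2_order_2[OF u v assms] unfolding hom_comp_1 by (simp add: order2_ge_coeff)

lemma derivation_transport:
  assumes "derivation \<delta>"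
  shows "derivation (\<lambda>k. expand (\<delta> (subst k)))"
  unfolding derivation_def
  by (simp add: comp2_add[OF x y] comp2_add[OF u v] comp2_mult[OF x y] comp2_mult[OF u v]
       comp2_const[OF x y] comp2_const[OF u v] comp2_0[OF u v]
       derivation_add[OF assms] derivation_const[OF assms] derivation_mult[OF assms])

lemma squarefree_expand:
  assumes "squarefree f"
  shows "squarefree (expand f)"
  unfolding squarefree_def
proof (intro allI impI)
  fix g assume "g ^ 2 dvd expand f"
  then have "subst (g ^ 2) dvd subst (expand f)" by (rule comp2_dvd[OF x y])
  then have "subst g ^ 2 dvd f" by (simp add: power2_eq_square comp2_mult[OF x y])
  then have "subst g dvd 1" using assms by (auto simp: squarefree_def)
  then have "expand (subst g) dvd expand 1" by (rule comp2_dvd[OF u v])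
  then show "g dvd 1" by (simp add: comp2_1[OF u v])
qed

text \<open>The conjugate of \<open>\<delta>\<close> by the automorphism is again a derivation, and
  its values at \<open>X2\<close> and \<open>Y2\<close> are its components. Applying
  \<open>derivation_eq_partials\<close> to it takes the place of a chain rule.\<close>

lemma partials_transport:
  assumes "derivation \<delta>" "\<delta> f = h * f"
  shows "expand (\<delta> x) * dX2 (expand f) + expand (\<delta> y) * dY2 (expand f) = expand h * expand f"
proof -
  have "expand h * expand f = expand (\<delta> (subst (expand f)))"
    using assms(2) by (simp add: comp2_mult[OF u v])
  also have "\<dots> = expand (\<delta> (subst X2)) * dX2 (expand f) + expand (\<delta> (subst Y2)) * dY2 (expand f)"
    by (rule derivation_eq_partials[OF derivation_transport[OF assms(1)]])
  finally show ?thesis by (simp add: comp2_X2[OF x y] comp2_Y2[OF x y])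
qed

end

lemma local_coordsE:
  assumes "local_coords x y"
  obtains u v where "local_coordinates x y u v"
  using assms unfolding local_coords_def local_coordinates_def by blast

section \<open>Linear coordinate changes\<close>

definition linear2 :: "complex \<Rightarrow> complex \<Rightarrow> cps2" where
  "linear2 p q = const2 p * X2 + const2 q * Y2"

lemma coeff2_linear2 [simp]:
  "coeff2 (linear2 p q) 0 0 = 0" "coeff2 (linear2 p q) 1 0 = p" "coeff2 (linear2 p q) 0 1 = q"
  "coeff2 (linear2 p q) (Suc 0) 0 = p" "coeff2 (linear2 p q) 0 (Suc 0) = q"
  by (simp_all add: linear2_def coeff2_add coeff2_const_mult coeff2_X2 coeff2_Y2)

lemma ev2_linear2: "ev2 (linear2 p q) z = p * fst z + q * snd z"
  by (simp add: linear2_def ev2_add abs_conv_mult sums_const2 sums_X2 sums_Y2)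

lemma local_coords_linear2:
  assumes "p * s - q * r \<noteq> 0"
  shows "local_coords (linear2 p q) (linear2 r s)"
proof -
  define d where "d = p * s - q * r"
  have d: "d \<noteq> 0" using assms by (simp add: d_def)
  \<comment> \<open>The rows of the inverse matrix give the inverse chart.\<close>
  define u where "u = linear2 (s / d) (- q / d)"
  define v where "v = linear2 (- r / d) (p / d)"
  have in_max: "linear2 p q \<in> max_ideal" for p q by (simp add: max_ideal_def)
  have "chart u v (chart (linear2 p q) (linear2 r s) z) = z" for z
  proof (rule prod_eqI)
    have "s * (p * fst z + q * snd z) - q * (r * fst z + s * snd z) = d * fst z"
      by (simp add: d_def algebra_simps)
    then show "fst (chart u v (chart (linear2 p q) (linear2 r s) z)) = fst z"
      using d by (simp add: chart_def u_def ev2_linear2 field_simps)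
    have "p * (r * fst z + s * snd z) - r * (p * fst z + q * snd z) = d * snd z"
      by (simp add: d_def algebra_simps)
    then show "snd (chart u v (chart (linear2 p q) (linear2 r s) z)) = snd z"
      using d by (simp add: chart_def v_def ev2_linear2 field_simps)
  qed
  moreover have "chart (linear2 p q) (linear2 r s) (chart u v z) = z" for z
  proof (rule prod_eqI)
    have "p * (s * fst z - q * snd z) + q * (p * snd z - r * fst z) = d * fst z"
      by (simp add: d_def algebra_simps)
    then show "fst (chart (linear2 p q) (linear2 r s) (chart u v z)) = fst z"
      using d by (simp add: chart_def u_def v_def ev2_linear2 field_simps)
    have "r * (s * fst z - q * snd z) + s * (p * snd z - r * fst z) = d * snd z"
      by (simp add: d_def algebra_simps)
    then show "snd (chart (linear2 p q) (linear2 r s) (chart u v z)) = snd z"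
      using d by (simp add: chart_def u_def v_def ev2_linear2 field_simps)
  qed
  ultimately have "(\<forall>\<^sub>F z in nhds 0. chart u v (chart (linear2 p q) (linear2 r s) z) = z) \<and>
      (\<forall>\<^sub>F z in nhds 0. chart (linear2 p q) (linear2 r s) (chart u v z) = z)"
    by simp
  moreover have "u \<in> max_ideal" "v \<in> max_ideal" unfolding u_def v_def by (rule in_max)+
  ultimately show ?thesis
    unfolding local_coords_def using in_max by blast
qed

lemma order2_ge_2_iff: "order2_ge 2 g \<longleftrightarrow> coeff2 g 0 0 = 0 \<and> coeff2 g 1 0 = 0 \<and> coeff2 g 0 1 = 0"
proof -
  have "i + j < 2 \<longleftrightarrow> (i, j) \<in> {(0, 0), (1, 0), (0, 1)}" for i j :: nat by auto
  then show ?thesis unfolding order2_ge_coeff by auto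
qed


section \<open>Linear parts of logarithmic derivations\<close>

lemma semisimple_zero_eigenvalue_coords:
  assumes "local_coords x y" and sf: "squarefree f" and f: "order2_ge 2 f"
    and \<delta>: "derivation \<delta>" "order2_ge 2 (\<delta> x - x)" "order2_ge 2 (\<delta> y)"
    and h: "\<delta> f = h * f" "coeff2 h 0 0 = 0"
  shows False
proof -
  obtain u v where "local_coordinates x y u v" using assms(1) by (rule local_coordsE)
  then interpret local_coordinates x y u v .
  show False
  proof (rule semisimple_zero_eigenvalue_contradiction)
    show "squarefree (expand f)" by (rule squarefree_expand[OF sf])
    show "order2_ge 2 (expand f)" by (rule comp2_order_2[OF u v f])
    show "order2_ge 2 (expand (\<delta> x) - X2)"
      using comp2_order_2[OF u v \<delta>(2)] by (simp add: comp2_diff[OF u v])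
    show "order2_ge 2 (expand (\<delta> y))" by (rule comp2_order_2[OF u v \<delta>(3)])
    show "expand (\<delta> x) * dX2 (expand f) + expand (\<delta> y) * dY2 (expand f) = expand h * expand f"
      by (rule partials_transport[OF \<delta>(1) h(1)])
    show "coeff2 (expand h) 0 0 = 0"
      using comp2_order_1[OF u v, of h] h(2) unfolding order2_ge_1_iff by simp
  qed
qed

text \<open>
  If \<open>\<delta>\<close> does not vanish at the origin, then a linear form \<open>l\<close> with \<open>\<delta> l = 1\<close> at the origin makes
  \<open>l * \<delta>\<close> a logarithmic derivation with linear part \<open>l \<partial>\<^sub>l\<close>.
\<close>

lemma Der_vanishes_at_0:
  assumes sf: "squarefree f" and f: "order2_ge 2 f" and \<delta>: "\<delta> \<in> Der f"
  shows "order2_ge 1 (\<delta> g)"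
proof -
  define \<alpha> \<beta> where "\<alpha> = coeff2 (\<delta> X2) 0 0" and "\<beta> = coeff2 (\<delta> Y2) 0 0"
  have der: "derivation \<delta>" and "f dvd \<delta> f" using \<delta> by (auto simp: Der_def)
  then obtain h where h: "\<delta> f = f * h" by (elim dvdE)
  have lin: "\<delta> (linear2 p q) = const2 p * \<delta> X2 + const2 q * \<delta> Y2" for p q
    unfolding linear2_def by (simp only: derivation_add[OF der] derivation_scale[OF der])
  have "\<alpha> = 0 \<and> \<beta> = 0"
  proof (rule ccontr)
    assume "\<not> (\<alpha> = 0 \<and> \<beta> = 0)"
    then obtain l1 l2 where l: "l1 * \<alpha> + l2 * \<beta> = 1"
      by (metis add.left_neutral add.right_neutral left_inverse mult_zero_left)
    define x where "x = linear2 l1 l2"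
    \<comment> \<open>The linear form annihilating the value of \<open>\<delta>\<close> at the
      origin. The determinant of \<open>x\<close> and \<open>y\<close> is then
      \<open>l1 * \<alpha> + l2 * \<beta>\<close>, which is 1.\<close>
    define y where "y = linear2 (- \<beta>) \<alpha>"
    have x1: "order2_ge 1 x" by (simp add: x_def order2_ge_coeff)
    define \<epsilon> where "\<epsilon> = (\<lambda>k. x * \<delta> k + 0 * \<delta> k)"
    show False
    proof (rule semisimple_zero_eigenvalue_coords[OF _ sf f])
      show "local_coords x y"
        unfolding x_def y_def using l by (intro local_coords_linear2) simp
      show "derivation \<epsilon>" unfolding \<epsilon>_def by (intro derivation_combination der)
      have "coeff2 (\<delta> x - const2 1) 0 0 = 0"
        using l unfolding x_def lin
        by (simp only: coeff2_diff coeff2_add coeff2_const_mult coeff2_const2 \<alpha>_def \<beta>_def) simp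
      then have "order2_ge 1 (\<delta> x - const2 1)" by (simp only: order2_ge_1_iff)
      then have "order2_ge (1 + 1) (x * (\<delta> x - const2 1))" by (intro order2_ge_mult x1)
      moreover have "x * (\<delta> x - const2 1) = \<epsilon> x - x" by (simp add: \<epsilon>_def algebra_simps)
      ultimately show "order2_ge 2 (\<epsilon> x - x)" by (simp only: one_add_one)
      have "coeff2 (\<delta> y) 0 0 = 0"
        unfolding y_def lin
        by (simp only: coeff2_add coeff2_const_mult \<alpha>_def \<beta>_def) simp
      then have "order2_ge 1 (\<delta> y)" by (simp only: order2_ge_1_iff)
      then have "order2_ge (1 + 1) (x * \<delta> y)" by (intro order2_ge_mult x1)
      then show "order2_ge 2 (\<epsilon> y)" by (simp add: \<epsilon>_def numeral_2_eq_2)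
      \<comment> \<open>The factor \<open>x\<close> makes the cofactor vanish at the origin,
        whatever the value of \<open>h\<close> there.\<close>
      show "\<epsilon> f = (x * h) * f" by (simp add: \<epsilon>_def h mult_ac)
      show "coeff2 (x * h) 0 0 = 0" by (simp add: coeff2_mult_00 x_def)
    qed
  qed
  then have "order2_ge 1 (\<delta> X2)" "order2_ge 1 (\<delta> Y2)"
    unfolding order2_ge_1_iff \<alpha>_def \<beta>_def by auto
  then show ?thesis
    by (subst derivation_eq_partials[OF der]) (intro order2_ge_add order2_ge_mult1)
qed

text \<open>
  Comparing the leading form \<open>f\<^sub>n\<close> of \<open>f\<close> on both sides: \<open>X2 * dX2 f\<^sub>n\<close> is a multiple of \<open>f\<^sub>n\<close>, so \<open>f\<^sub>n\<close>
  is a monomial, and so is \<open>Y2 * dX2 f\<^sub>n\<close>, so \<open>f\<^sub>n\<close> is a power of \<open>Y2\<close>.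
\<close>

lemma linear_parts_contradiction:
  assumes sf: "squarefree f" and f: "order2_ge 2 f"
    and a1: "order2_ge 2 (a1 - X2)" and b1: "order2_ge 2 b1"
    and a2: "order2_ge 2 (a2 - linear2 a 1)" and b2: "order2_ge 2 b2"
    and eq1: "a1 * dX2 f + b1 * dY2 f = h1 * f" and eq2: "a2 * dX2 f + b2 * dY2 f = h2 * f"
  shows False
proof -
  have "Rep_cps2 f \<noteq> 0" using sf by auto
  then obtain n i j where n: "order_ge n (Rep_cps2 f)" "i + j = n" and c: "Rep_cps2 f $ i $ j \<noteq> 0"
    by (rule exists_order)
  have on: "order2_ge n f" using n(1) by (simp add: order2_ge.rep_eq)
  have c: "coeff2 f i j \<noteq> 0" using c by (simp add: coeff2.rep_eq)
  have "n \<noteq> 0" using f n(2) c by (intro notI) (simp add: order2_ge_coeff)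
  then obtain m where m: "n = Suc m" by (cases n) auto
  \<comment> \<open>Replacing the first component by its linear part \<open>l\<close>, dropping the
    second and freezing \<open>h\<close> at its value at 0 changes the equation only in degrees
    above \<open>n\<close>.\<close>
  have lead: "coeff2 (l * dX2 f) k k' = coeff2 h 0 0 * coeff2 f k k'"
    if "order2_ge 2 (a - l)" "order2_ge 2 b" "a * dX2 f + b * dY2 f = h * f" "k + k' = n"
    for a b l h k k'
  proof -
    have "order2_ge 1 (h - const2 (coeff2 h 0 0))"
      unfolding order2_ge_1_iff by (simp add: coeff2_diff coeff2_const2)
    then have "order2_ge (1 + n) ((h - const2 (coeff2 h 0 0)) * f)"
      by (intro order2_ge_mult on)
    moreover have "order2_ge (2 + m) ((a - l) * dX2 f)" "order2_ge (2 + m) (b * dY2 f)"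
      using order2_ge_mult[OF that(1) order2_ge_dX2[of m f]]
        order2_ge_mult[OF that(2) order2_ge_dY2[of m f]] on unfolding m by simp_all
    ultimately have "order2_ge (Suc n) ((h - const2 (coeff2 h 0 0)) * f - (a - l) * dX2 f - b * dY2 f)"
      unfolding m by (intro order2_ge_diff) simp_all
    also have "(h - const2 (coeff2 h 0 0)) * f - (a - l) * dX2 f - b * dY2 f
        = l * dX2 f - const2 (coeff2 h 0 0) * f"
      using that(3) by (simp add: algebra_simps)
    finally have "coeff2 (l * dX2 f - const2 (coeff2 h 0 0) * f) k k' = 0"
      using that(4) by (simp add: order2_ge_coeff)
    then show ?thesis by (simp add: coeff2_diff coeff2_const_mult)
  qed
  have E1: "of_nat k * coeff2 f k k' = coeff2 h1 0 0 * coeff2 f k k'" if "k + k' = n" for k k'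
    using lead[OF a1 b1 eq1 that] by (cases k) (simp_all add: coeff2_X2_mult coeff2_dX2)
  have i: "of_nat i = coeff2 h1 0 0" using E1[OF n(2)] c by simp
  have "i = 0"
  proof (rule ccontr)
    assume "i \<noteq> 0"
    then obtain k where k: "i = Suc k" by (cases i) auto
    \<comment> \<open>The position is one step from \<open>(i, j)\<close> along the leading form.
      There \<open>f\<close> has coefficient 0 by \<open>E1\<close>, so the second equation isolates
      the coefficient of \<open>Y2 * dX2 f\<close>, which is \<open>i\<close> times the nonzero
      coefficient at \<open>(i, j)\<close>.\<close>
    have kj: "k + Suc j = n" using k n(2) by simp
    have "(of_nat k - of_nat i :: complex) * coeff2 f k (Suc j) = 0"
      using E1[OF kj] unfolding i by (simp add: algebra_simps)
    then have 0: "coeff2 f k (Suc j) = 0" by (simp add: k)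
    have "coeff2 (linear2 a 1 * dX2 f) k (Suc j) = 0"
      using lead[OF a2 b2 eq2 kj] 0 by simp
    moreover have "linear2 a 1 * dX2 f = const2 a * (X2 * dX2 f) + Y2 * dX2 f"
      by (simp add: linear2_def algebra_simps)
    ultimately have "coeff2 (dX2 f) k j = 0"
      using 0 by (cases k) (simp_all add: coeff2_add coeff2_const_mult coeff2_X2_mult coeff2_Y2_mult coeff2_dX2)
    then show False using c by (simp add: coeff2_dX2 k del: of_nat_Suc)
  qed
  then have "coeff2 h1 0 0 = 0" using i by simp
  then show False by (rule semisimple_zero_eigenvalue_contradiction[OF sf f a1 b1 eq1])
qed

lemma linear_parts_coords_contradiction:
  assumes "local_coords x y" and sf: "squarefree f" and f: "order2_ge 2 f"
    and "\<delta>1 \<in> Der f" "\<delta>2 \<in> Der f"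
    and \<delta>1: "order2_ge 2 (\<delta>1 x - x)" "order2_ge 2 (\<delta>1 y)"
    and \<delta>2: "order2_ge 2 (\<delta>2 x - (const2 a * x + y))" "order2_ge 2 (\<delta>2 y)"
  shows False
proof -
  obtain u v where "local_coordinates x y u v" using assms(1) by (rule local_coordsE)
  then interpret local_coordinates x y u v .
  have der: "derivation \<delta>1" "derivation \<delta>2" using assms(4,5) by (auto simp: Der_def)
  obtain h1 where h1: "\<delta>1 f = h1 * f" using assms(4) by (auto simp: Der_def dvd_def mult.commute)
  obtain h2 where h2: "\<delta>2 f = h2 * f" using assms(5) by (auto simp: Der_def dvd_def mult.commute)
  show False
  proof (rule linear_parts_contradiction)
    show "squarefree (expand f)" by (rule squarefree_expand[OF sf])
    show "order2_ge 2 (expand f)" by (rule comp2_order_2[OF u v f])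
    show "order2_ge 2 (expand (\<delta>1 x) - X2)"
      using comp2_order_2[OF u v \<delta>1(1)] by (simp add: comp2_diff[OF u v])
    show "order2_ge 2 (expand (\<delta>1 y))" by (rule comp2_order_2[OF u v \<delta>1(2)])
    show "order2_ge 2 (expand (\<delta>2 x) - linear2 a 1)"
      using comp2_order_2[OF u v \<delta>2(1)]
      by (simp add: linear2_def comp2_diff[OF u v] comp2_add[OF u v] comp2_mult[OF u v]
          comp2_const[OF u v])
    show "order2_ge 2 (expand (\<delta>2 y))" by (rule comp2_order_2[OF u v \<delta>2(2)])
    show "expand (\<delta>1 x) * dX2 (expand f) + expand (\<delta>1 y) * dY2 (expand f) = expand h1 * expand f"
      by (rule partials_transport[OF der(1) h1])
    show "expand (\<delta>2 x) * dX2 (expand f) + expand (\<delta>2 y) * dY2 (expand f) = expand h2 * expand f"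
      by (rule partials_transport[OF der(2) h2])
  qed
qed

section \<open>Pairs of parallel linear vector fields\<close>

lemma dependent_pair:
  fixes g1 g2 k1 k2 :: complex
  assumes "g1 * k2 = g2 * k1"
  obtains c d where "c \<noteq> 0 \<or> d \<noteq> 0" "c * g1 + d * g2 = 0" "c * k1 + d * k2 = 0"
proof (cases "g1 = 0 \<and> g2 = 0")
  case False
  then show thesis using that[of g2 "- g1"] assms by (auto simp: algebra_simps)
next
  case True
  show thesis
  proof (cases "k1 = 0 \<and> k2 = 0")
    case False
    then show thesis using that[of k2 "- k1"] True by auto
  next
    case k: True
    then show thesis using that[of 1 0] True by auto
  qed
qed

text \<open>
  The hypotheses say that the linear vector fields with matrices \<open>(p1, q1; r1, s1)\<close> and
  \<open>(p2, q2; r2, s2)\<close> are everywhere parallel; either they are proportional or both have values in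
  the kernel of a common linear form \<open>(m, n)\<close>.
\<close>

lemma parallel_linear_fields:
  fixes p1 q1 r1 s1 p2 q2 r2 s2 :: complex
  assumes e1: "p1 * r2 = p2 * r1" and e2: "q1 * s2 = q2 * s1"
    and e3: "p1 * s2 + q1 * r2 = p2 * s1 + q2 * r1"
    and indep: "\<And>c d. c * p1 + d * p2 = 0 \<Longrightarrow> c * q1 + d * q2 = 0 \<Longrightarrow>
      c * r1 + d * r2 = 0 \<Longrightarrow> c * s1 + d * s2 = 0 \<Longrightarrow> c = 0 \<and> d = 0"
  obtains m n where "m \<noteq> 0 \<or> n \<noteq> 0" "m * p1 + n * r1 = 0" "m * q1 + n * s1 = 0"
    "m * p2 + n * r2 = 0" "m * q2 + n * s2 = 0"
proof -
  \<comment> \<open>\<open>D\<close> is the determinant of the first matrix and \<open>M\<close> its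
    polarization with the second. For parallel fields \<open>M\<close> times the first equals
    \<open>2 * D\<close> times the second, so independence forces \<open>D = 0\<close>.\<close>
  define D where "D = p1 * s1 - q1 * r1"
  define M where "M = p1 * s2 + p2 * s1 - q1 * r2 - q2 * r1"
  have "- M * p1 + 2 * D * p2 = 0" "- M * q1 + 2 * D * q2 = 0"
    "- M * r1 + 2 * D * r2 = 0" "- M * s1 + 2 * D * s2 = 0"
    unfolding M_def D_def using e1 e2 e3 by algebra+
  then have "2 * D = 0" using indep by blast
  then have "p1 * s1 = r1 * q1" by (simp add: D_def mult.commute)
  then obtain m n where mn: "m \<noteq> 0 \<or> n \<noteq> 0" "m * p1 + n * r1 = 0" "m * q1 + n * s1 = 0"
    by (rule dependent_pair)
  define g where "g = m * p2 + n * r2"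
  define k where "k = m * q2 + n * s2"
  have "\<not> (p1 = 0 \<and> q1 = 0 \<and> r1 = 0 \<and> s1 = 0)"
    using indep[of 1 0] by auto
  \<comment> \<open>These are the coefficients of the products of the linear form with coefficients
    \<open>g\<close> and \<open>k\<close> and the two components of the first field. Both products
    vanish, while the first field does not.\<close>
  moreover have "p1 * g = 0" "r1 * g = 0" "q1 * k = 0" "s1 * k = 0"
    "p1 * k + q1 * g = 0" "r1 * k + s1 * g = 0"
    unfolding g_def k_def using mn(2,3) e1 e2 e3 by algebra+
  ultimately have "g = 0 \<and> k = 0" by auto
  then show thesis using that[of m n] mn by (simp add: g_def k_def)
qed

text \<open>The determinant of two logarithmic fields is a multiple of \<open>f\<close>, so order 3
  kills its quadratic part, which is the determinant of the linear parts. If these were independent,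
  the common linear form \<open>(m, n)\<close> annihilating them would serve as \<open>y\<close>,
  and both would be linear multiples of the derivative along \<open>x\<close>.\<close>

lemma linear_parts_dependent:
  assumes sf: "squarefree f" and f: "order2_ge 3 f" and Der: "\<delta>1 \<in> Der f" "\<delta>2 \<in> Der f"
  obtains c d where "c \<noteq> 0 \<or> d \<noteq> 0" "order2_ge 2 (const2 c * \<delta>1 X2 + const2 d * \<delta>2 X2)"
    "order2_ge 2 (const2 c * \<delta>1 Y2 + const2 d * \<delta>2 Y2)"
proof (rule ccontr)
  note dependence = that
  assume "\<not> thesis"
  have f2: "order2_ge 2 f" using f by (rule order2_ge_mono) simp
  have van: "coeff2 (\<delta>1 g) 0 0 = 0" "coeff2 (\<delta>2 g) 0 0 = 0" for g
    using Der_vanishes_at_0[OF sf f2] Der unfolding order2_ge_1_iff by blast+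
  define p1 q1 where "p1 = coeff2 (\<delta>1 X2) 1 0" and "q1 = coeff2 (\<delta>1 X2) 0 1"
  define r1 s1 where "r1 = coeff2 (\<delta>1 Y2) 1 0" and "s1 = coeff2 (\<delta>1 Y2) 0 1"
  define p2 q2 where "p2 = coeff2 (\<delta>2 X2) 1 0" and "q2 = coeff2 (\<delta>2 X2) 0 1"
  define r2 s2 where "r2 = coeff2 (\<delta>2 Y2) 1 0" and "s2 = coeff2 (\<delta>2 Y2) 0 1"
  note defs = p1_def q1_def r1_def s1_def p2_def q2_def r2_def s2_def
  have indep: "c = 0 \<and> d = 0" if "c * p1 + d * p2 = 0" "c * q1 + d * q2 = 0"
    "c * r1 + d * r2 = 0" "c * s1 + d * s2 = 0" for c d
  proof (rule ccontr)
    assume "\<not> (c = 0 \<and> d = 0)"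
    moreover have "order2_ge 2 (const2 c * \<delta>1 X2 + const2 d * \<delta>2 X2)"
      "order2_ge 2 (const2 c * \<delta>1 Y2 + const2 d * \<delta>2 Y2)"
      using that unfolding order2_ge_2_iff coeff2_add coeff2_const_mult van defs by simp_all
    ultimately have thesis by (intro dependence[of c d]) auto
    then show False using \<open>\<not> thesis\<close> by contradiction
  qed
  have "f dvd \<delta>1 X2 * \<delta>2 Y2 - \<delta>2 X2 * \<delta>1 Y2" by (rule saito_dvd_det[OF sf Der])
  then have "order2_ge 3 (\<delta>1 X2 * \<delta>2 Y2 - \<delta>2 X2 * \<delta>1 Y2)"
    using f by (auto elim!: dvdE intro: order2_ge_mult1)
  then have det: "coeff2 (\<delta>1 X2 * \<delta>2 Y2 - \<delta>2 X2 * \<delta>1 Y2) i j = 0" if "i + j < 3" for i j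
    using that by (simp add: order2_ge_coeff)
  have e1: "p1 * r2 = p2 * r1"
    using det[of 2 0] van by (simp add: coeff2_diff coeff2_mult numeral_2_eq_2 defs)
  have e2: "q1 * s2 = q2 * s1"
    using det[of 0 2] van by (simp add: coeff2_diff coeff2_mult numeral_2_eq_2 defs)
  have e3: "p1 * s2 + q1 * r2 = p2 * s1 + q2 * r1"
    using det[of 1 1] van by (simp add: coeff2_diff coeff2_mult defs algebra_simps)
  obtain m n where mn: "m \<noteq> 0 \<or> n \<noteq> 0" "m * p1 + n * r1 = 0" "m * q1 + n * s1 = 0"
    "m * p2 + n * r2 = 0" "m * q2 + n * s2 = 0"
    by (rule parallel_linear_fields[OF e1 e2 e3 indep])
  \<comment> \<open>Completes \<open>(m, n)\<close> to a unimodular matrix; \<open>(r, s)\<close>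
    becomes the coordinate \<open>x\<close>.\<close>
  obtain r s where rs: "m * s - n * r = 1"
  proof (cases "m = 0")
    case True
    then show thesis using that[of 0 "- inverse n"] mn(1) by simp
  next
    case False
    then show thesis using that[of "inverse m" 0] by simp
  qed
  define g1 k1 where "g1 = r * p1 + s * r1" and "k1 = r * q1 + s * s1"
  define g2 k2 where "g2 = r * p2 + s * r2" and "k2 = r * q2 + s * s2"
  \<comment> \<open>A vector annihilated by \<open>(m, n)\<close> is its value under
    \<open>(r, s)\<close> times \<open>(- n, m)\<close>. So \<open>g1\<close>, \<open>k1\<close>,
    \<open>g2\<close>, \<open>k2\<close>, the coefficients of the linear parts of
    \<open>\<delta>1 x\<close> and \<open>\<delta>2 x\<close>, determine both fields to first
    order.\<close>
  have kernel: "p = - n * (r * p + s * t) \<and> t = m * (r * p + s * t)" if "m * p + n * t = 0" for p t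
    using that rs by algebra
  have rec: "p1 = - n * g1" "r1 = m * g1" "q1 = - n * k1" "s1 = m * k1"
    "p2 = - n * g2" "r2 = m * g2" "q2 = - n * k2" "s2 = m * k2"
    unfolding g1_def k1_def g2_def k2_def using mn(2-)[THEN kernel] by blast+
  define E where "E = g1 * k2 - g2 * k1"
  have "E \<noteq> 0"
  proof
    assume "E = 0"
    then have "g1 * k2 = g2 * k1" by (simp add: E_def)
    then obtain c d where cd: "c \<noteq> 0 \<or> d \<noteq> 0" "c * g1 + d * g2 = 0" "c * k1 + d * k2 = 0"
      by (rule dependent_pair)
    have "c * p1 + d * p2 = 0" "c * q1 + d * q2 = 0" "c * r1 + d * r2 = 0" "c * s1 + d * s2 = 0"
      unfolding rec using cd(2,3) by algebra+
    then show False using indep cd(1) by blast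
  qed
  \<comment> \<open>Since \<open>E\<close> is nonzero, some constant combination of the two fields
    has any prescribed linear form as the linear part of its \<open>x\<close> component. The forms
    \<open>x\<close> and \<open>y\<close> themselves are prescribed below, which is the excluded
    situation with \<open>a = 0\<close>.\<close>
  have Cramer: "((w * k2 - z * g2) / E) * g1 + ((z * g1 - w * k1) / E) * g2 = w"
    "((w * k2 - z * g2) / E) * k1 + ((z * g1 - w * k1) / E) * k2 = z" for w z
  proof -
    have "(w * k2 - z * g2) * g1 + (z * g1 - w * k1) * g2 = w * E"
      "(w * k2 - z * g2) * k1 + (z * g1 - w * k1) * k2 = z * E"
      by (simp_all add: E_def algebra_simps)
    then show "((w * k2 - z * g2) / E) * g1 + ((z * g1 - w * k1) / E) * g2 = w"
      "((w * k2 - z * g2) / E) * k1 + ((z * g1 - w * k1) / E) * k2 = z"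
      using \<open>E \<noteq> 0\<close> by (simp_all add: field_simps)
  qed
  obtain a b where ab: "a * g1 + b * g2 = r" "a * k1 + b * k2 = s" using Cramer[of r s] by blast
  obtain a' b' where ab': "a' * g1 + b' * g2 = m" "a' * k1 + b' * k2 = n" using Cramer[of m n] by blast
  define x where "x = linear2 r s"
  define y where "y = linear2 m n"
  have lin: "\<delta> (linear2 p q) = const2 p * \<delta> X2 + const2 q * \<delta> Y2" if "\<delta> \<in> Der f" for p q \<delta>
    using that unfolding linear2_def Der_def by (auto simp: derivation_add derivation_scale)
  note lin12 = lin[OF Der(1)] lin[OF Der(2)]
  define \<epsilon>1 where "\<epsilon>1 = (\<lambda>k. const2 a * \<delta>1 k + const2 b * \<delta>2 k)"
  define \<epsilon>2 where "\<epsilon>2 = (\<lambda>k. const2 a' * \<delta>1 k + const2 b' * \<delta>2 k)"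
  have c1: "coeff2 (\<delta>1 x) 1 0 = g1" "coeff2 (\<delta>1 x) 0 1 = k1"
    "coeff2 (\<delta>2 x) 1 0 = g2" "coeff2 (\<delta>2 x) 0 1 = k2"
    unfolding x_def lin12 g1_def k1_def g2_def k2_def defs
    by (simp_all only: coeff2_add coeff2_const_mult)
  have c2: "coeff2 (\<delta>1 y) 1 0 = 0" "coeff2 (\<delta>1 y) 0 1 = 0"
    "coeff2 (\<delta>2 y) 1 0 = 0" "coeff2 (\<delta>2 y) 0 1 = 0"
    using mn(2-) unfolding y_def lin12 defs by (simp_all only: coeff2_add coeff2_const_mult)
  show False
  proof (rule linear_parts_coords_contradiction[OF _ sf f2])
    have "r * n - s * m = - 1" using rs by (simp add: algebra_simps)
    then show "local_coords x y" unfolding x_def y_def by (intro local_coords_linear2) simp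
    show "\<epsilon>1 \<in> Der f" "\<epsilon>2 \<in> Der f" unfolding \<epsilon>1_def \<epsilon>2_def by (intro Der_combination Der)+
    show "order2_ge 2 (\<epsilon>1 x - x)" "order2_ge 2 (\<epsilon>1 y)"
      "order2_ge 2 (\<epsilon>2 x - (const2 0 * x + y))" "order2_ge 2 (\<epsilon>2 y)"
      unfolding order2_ge_2_iff \<epsilon>1_def \<epsilon>2_def coeff2_diff coeff2_add coeff2_const_mult c1 c2 van
      using ab ab' by (simp_all add: x_def y_def)
  qed
qed


section \<open>Changing the basis\<close>

lemma Der_basisE:
  assumes "Der_basis f \<delta>1 \<delta>2" "\<delta> \<in> Der f"
  obtains g h where "\<delta> = (\<lambda>k. g * \<delta>1 k + h * \<delta>2 k)"
    "\<And>g' h'. \<delta> = (\<lambda>k. g' * \<delta>1 k + h' * \<delta>2 k) \<Longrightarrow> g' = g \<and> h' = h"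
proof -
  have "\<exists>!z. case z of (g, h) \<Rightarrow> \<delta> = (\<lambda>k. g * \<delta>1 k + h * \<delta>2 k)"
    using assms unfolding Der_basis_def by blast
  then obtain z where z: "case z of (g, h) \<Rightarrow> \<delta> = (\<lambda>k. g * \<delta>1 k + h * \<delta>2 k)"
    and unique: "\<And>w. case w of (g, h) \<Rightarrow> \<delta> = (\<lambda>k. g * \<delta>1 k + h * \<delta>2 k) \<Longrightarrow> w = z"
    by (elim ex1E) blast
  show thesis
  proof (rule that[of "fst z" "snd z"])
    show "\<delta> = (\<lambda>k. fst z * \<delta>1 k + snd z * \<delta>2 k)" using z by (simp add: case_prod_beta)
    fix g' h' assume "\<delta> = (\<lambda>k. g' * \<delta>1 k + h' * \<delta>2 k)"
    then show "g' = fst z \<and> h' = snd z" using unique[of "(g', h')"] by auto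
  qed
qed

lemma Der_basis_swap:
  assumes "Der_basis f \<delta>1 \<delta>2"
  shows "Der_basis f \<delta>2 \<delta>1"
proof -
  have "\<exists>!(g, h). \<delta> = (\<lambda>k. g * \<delta>2 k + h * \<delta>1 k)" if \<delta>: "\<delta> \<in> Der f" for \<delta>
  proof -
    obtain g h where gh: "\<delta> = (\<lambda>k. g * \<delta>1 k + h * \<delta>2 k)"
      and unique: "\<And>g' h'. \<delta> = (\<lambda>k. g' * \<delta>1 k + h' * \<delta>2 k) \<Longrightarrow> g' = g \<and> h' = h"
      using Der_basisE[OF assms \<delta>] by metis
    show ?thesis
    proof (rule ex1I[of _ "(h, g)"])
      show "case (h, g) of (g, h) \<Rightarrow> \<delta> = (\<lambda>k. g * \<delta>2 k + h * \<delta>1 k)"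
        using gh by (simp add: add.commute)
      fix z assume "case z of (g, h) \<Rightarrow> \<delta> = (\<lambda>k. g * \<delta>2 k + h * \<delta>1 k)"
      then show "z = (h, g)"
        using unique[of "snd z" "fst z"] by (auto simp: add.commute split: prod.splits)
    qed
  qed
  then show ?thesis using assms unfolding Der_basis_def by blast
qed

lemma Der_basis_combination:
  assumes basis: "Der_basis f \<delta>1 \<delta>2" and "c \<noteq> 0"
  shows "Der_basis f (\<lambda>k. const2 c * \<delta>1 k + const2 d * \<delta>2 k) \<delta>2"
proof -
  define c' where "c' = const2 (inverse c)"
  have c': "c' * const2 c = 1" using \<open>c \<noteq> 0\<close> by (simp add: c'_def flip: const2_mult)
  have eq: "(\<lambda>k. g * (const2 c * \<delta>1 k + const2 d * \<delta>2 k) + h * \<delta>2 k)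
      = (\<lambda>k. (g * const2 c) * \<delta>1 k + (g * const2 d + h) * \<delta>2 k)" for g h
    by (simp add: algebra_simps)
  have "\<exists>!(g, h). \<delta> = (\<lambda>k. g * (const2 c * \<delta>1 k + const2 d * \<delta>2 k) + h * \<delta>2 k)"
    if \<delta>: "\<delta> \<in> Der f" for \<delta>
  proof -
    obtain g h where gh: "\<delta> = (\<lambda>k. g * \<delta>1 k + h * \<delta>2 k)"
      and unique: "\<And>g' h'. \<delta> = (\<lambda>k. g' * \<delta>1 k + h' * \<delta>2 k) \<Longrightarrow> g' = g \<and> h' = h"
      using Der_basisE[OF basis \<delta>] by metis
    have g: "g * c' * const2 c = g" using c' by (simp add: mult.assoc)
    show ?thesis unfolding eq
    \<comment> \<open>Obtained by solving the triangular system for the old coefficients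
      \<open>g\<close> and \<open>h\<close>; \<open>c'\<close> is the inverse of the constant
      \<open>c\<close>.\<close>
    proof (rule ex1I[of _ "(g * c', h - g * c' * const2 d)"])
      show "case (g * c', h - g * c' * const2 d) of (g, h) \<Rightarrow>
          \<delta> = (\<lambda>k. (g * const2 c) * \<delta>1 k + (g * const2 d + h) * \<delta>2 k)"
        unfolding prod.case g by (simp add: gh)
      fix z assume "case z of (g, h) \<Rightarrow> \<delta> = (\<lambda>k. (g * const2 c) * \<delta>1 k + (g * const2 d + h) * \<delta>2 k)"
      then have z: "fst z * const2 c = g" "fst z * const2 d + snd z = h"
        using unique[of "fst z * const2 c" "fst z * const2 d + snd z"] by (auto split: prod.splits)
      have "fst z = g * c'" using z(1) c' by (metis mult.assoc mult.commute mult.right_neutral)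
      then show "z = (g * c', h - g * c' * const2 d)"
        using z(2) by (intro prod_eqI) (auto simp: algebra_simps)
    qed
  qed
  moreover have "\<delta>1 \<in> Der f" "\<delta>2 \<in> Der f" using basis by (auto simp: Der_basis_def)
  ultimately show ?thesis
    unfolding Der_basis_def by (auto intro: Der_combination)
qed

section \<open>Powers of the maximal ideal and the final argument\<close>

lemma order2_ge_sum:
  "(\<And>i. i \<in> A \<Longrightarrow> order2_ge n (f i)) \<Longrightarrow> order2_ge n (sum f A)"
  by (induction A rule: infinite_finite_induct) (auto intro: order2_ge_add)

lemma ideal_power_order: "f \<in> ideal_power max_ideal n \<Longrightarrow> order2_ge n f"
proof (induction n arbitrary: f)
  case (Suc n)
  then obtain N :: nat and a b where f: "f = (\<Sum>k<N. a k * b k)"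
    and "\<forall>k<N. a k \<in> max_ideal" "\<forall>k<N. b k \<in> ideal_power max_ideal n"
    by (auto simp: ideal_mult_def)
  then have "order2_ge (1 + n) (a k * b k)" if "k < N" for k
    using that Suc.IH by (intro order2_ge_mult) (auto simp: max_ideal_iff)
  then show ?case unfolding f by (intro order2_ge_sum) auto
qed simp

theorem corollaryA1:
  fixes D :: "(complex \<times> complex) set" and f :: cps2
  assumes "local_equation f D" and "squarefree f" and "f \<in> ideal_power max_ideal 3"
  shows "\<not> (\<exists>x y \<delta>1 \<delta>2 a. local_coords x y \<and> Der_basis f \<delta>1 \<delta>2 \<and>
             linear_part x y \<delta>1 = (x, 0) \<and> linear_part x y \<delta>2 = (const2 a * x + y, 0)) \<and>
         (\<exists>\<delta>1 \<delta>2. Der_basis f \<delta>1 \<delta>2 \<and>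
             (\<forall>x y. local_coords x y \<longrightarrow> linear_part x y \<delta>1 = (0, 0)))"
proof (intro conjI notI; (elim exE conjE)?)
  have f3: "order2_ge 3 f" by (rule ideal_power_order[OF assms(3)])
  then have f2: "order2_ge 2 f" by (rule order2_ge_mono) simp
  {
    fix x y \<delta>1 \<delta>2 a
    assume xy: "local_coords x y" and basis: "Der_basis f \<delta>1 \<delta>2"
      and l1: "linear_part x y \<delta>1 = (x, 0)" and l2: "linear_part x y \<delta>2 = (const2 a * x + y, 0)"
    obtain u v where "local_coordinates x y u v" using xy by (rule local_coordsE)
    then interpret local_coordinates x y u v .
    have Der: "\<delta>1 \<in> Der f" "\<delta>2 \<in> Der f" using basis by (auto simp: Der_basis_def)
    \<comment> \<open>The linear part does not record constant terms; these are excluded because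
      logarithmic derivations vanish at the origin.\<close>
    have lin: "order2_ge 2 (\<delta> x - fst (linear_part x y \<delta>))" "order2_ge 2 (\<delta> y - snd (linear_part x y \<delta>))"
      if "\<delta> \<in> Der f" for \<delta>
      unfolding linear_part_def fst_conv snd_conv
      by (intro order2_ge_hom_comp_1 Der_vanishes_at_0[OF assms(2) f2 that])+
    show False
      using linear_parts_coords_contradiction[OF xy assms(2) f2 Der] lin[OF Der(1)] lin[OF Der(2)]
      unfolding l1 l2 fst_conv snd_conv diff_0_right by blast
  }
  have "f \<noteq> 0" using assms(2) by auto
  then obtain \<delta>1 \<delta>2 where basis: "Der_basis f \<delta>1 \<delta>2" by (rule Der_basis_exists)
  then have Der: "\<delta>1 \<in> Der f" "\<delta>2 \<in> Der f" by (auto simp: Der_basis_def)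
  obtain c d where cd: "c \<noteq> 0 \<or> d \<noteq> 0" "order2_ge 2 (const2 c * \<delta>1 X2 + const2 d * \<delta>2 X2)"
    "order2_ge 2 (const2 c * \<delta>1 Y2 + const2 d * \<delta>2 Y2)"
    by (rule linear_parts_dependent[OF assms(2) f3 Der])
  define \<epsilon> where "\<epsilon> = (\<lambda>k. const2 c * \<delta>1 k + const2 d * \<delta>2 k)"
  have "\<exists>\<delta>. Der_basis f \<epsilon> \<delta>"
  \<comment> \<open>The combination replaces whichever basis element has a nonzero coefficient,
    after a swap if that is the second one.\<close>
  proof (cases "c = 0")
    case False
    then show ?thesis unfolding \<epsilon>_def using Der_basis_combination[OF basis] by blast
  next
    case True
    then have "Der_basis f (\<lambda>k. const2 d * \<delta>2 k + const2 c * \<delta>1 k) \<delta>1"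
      using cd(1) by (intro Der_basis_combination Der_basis_swap[OF basis]) simp
    then show ?thesis unfolding \<epsilon>_def by (auto simp: add.commute)
  qed
  \<comment> \<open>Both components of \<open>\<epsilon>\<close> have order at least 2, hence so
    does every value of \<open>\<epsilon>\<close>, in particular its values at \<open>x\<close> and
    \<open>y\<close> for any coordinates.\<close>
  moreover have "linear_part x y \<epsilon> = (0, 0)" if xy: "local_coords x y" for x y
  proof -
    obtain u v where "local_coordinates x y u v" using xy by (rule local_coordsE)
    then interpret local_coordinates x y u v .
    have "derivation \<epsilon>" using Der_combination[OF Der] by (auto simp: \<epsilon>_def Der_def)
    then have "\<epsilon> g = \<epsilon> X2 * dX2 g + \<epsilon> Y2 * dY2 g" for g by (rule derivation_eq_partials)
    moreover have "order2_ge 2 (\<epsilon> X2 * dX2 g + \<epsilon> Y2 * dY2 g)" for g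
      unfolding \<epsilon>_def by (rule order2_ge_add[OF cd(2,3)[THEN order2_ge_mult1]])
    ultimately have "order2_ge 2 (\<epsilon> g)" for g by metis
    then show ?thesis by (simp only: linear_part_def hom_comp_1_eq_0)
  qed
  ultimately show "\<exists>\<delta>1 \<delta>2. Der_basis f \<delta>1 \<delta>2 \<and>
      (\<forall>x y. local_coords x y \<longrightarrow> linear_part x y \<delta>1 = (0, 0))" by blast
qed

end
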